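(* Let $\mu\in\mathbb R$, let $h:\mathbb R\to\mathbb R$ satisfy Condition (H) for this $\mu$, and let $N$ be the number of connected components of $\Omega=\{\xi\in\mathbb R:h(\xi)<\mu\}$. Let $f$ satisfy Condition (F) with $n=2$, some $t_0\in\mathbb R$, some $\gamma>0$ and some $R\le1$. Then, as $T\downarrow0$, $$\mathcal B(a_{T,\mu};f)=\frac{N}{2\pi^2}\,U(1,0;f)\,|\log T|+O(1).$$
   Context: Fermi symbol: $a_{T,\mu}(\xi)=\bigl(1+\exp((h(\xi)-\mu)/T)\bigr)^{-1}$, $\xi\in\mathbb R$, $T>0$. Condition (H) (in dimension one): (1) $h\in C^\infty(\mathbb R)$ is real-valued; for some $\beta_1>0,c>0$, $h(\xi)\ge c|\xi|^{\beta_1}$ for all sufficiently large $|\xi|$; and for some $\beta_2\ge0$ and constants $C_k$, $|h^{(k)}(\xi)|\le C_k(1+|\xi|)^{\beta_2}$ for all $k\ge1$, $\xi\in\mathbb R$. (2) $h'(\xi)\ne0$ whenever $h(\xi)=\mu$. (3) $\Omega=\{\xi:h(\xi)<\mu\}$ has finitely many connected components; thus $\Omega$ is a union of $N<\infty$ bounded open intervals with pairwise disjoint closures. Condition (F) (with integer $n\ge1$, $\gamma>0$, $t_0\in\mathbb R$, $R>0$): $f\in C^n(\mathbb R\setminus\{t_0\})\cap C(\mathbb R)$, $\max_{0\le k\le n}\sup_{t\ne t_0}|f^{(k)}(t)||t-t_0|^{-\gamma+k}<\infty$, and $f$ is supported on $(t_0-R,t_0+R)$. Coefficient. $U(s_1,s_2;g)=\int_0^1\frac{g((1-t)s_1+ts_2)-[(1-t)g(s_1)+tg(s_2)]}{t(1-t)}\,dt$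 and $\mathcal B(a;g)=\frac1{8\pi^2}\lim_{\varepsilon\downarrow0}\iint_{|\xi_1-\xi_2|>\varepsilon}\frac{U(a(\xi_1),a(\xi_2);g)}{|\xi_1-\xi_2|^2}\,d\xi_1d\xi_2$. *)

theory Defs
  imports "HOL-Analysis.Analysis" "HOL-Library.Landau_Symbols"
begin

definition nderiv :: "nat \<Rightarrow> (real \<Rightarrow> 'a::real_normed_vector) \<Rightarrow> real \<Rightarrow> 'a" where
  "nderiv k f = ((\<lambda>g t. vector_derivative g (at t)) ^^ k) f"

text \<open>Intended for open \<open>S\<close>, where \<open>at t\<close> and \<open>at t within S\<close> agree. The differentiability
  clause is needed because \<^const>\<open>vector_derivative\<close> is total.\<close>

definition C_on :: "nat \<Rightarrow> real set \<Rightarrow> (real \<Rightarrow> 'a::real_normed_vector) \<Rightarrow> bool" where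
  "C_on n S f \<longleftrightarrow>
     (\<forall>k<n. \<forall>t\<in>S. nderiv k f differentiable (at t)) \<and>
     (\<forall>k\<le>n. continuous_on S (nderiv k f))"

definition fermi :: "(real \<Rightarrow> real) \<Rightarrow> real \<Rightarrow> real \<Rightarrow> real \<Rightarrow> real" where
  "fermi h \<mu> T \<xi> = 1 / (1 + exp ((h \<xi> - \<mu>) / T))"

definition sublevel :: "(real \<Rightarrow> real) \<Rightarrow> real \<Rightarrow> real set" where
  "sublevel h \<mu> = {\<xi>. h \<xi> < \<mu>}"

definition condition_H :: "(real \<Rightarrow> real) \<Rightarrow> real \<Rightarrow> bool" where
  "condition_H h \<mu> \<longleftrightarrow>
     (\<forall>n. C_on n UNIV h) \<and>
     (\<exists>\<beta>1>0. \<exists>c>0. \<exists>r. \<forall>\<xi>. \<bar>\<xi>\<bar> \<ge> r \<longrightarrow> h \<xi> \<ge> c * \<bar>\<xi>\<bar> powr \<beta>1) \<and>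
     (\<exists>\<beta>2\<ge>0. \<exists>C :: nat \<Rightarrow> real. \<forall>k\<ge>1. \<forall>\<xi>. \<bar>nderiv k h \<xi>\<bar> \<le> C k * (1 + \<bar>\<xi>\<bar>) powr \<beta>2) \<and>
     (\<forall>\<xi>. h \<xi> = \<mu> \<longrightarrow> deriv h \<xi> \<noteq> 0) \<and>
     finite (components (sublevel h \<mu>))"

text \<open>Test functions are complex-valued. ``Supported on'' the open interval is read as vanishing
  outside it, which is weaker than requiring the closed support to be contained in it.\<close>

definition condition_F ::
    "nat \<Rightarrow> real \<Rightarrow> real \<Rightarrow> real \<Rightarrow> (real \<Rightarrow> complex) \<Rightarrow> bool" where
  "condition_F n \<gamma> t0 R f \<longleftrightarrow>
     n \<ge> 1 \<and> \<gamma> > 0 \<and> R > 0 \<and>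
     C_on n (- {t0}) f \<and> continuous_on UNIV f \<and>
     (\<exists>C. \<forall>k\<le>n. \<forall>t. t \<noteq> t0 \<longrightarrow> norm (nderiv k f t) * \<bar>t - t0\<bar> powr (- \<gamma> + real k) \<le> C) \<and>
     (\<forall>t. t \<notin> {t0 - R<..<t0 + R} \<longrightarrow> f t = 0)"

text \<open>At the endpoints \<open>t = 0\<close> and \<open>t = 1\<close> the integrand takes the value \<open>0\<close> by the convention
  for division by zero; this does not affect the integral.\<close>

definition U_integrand :: "real \<Rightarrow> real \<Rightarrow> (real \<Rightarrow> complex) \<Rightarrow> real \<Rightarrow> complex" where
  "U_integrand s1 s2 g t =
     (g ((1 - t) * s1 + t * s2) - ((1 - t) *\<^sub>R g s1 + t *\<^sub>R g s2)) /\<^sub>R (t * (1 - t))"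

definition U :: "real \<Rightarrow> real \<Rightarrow> (real \<Rightarrow> complex) \<Rightarrow> complex" where
  "U s1 s2 g = (LINT t:{0..1}|lborel. U_integrand s1 s2 g t)"

definition U_exists :: "real \<Rightarrow> real \<Rightarrow> (real \<Rightarrow> complex) \<Rightarrow> bool" where
  "U_exists s1 s2 g \<longleftrightarrow> set_integrable lborel {0..1} (U_integrand s1 s2 g)"

definition off_diagonal :: "real \<Rightarrow> (real \<times> real) set" where
  "off_diagonal \<epsilon> = {(\<xi>1, \<xi>2). \<bar>\<xi>1 - \<xi>2\<bar> > \<epsilon>}"

definition B_integrand ::
    "(real \<Rightarrow> real) \<Rightarrow> (real \<Rightarrow> complex) \<Rightarrow> real \<times> real \<Rightarrow> complex" where
  "B_integrand a g = (\<lambda>(\<xi>1, \<xi>2). U (a \<xi>1) (a \<xi>2) g /\<^sub>R \<bar>\<xi>1 - \<xi>2\<bar>\<^sup>2)"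

definition B_truncated ::
    "(real \<Rightarrow> real) \<Rightarrow> (real \<Rightarrow> complex) \<Rightarrow> real \<Rightarrow> complex" where
  "B_truncated a g \<epsilon> = (LINT z:off_diagonal \<epsilon>|lborel. B_integrand a g z)"

definition B :: "(real \<Rightarrow> real) \<Rightarrow> (real \<Rightarrow> complex) \<Rightarrow> complex" where
  "B a g = (1 / (8 * pi\<^sup>2)) *\<^sub>R Lim (at_right 0) (B_truncated a g)"

text \<open>The integrals and limit above are total functions in HOL; \<open>U_exists\<close> and \<open>B_exists\<close> say that
  they have their intended meaning.\<close>

definition B_exists :: "(real \<Rightarrow> real) \<Rightarrow> (real \<Rightarrow> complex) \<Rightarrow> bool" where
  "B_exists a g \<longleftrightarrow>
     (\<forall>\<epsilon>>0. set_integrable lborel (off_diagonal \<epsilon>) (B_integrand a g)) \<and>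
     (\<exists>L. (B_truncated a g \<longlongrightarrow> L) (at_right 0))"

end

theory Submission
  imports Defs
begin

text \<open>Write \<open>a\<close> for the Fermi symbol, \<open>\<chi>\<close> for the indicator of \<open>\<Omega>\<close>, and \<open>\<delta> = \<gamma> / 2\<close> with \<open>\<gamma> \<le> 1\<close>
  without loss of generality. Two bounds on \<open>U\<close> suffice: it is Hoelder continuous of order \<open>\<delta>\<close>
  on the unit square, and \<open>U (x, y) = O(|x - y|^(1 + \<delta>) |x - t0|^(\<delta> - 1))\<close>, which interpolates between
  the Hoelder bound and the quadratic bound valid away from the singularity \<open>t0\<close>. In the plane of
  \<open>(\<xi>1, \<xi>2)\<close> the second bound is used for \<open>|\<xi>1 - \<xi>2| \<lesssim> T\<close>; elsewhere \<open>U (a, a)\<close> is compared with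
  \<open>U (\<chi>, \<chi>)\<close> by means of the first one. After integration over \<open>\<xi>1 - \<xi>2\<close> both errors are bounded by
  \<open>1 / T\<close> times an integral of \<open>a (1 - a) |a - t|^(\<delta> - 1)\<close> with \<open>t \<in> {0, 1, t0}\<close>, and this integral is
  \<open>O(T)\<close>: near the Fermi points one substitutes \<open>y = a(\<xi>)\<close>, since \<open>a' = - a (1 - a) h' / T\<close> and \<open>h' \<noteq> 0\<close>
  there, and away from them the integrand is exponentially small. What remains is \<open>U (1, 0)\<close> times
  the integral of \<open>1 / |\<xi>1 - \<xi>2|\<^sup>2\<close> over the pairs separated by \<open>\<Omega>\<close> at distance at least a multiple
  of \<open>T\<close>, to which every component contributes \<open>4 |log T| + O(1)\<close>.\<close>

section \<open>Estimates for \<open>U\<close>\<close>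

text \<open>The exponent is halved because the factor 1 / (t (1 - t)) in \<open>U\<close> is not
  integrable. A chord defect vanishes like (t (1 - t))^\<gamma> at the ends, but this bound does not
  see how close two pairs of arguments are; the Hoelder bound sees it but has no decay in t. Their
  geometric mean has both properties, each with exponent \<gamma> / 2. Assuming \<gamma> \<le> 1
  costs nothing because f vanishes at distance more than 1 from t0. The second obstacle is that h'
  may grow polynomially, so that no fixed multiple of T separates near pairs from far ones. The
  strip around the diagonal therefore has width T divided by a local bound of |h'|. This puts a
  polynomial factor into the weighted integrals, which the exponential decay of the weights away
  from the level set absorbs. Around \<Omega> the width is constant, so the main term has a single
  cutoff, and the constant factor in it changes |log T| only by O(1). The remainder and the
  truncated main term are both absolutely integrable, hence the limit defining \<open>B\<close> is
  an ordinary integral for every small T.\<close>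

lemma min_le_sqrt_mult:
  fixes d p q :: real
  assumes "d \<le> p" "d \<le> q" "0 \<le> p" "0 \<le> q"
  shows "d \<le> sqrt p * sqrt q"
proof -
  have "d \<le> min p q" using assms by simp
  also have "\<dots> = sqrt (min p q) * sqrt (min p q)" using assms by simp
  also have "\<dots> \<le> sqrt p * sqrt q" using assms by (intro mult_mono) auto
  finally show ?thesis .
qed

text \<open>By the substitution of 1 - t for t. It lets the singular weight be taken at whichever
  argument differs from \<open>t0\<close>, and it identifies the two values of \<open>U\<close>
  across a jump.\<close>

lemma U_commute: "U x y g = U y x g"
proof -
  have "U x y g = (LINT t|lborel. indicator {0..1} t *\<^sub>R U_integrand x y g t)"
    by (simp add: U_def set_lebesgue_integral_def)
  also have "\<dots> = (LINT t|lborel. indicator {0..1} (1 + (-1) * t) *\<^sub>R U_integrand x y g (1 + (-1) * t))"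
    by (subst lborel_integral_real_affine[of "-1" _ 1]) auto
  also have "\<dots> = (LINT t|lborel. indicator {0..1} t *\<^sub>R U_integrand y x g t)"
    by (intro Bochner_Integration.integral_cong)
       (auto simp: U_integrand_def indicator_def algebra_simps)
  finally show ?thesis by (simp add: U_def set_lebesgue_integral_def)
qed

lemma U_self [simp]: "U x x g = 0"
proof -
  have "U_integrand x x g t = 0" for t
    by (simp add: U_integrand_def algebra_simps flip: scaleR_add_left)
  then show ?thesis by (simp add: U_def)
qed

lemma mean_value_inequality:
  fixes f :: "real \<Rightarrow> 'a::real_normed_vector"
  assumes "\<And>z. z \<in> closed_segment x y \<Longrightarrow> (f has_vector_derivative f' z) (at z)"
    and "\<And>z. z \<in> closed_segment x y \<Longrightarrow> norm (f' z) \<le> K"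
  shows "norm (f x - f y) \<le> K * \<bar>x - y\<bar>"
proof -
  have "norm (f x - f y) \<le> K * norm (x - y)"
  proof (rule differentiable_bound[where S = "closed_segment x y" and f' = "\<lambda>z h. h *\<^sub>R f' z"])
    fix z assume z: "z \<in> closed_segment x y"
    show "(f has_derivative (\<lambda>h. h *\<^sub>R f' z)) (at z within closed_segment x y)"
      using assms(1)[OF z] by (simp add: has_vector_derivative_def has_derivative_at_withinI)
    show "onorm (\<lambda>h. h *\<^sub>R f' z) \<le> K"
      using assms(2)[OF z] by (intro onorm_le) (simp add: mult.commute[of K] mult_left_mono)
  qed auto
  then show ?thesis by simp
qed

text \<open>Both endpoint values are expanded around the intermediate point z. The linear terms
  cancel because (1 - t) (x - z) + t (y - z) = 0, and the quadratic remainders combine through (1 -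
  t) t^2 + t (1 - t)^2 = t (1 - t), which is the denominator in \<open>U\<close>.\<close>

lemma chord_defect_C2:
  fixes f :: "real \<Rightarrow> 'a::real_normed_vector"
  assumes f: "\<And>z. z \<in> closed_segment x y \<Longrightarrow> (f has_vector_derivative f' z) (at z)"
    and f': "\<And>z. z \<in> closed_segment x y \<Longrightarrow> (f' has_vector_derivative f'' z) (at z)"
    and M: "\<And>z. z \<in> closed_segment x y \<Longrightarrow> norm (f'' z) \<le> M"
    and t: "0 \<le> t" "t \<le> 1"
  shows "norm (f ((1 - t) * x + t * y) - ((1 - t) *\<^sub>R f x + t *\<^sub>R f y))
    \<le> M * \<bar>x - y\<bar>\<^sup>2 * (t * (1 - t))"
proof -
  define z where "z = (1 - t) * x + t * y"
  have z: "z \<in> closed_segment x y"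
    unfolding z_def closed_segment_def using t by auto
  have *: "norm (f w - f z - (w - z) *\<^sub>R f' z) \<le> M * \<bar>w - z\<bar>\<^sup>2" if w: "w \<in> closed_segment x y" for w
  proof -
    have sub: "closed_segment z w \<subseteq> closed_segment x y"
      using z w by (simp add: subset_closed_segment)
    have "M \<ge> 0" using M[OF z] norm_ge_zero[of "f'' z"] by linarith
    have "norm (f w - f z - (w - z) *\<^sub>R f' z) \<le> norm (w - z) * (M * \<bar>w - z\<bar>)"
    proof (rule vector_differentiable_bound_linearization[where S = "closed_segment z w"])
      fix v assume v: "v \<in> closed_segment z w"
      show "(f has_vector_derivative f' v) (at v within closed_segment z w)"
        using f sub v by (blast intro: has_vector_derivative_at_within)
      have "closed_segment v z \<subseteq> closed_segment x y"
        using v z sub by (meson ends_in_segment(1) subset_closed_segment subset_iff)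
      then have "norm (f' v - f' z) \<le> M * \<bar>v - z\<bar>"
        using f' M by (intro mean_value_inequality[where f' = f'']) auto
      also have "\<dots> \<le> M * \<bar>w - z\<bar>"
        using v \<open>M \<ge> 0\<close> by (intro mult_left_mono) (auto simp: closed_segment_eq_real_ivl split: if_splits)
      finally show "norm (f' v - f' z) \<le> M * \<bar>w - z\<bar>" .
    qed auto
    then show ?thesis by (simp add: power2_eq_square mult_ac)
  qed
  have xz: "x - z = t * (x - y)" and yz: "y - z = (1 - t) * (y - x)"
    by (auto simp: z_def algebra_simps)
  have "f z - ((1 - t) *\<^sub>R f x + t *\<^sub>R f y) =
    - ((1 - t) *\<^sub>R (f x - f z - (x - z) *\<^sub>R f' z) + t *\<^sub>R (f y - f z - (y - z) *\<^sub>R f' z))"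
    unfolding xz yz by (simp add: algebra_simps flip: scaleR_add_left)
  then have "norm (f z - ((1 - t) *\<^sub>R f x + t *\<^sub>R f y)) \<le>
    (1 - t) * norm (f x - f z - (x - z) *\<^sub>R f' z) + t * norm (f y - f z - (y - z) *\<^sub>R f' z)"
    using t by (metis (no_types, opaque_lifting) abs_of_nonneg diff_ge_0_iff_ge norm_minus_cancel norm_scaleR norm_triangle_ineq)
  also have "\<dots> \<le> (1 - t) * (M * \<bar>x - z\<bar>\<^sup>2) + t * (M * \<bar>y - z\<bar>\<^sup>2)"
    using t by (intro add_mono mult_left_mono *) auto
  also have "\<dots> = M * \<bar>x - y\<bar>\<^sup>2 * (t * (1 - t))"
    unfolding xz yz by (simp add: power2_eq_square algebra_simps)
  finally show ?thesis by (simp add: z_def)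
qed

text \<open>Since \<open>0 powr \<gamma> = 0\<close>, the bound \<open>f_bound\<close> at
  \<open>t0\<close> forces \<open>f t0 = 0\<close>. With \<gamma> \<le> 1 the exponents in both
  derivative bounds are nonpositive, so a lower bound for the distance to \<open>t0\<close> bounds
  the derivatives along a whole segment.\<close>

locale power_singularity =
  fixes f f' f'' :: "real \<Rightarrow> complex" and t0 \<gamma> C :: real
  assumes exponent: "0 < \<gamma>" "\<gamma> \<le> 1" and C_nonneg: "0 \<le> C"
    and cont: "continuous_on UNIV f"
    and f_bound: "norm (f t) \<le> C * \<bar>t - t0\<bar> powr \<gamma>"
    and f_deriv: "t \<noteq> t0 \<Longrightarrow> (f has_vector_derivative f' t) (at t)"
    and f'_deriv: "t \<noteq> t0 \<Longrightarrow> (f' has_vector_derivative f'' t) (at t)"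
    and f'_bound: "t \<noteq> t0 \<Longrightarrow> norm (f' t) \<le> C * \<bar>t - t0\<bar> powr (\<gamma> - 1)"
    and f''_bound: "t \<noteq> t0 \<Longrightarrow> norm (f'' t) \<le> C * \<bar>t - t0\<bar> powr (\<gamma> - 2)"
begin


lemma segment_away:
  assumes "\<bar>x - t0\<bar> \<ge> 2 * \<bar>x - y\<bar>" "z \<in> closed_segment x y"
  shows "\<bar>z - t0\<bar> \<ge> \<bar>x - t0\<bar> / 2"
proof -
  have "\<bar>z - x\<bar> \<le> \<bar>x - y\<bar>"
    using assms(2) by (auto simp: closed_segment_eq_real_ivl split: if_splits)
  moreover have "\<bar>x - t0\<bar> \<le> \<bar>z - x\<bar> + \<bar>z - t0\<bar>" by arith
  ultimately show ?thesis using assms(1) by argo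
qed

lemma holder_away:
  assumes "\<bar>x - t0\<bar> > 2 * \<bar>x - y\<bar>"
  shows "norm (f x - f y) \<le> C * \<bar>x - y\<bar> powr \<gamma>"
proof (cases "x = y")
  case False
  have away: "\<bar>z - t0\<bar> \<ge> \<bar>x - y\<bar>" if "z \<in> closed_segment x y" for z
    using segment_away[OF _ that] assms by simp
  have "norm (f x - f y) \<le> (C * \<bar>x - y\<bar> powr (\<gamma> - 1)) * \<bar>x - y\<bar>"
  proof (rule mean_value_inequality[where f' = f'])
    fix z assume z: "z \<in> closed_segment x y"
    have zr: "\<bar>z - t0\<bar> \<ge> \<bar>x - y\<bar>" and "z \<noteq> t0" using away[OF z] False by auto
    then show "(f has_vector_derivative f' z) (at z)" using f_deriv by simp
    have "norm (f' z) \<le> C * \<bar>z - t0\<bar> powr (\<gamma> - 1)" using \<open>z \<noteq> t0\<close> by (rule f'_bound)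
    also have "\<dots> \<le> C * \<bar>x - y\<bar> powr (\<gamma> - 1)"
      using zr False exponent C_nonneg by (intro mult_left_mono powr_mono2') auto
    finally show "norm (f' z) \<le> C * \<bar>x - y\<bar> powr (\<gamma> - 1)" .
  qed
  also have "\<dots> = C * \<bar>x - y\<bar> powr \<gamma>"
    using False by (simp add: powr_diff)
  finally show ?thesis .
qed (use C_nonneg in auto)

text \<open>If one of the points is farther from \<open>t0\<close> than 2 |x - y|, the segment
  avoids the singularity and the mean value inequality applies. Otherwise each value is itself at
  most 2 C |x - y|^\<gamma>, and the two add up to the factor 4.\<close>

lemma holder: "norm (f x - f y) \<le> 4 * C * \<bar>x - y\<bar> powr \<gamma>"
proof -
  consider "\<bar>x - t0\<bar> > 2 * \<bar>x - y\<bar>" | "\<bar>y - t0\<bar> > 2 * \<bar>y - x\<bar>"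
    | "\<bar>x - t0\<bar> \<le> 2 * \<bar>x - y\<bar>" "\<bar>y - t0\<bar> \<le> 2 * \<bar>x - y\<bar>"
    using abs_minus_commute[of x y] by fastforce
  then show ?thesis
  proof cases
    case 1
    have "norm (f x - f y) \<le> C * \<bar>x - y\<bar> powr \<gamma>" by (rule holder_away[OF 1])
    also have "\<dots> \<le> 4 * C * \<bar>x - y\<bar> powr \<gamma>" using C_nonneg by (intro mult_right_mono) auto
    finally show ?thesis .
  next
    case 2
    have "norm (f y - f x) \<le> C * \<bar>y - x\<bar> powr \<gamma>" by (rule holder_away[OF 2])
    also have "\<dots> \<le> 4 * C * \<bar>x - y\<bar> powr \<gamma>"
      using C_nonneg by (subst abs_minus_commute, intro mult_right_mono) auto
    finally show ?thesis by (simp add: norm_minus_commute)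
  next
    case 3
    have *: "norm (f z) \<le> 2 * C * \<bar>x - y\<bar> powr \<gamma>" if "\<bar>z - t0\<bar> \<le> 2 * \<bar>x - y\<bar>" for z
    proof -
      have "norm (f z) \<le> C * \<bar>z - t0\<bar> powr \<gamma>" by (rule f_bound)
      also have "\<dots> \<le> C * (2 * \<bar>x - y\<bar>) powr \<gamma>"
        using that exponent C_nonneg by (intro mult_left_mono powr_mono2) auto
      also have "\<dots> = C * (2 powr \<gamma> * \<bar>x - y\<bar> powr \<gamma>)" by (simp add: powr_mult)
      also have "\<dots> \<le> C * (2 powr 1 * \<bar>x - y\<bar> powr \<gamma>)"
        using exponent C_nonneg by (intro mult_left_mono mult_right_mono powr_mono) auto
      finally show ?thesis by simp
    qed
    show ?thesis using norm_triangle_ineq4[of "f x" "f y"] *[OF 3(1)] *[OF 3(2)] by linarith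
  qed
qed

definition chord_defect :: "real \<Rightarrow> real \<Rightarrow> real \<Rightarrow> complex" where
  "chord_defect x y t = f ((1 - t) * x + t * y) - ((1 - t) *\<^sub>R f x + t *\<^sub>R f y)"

lemma U_integrand_eq: "U_integrand x y f t = chord_defect x y t /\<^sub>R (t * (1 - t))"
  by (simp add: U_integrand_def chord_defect_def)

text \<open>The defect is the combination of f z - f x and f z - f y with weights 1 - t and t, where
  |z - x| = t |x - y| and |z - y| = (1 - t) |x - y|. Enlarging each weight s to s^\<gamma> makes
  both terms carry (t (1 - t))^\<gamma>.\<close>

lemma chord_defect_holder:
  assumes t: "0 \<le> t" "t \<le> 1"
  shows "norm (chord_defect x y t) \<le> 8 * C * \<bar>x - y\<bar> powr \<gamma> * (t * (1 - t)) powr \<gamma>"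
proof -
  define z where "z = (1 - t) * x + t * y"
  have xz: "z - x = t * (y - x)" and yz: "z - y = (1 - t) * (x - y)"
    by (auto simp: z_def algebra_simps)
  have self_le: "s \<le> s powr \<gamma>" if "0 \<le> s" "s \<le> 1" for s :: real
    using powr_mono'[of \<gamma> 1 s] that exponent by simp
  have "chord_defect x y t = (1 - t) *\<^sub>R (f z - f x) + t *\<^sub>R (f z - f y)"
    unfolding chord_defect_def z_def[symmetric] by (simp add: algebra_simps flip: scaleR_add_left)
  then have "norm (chord_defect x y t) \<le> (1 - t) * norm (f z - f x) + t * norm (f z - f y)"
    using t by (metis (no_types, opaque_lifting) abs_of_nonneg diff_ge_0_iff_ge norm_scaleR norm_triangle_ineq)
  also have "\<dots> \<le> (1 - t) powr \<gamma> * (4 * C * \<bar>z - x\<bar> powr \<gamma>) + t powr \<gamma> * (4 * C * \<bar>z - y\<bar> powr \<gamma>)"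
    using t by (intro add_mono mult_mono holder self_le) auto
  also have "\<dots> = 8 * C * \<bar>x - y\<bar> powr \<gamma> * (t * (1 - t)) powr \<gamma>"
    unfolding xz yz using t
    by (simp add: abs_mult powr_mult abs_minus_commute[of y x])
  finally show ?thesis .
qed

lemma U_integrand_holder:
  assumes t: "0 \<le> t" "t \<le> 1"
  shows "norm (U_integrand x y f t) \<le> 8 * C * \<bar>x - y\<bar> powr \<gamma> * (t * (1 - t)) powr (\<gamma> - 1)"
proof (cases "t * (1 - t) = 0")
  case False
  then have "t * (1 - t) > 0" using t by (auto simp: zero_less_mult_iff)
  with chord_defect_holder[OF t, of x y] show ?thesis
    by (simp add: U_integrand_eq powr_diff divide_simps)
qed (auto simp: U_integrand_eq)

lemma f_measurable [measurable]: "f \<in> borel_measurable borel"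
  using cont by (rule borel_measurable_continuous_onI)

lemma U_integrand_measurable [measurable]: "U_integrand x y f \<in> borel_measurable borel"
  unfolding U_integrand_def by measurable

lemma beta_integrable:
  assumes "0 < \<kappa>"
  shows "set_integrable lborel {0..1::real} (\<lambda>t. K * (t * (1 - t)) powr (\<kappa> - 1))"
proof -
  have "set_integrable lborel {0..1::real} (\<lambda>t. K * (t powr (\<kappa> - 1) * (1 - t) powr (\<kappa> - 1)))"
    using integrable_Beta[OF assms assms] by simp
  then show ?thesis
    by (rule set_integrable_cong[THEN iffD1, rotated -1]) (auto simp: powr_mult)
qed

lemma U_exists: "U_exists x y f"
proof -
  have "set_integrable lborel {0..1} (\<lambda>t. (8 * C * \<bar>x - y\<bar> powr \<gamma>) * (t * (1 - t)) powr (\<gamma> - 1))"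
    using exponent by (intro beta_integrable) auto
  then show ?thesis unfolding U_exists_def
    by (rule set_integrable_bound)
       (auto simp: set_borel_measurable_def intro!: AE_I2 U_integrand_holder order.trans[OF U_integrand_holder])
qed

lemma U_bound:
  assumes "set_integrable lborel {0..1} g"
    and "\<And>t. 0 \<le> t \<Longrightarrow> t \<le> 1 \<Longrightarrow> norm (U_integrand x y f t) \<le> g t"
  shows "norm (U x y f) \<le> (LINT t:{0..1}|lborel. g t)"
proof -
  have "norm (U x y f) \<le> (LINT t:{0..1}|lborel. norm (U_integrand x y f t))"
    unfolding U_def using U_exists by (simp add: U_exists_def set_integral_norm_bound)
  also have "\<dots> \<le> (LINT t:{0..1}|lborel. g t)"
    using assms U_exists unfolding U_exists_def
    by (intro set_integral_mono set_integrable_norm) auto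
  finally show ?thesis .
qed

text \<open>Euler's Beta value B(\<kappa>, \<kappa>) when \<kappa> > 0.\<close>

definition beta_const :: "real \<Rightarrow> real" where
  "beta_const \<kappa> = (LINT t:{0..1}|lborel. (t * (1 - t)) powr (\<kappa> - 1))"

lemma beta_const_nonneg: "beta_const \<kappa> \<ge> 0"
  unfolding beta_const_def set_lebesgue_integral_def by (intro integral_nonneg_AE) auto

lemma U_holder: "norm (U x y f) \<le> 8 * C * beta_const \<gamma> * \<bar>x - y\<bar> powr \<gamma>"
proof -
  have "norm (U x y f) \<le> (LINT t:{0..1}|lborel. (8 * C * \<bar>x - y\<bar> powr \<gamma>) * (t * (1 - t)) powr (\<gamma> - 1))"
    using exponent by (intro U_bound beta_integrable U_integrand_holder) auto
  then show ?thesis by (simp add: beta_const_def mult_ac)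
qed

text \<open>The segment stays at distance at least |x - t0| / 2 from the singularity, so the C2
  bound applies; its factor t (1 - t) cancels the denominator and the integrand is bounded. The 4
  bounds 2^(2 - \<gamma>), which comes from halving the distance.\<close>

lemma U_quadratic:
  assumes "\<bar>x - t0\<bar> \<ge> 2 * \<bar>x - y\<bar>" "x \<noteq> t0"
  shows "norm (U x y f) \<le> 4 * C * \<bar>x - y\<bar>\<^sup>2 * \<bar>x - t0\<bar> powr (\<gamma> - 2)"
proof -
  define M where "M = C * (\<bar>x - t0\<bar> / 2) powr (\<gamma> - 2)"
  have "M \<ge> 0" using C_nonneg by (simp add: M_def)
  have away: "\<bar>z - t0\<bar> \<ge> \<bar>x - t0\<bar> / 2" "z \<noteq> t0" if "z \<in> closed_segment x y" for z
    using segment_away[OF assms(1) that] assms(2) by auto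
  have f''_le: "norm (f'' z) \<le> M" if z: "z \<in> closed_segment x y" for z
  proof -
    have "norm (f'' z) \<le> C * \<bar>z - t0\<bar> powr (\<gamma> - 2)" using away[OF z] by (intro f''_bound)
    also have "\<dots> \<le> M" unfolding M_def
      using away[OF z] assms(2) exponent C_nonneg by (intro mult_left_mono powr_mono2') auto
    finally show ?thesis .
  qed
  have "norm (U x y f) \<le> (LINT t:{0..1::real}|lborel. M * \<bar>x - y\<bar>\<^sup>2)"
  proof (rule U_bound)
    fix t :: real assume t: "0 \<le> t" "t \<le> 1"
    have "norm (chord_defect x y t) \<le> M * \<bar>x - y\<bar>\<^sup>2 * (t * (1 - t))"
      unfolding chord_defect_def using away t f''_le
      by (intro chord_defect_C2[where f' = f' and f'' = f'']) (auto intro: f_deriv f'_deriv)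
    then show "norm (U_integrand x y f t) \<le> M * \<bar>x - y\<bar>\<^sup>2"
    proof (cases "t * (1 - t) = 0")
      case False
      then have "t * (1 - t) > 0" using t by (auto simp: zero_less_mult_iff)
      then show ?thesis using \<open>norm (chord_defect x y t) \<le> _\<close>
        by (simp add: U_integrand_eq divide_simps)
    qed (use \<open>M \<ge> 0\<close> in \<open>auto simp: U_integrand_eq\<close>)
  qed (auto simp: set_integrable_def)
  also have "\<dots> = M * \<bar>x - y\<bar>\<^sup>2" by (simp add: set_lebesgue_integral_def)
  also have "M \<le> 4 * C * \<bar>x - t0\<bar> powr (\<gamma> - 2)"
  proof -
    have "M = C * (2 powr (2 - \<gamma>) * \<bar>x - t0\<bar> powr (\<gamma> - 2))"
      by (simp add: M_def powr_divide powr_diff divide_simps)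
    also have "\<dots> \<le> C * (2 powr 2 * \<bar>x - t0\<bar> powr (\<gamma> - 2))"
      using exponent C_nonneg by (intro mult_left_mono mult_right_mono powr_mono) auto
    finally show ?thesis by simp
  qed
  finally show ?thesis by (simp add: mult_right_mono mult_ac)
qed

text \<open>One constant for three estimates: 4 C from the quadratic bound, 16 C B(\<gamma>,
  \<gamma>) from the Hoelder bound near \<open>t0\<close> (8 times a factor 2^(1 - \<gamma> / 2)
  \<le> 2), and the last term from \<open>U_difference\<close>.\<close>

definition U_const :: real where "U_const = 4 * C + 16 * C * beta_const \<gamma> + 16 * C * beta_const (\<gamma> / 2)"

lemma U_const_nonneg: "U_const \<ge> 0"
  using C_nonneg beta_const_nonneg by (simp add: U_const_def)

text \<open>Let r = |x - y| and d = |x - t0|. If d \<ge> 2 r, one factor r^(1 - \<gamma> / 2) of the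
  quadratic bound is replaced by d^(1 - \<gamma> / 2). If d < 2 r, the factor r^(\<gamma> / 2 - 1)
  of the Hoelder bound is replaced by (d / 2)^(\<gamma> / 2 - 1), its exponent being
  negative.\<close>

lemma U_near_diagonal_left:
  assumes "x \<noteq> t0"
  shows "norm (U x y f) \<le> U_const * \<bar>x - y\<bar> powr (1 + \<gamma> / 2) * \<bar>x - t0\<bar> powr (\<gamma> / 2 - 1)"
proof (cases "x = y")
  case False
  define r d where "r = \<bar>x - y\<bar>" and "d = \<bar>x - t0\<bar>"
  have rd: "r > 0" "d > 0" using False assms by (auto simp: r_def d_def)
  show ?thesis
  proof (cases "d \<ge> 2 * r")
    case True
    then have "norm (U x y f) \<le> 4 * C * r\<^sup>2 * d powr (\<gamma> - 2)"
      using U_quadratic assms by (simp add: r_def d_def)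
    also have "r\<^sup>2 = r powr (1 + \<gamma> / 2) * r powr (1 - \<gamma> / 2)"
      using rd by (simp flip: powr_add)
    also have "4 * C * (r powr (1 + \<gamma> / 2) * r powr (1 - \<gamma> / 2)) * d powr (\<gamma> - 2) \<le>
        4 * C * (r powr (1 + \<gamma> / 2) * d powr (1 - \<gamma> / 2)) * d powr (\<gamma> - 2)"
      using True rd exponent C_nonneg by (intro mult_right_mono mult_left_mono powr_mono2) auto
    also have "\<dots> = 4 * C * r powr (1 + \<gamma> / 2) * d powr (\<gamma> / 2 - 1)"
      using rd by (simp add: mult.assoc flip: powr_add)
    also have "\<dots> \<le> U_const * r powr (1 + \<gamma> / 2) * d powr (\<gamma> / 2 - 1)"
      using C_nonneg beta_const_nonneg by (intro mult_right_mono) (auto simp: U_const_def)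
    finally show ?thesis by (simp add: r_def d_def)
  next
    case False
    have "norm (U x y f) \<le> 8 * C * beta_const \<gamma> * r powr \<gamma>"
      using U_holder by (simp add: r_def)
    also have "r powr \<gamma> = r powr (1 + \<gamma> / 2) * r powr (\<gamma> / 2 - 1)"
      using rd by (simp flip: powr_add)
    also have "r powr (\<gamma> / 2 - 1) \<le> (d / 2) powr (\<gamma> / 2 - 1)"
      using False rd exponent by (intro powr_mono2') auto
    also have "\<dots> = 2 powr (1 - \<gamma> / 2) * d powr (\<gamma> / 2 - 1)"
      using rd powr_minus_divide[of 2 "\<gamma> / 2 - 1"] by (simp add: powr_divide)
    also have "2 powr (1 - \<gamma> / 2) \<le> (2::real) powr 1"
      using exponent by (intro powr_mono) auto
    finally have "norm (U x y f) \<le> 8 * C * beta_const \<gamma> * (r powr (1 + \<gamma> / 2) * (2 * d powr (\<gamma> / 2 - 1)))"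
      using C_nonneg beta_const_nonneg by (simp add: mult_left_mono mult_right_mono)
    also have "\<dots> = 16 * C * beta_const \<gamma> * (r powr (1 + \<gamma> / 2) * d powr (\<gamma> / 2 - 1))" by simp
    also have "\<dots> \<le> U_const * (r powr (1 + \<gamma> / 2) * d powr (\<gamma> / 2 - 1))"
      using C_nonneg beta_const_nonneg by (intro mult_right_mono) (auto simp: U_const_def)
    finally show ?thesis by (simp add: r_def d_def mult.assoc)
  qed
qed auto

text \<open>The sum over both arguments is needed because \<open>0 powr (\<gamma> / 2 - 1) = 0\<close>: with a single
  summand the bound would fail at that point.\<close>

lemma U_near_diagonal:
  "norm (U x y f) \<le> U_const * \<bar>x - y\<bar> powr (1 + \<gamma> / 2) *
     (\<bar>x - t0\<bar> powr (\<gamma> / 2 - 1) + \<bar>y - t0\<bar> powr (\<gamma> / 2 - 1))"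
proof -
  consider "x \<noteq> t0" | "y \<noteq> t0" | "x = y" by blast
  then show ?thesis
  proof cases
    case 1
    then show ?thesis using U_const_nonneg
      by (intro order.trans[OF U_near_diagonal_left] mult_left_mono) auto
  next
    case 2
    then show ?thesis using U_const_nonneg
      by (subst U_commute, intro order.trans[OF U_near_diagonal_left])
         (auto simp: abs_minus_commute[of y x] intro!: mult_left_mono)
  qed auto
qed

text \<open>Dividing the plain Hoelder bound for the difference of the defects by t (1 - t) would
  leave a divergent integral; half of the exponent is spent on decay at the ends of [0, 1].\<close>

lemma U_difference:
  assumes "x1 \<in> {0..1}" "y1 \<in> {0..1}" "x2 \<in> {0..1}" "y2 \<in> {0..1}"
  shows "norm (U x1 y1 f - U x2 y2 f) \<le>
    U_const * (\<bar>x1 - x2\<bar> powr (\<gamma> / 2) + \<bar>y1 - y2\<bar> powr (\<gamma> / 2))"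
proof -
  define p q where "p = \<bar>x1 - x2\<bar>" and "q = \<bar>y1 - y2\<bar>"
  have pq: "p \<ge> 0" "q \<ge> 0" by (auto simp: p_def q_def)
  define P where "P = p powr (\<gamma> / 2) + q powr (\<gamma> / 2)"
  have "P \<ge> 0" by (simp add: P_def)
  have bound: "norm (U_integrand x1 y1 f t - U_integrand x2 y2 f t) \<le> (16 * C * P) * (t * (1 - t)) powr (\<gamma> / 2 - 1)"
    if t: "0 \<le> t" "t \<le> 1" for t
  proof (cases "t * (1 - t) = 0")
    case False
    then have tt: "t * (1 - t) > 0" using t by (auto simp: zero_less_mult_iff)
    define D where "D = norm (chord_defect x1 y1 t - chord_defect x2 y2 t)"
    \<comment> \<open>The unit square enters here: |x - y| \<le> 1 leaves a bound depending on t
      alone.\<close>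
    have cd: "norm (chord_defect x y t) \<le> 8 * C * (t * (1 - t)) powr \<gamma>" if "x \<in> {0..1}" "y \<in> {0..1}" for x y
    proof -
      have "norm (chord_defect x y t) \<le> 8 * C * \<bar>x - y\<bar> powr \<gamma> * (t * (1 - t)) powr \<gamma>"
        by (rule chord_defect_holder[OF t])
      also have "\<bar>x - y\<bar> powr \<gamma> \<le> 1 powr \<gamma>"
        using that exponent by (intro powr_mono2) auto
      finally show ?thesis using C_nonneg by (simp add: mult_left_mono mult_right_mono)
    qed
    have D1: "D \<le> 16 * C * (t * (1 - t)) powr \<gamma>"
      unfolding D_def using norm_triangle_ineq4[of "chord_defect x1 y1 t" "chord_defect x2 y2 t"]
        cd[OF assms(1,2)] cd[OF assms(3,4)] by linarith
    have "\<bar>((1 - t) * x1 + t * y1) - ((1 - t) * x2 + t * y2)\<bar> \<le> max p q"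
    proof -
      have "((1 - t) * x1 + t * y1) - ((1 - t) * x2 + t * y2) = (1 - t) * (x1 - x2) + t * (y1 - y2)"
        by (simp add: algebra_simps)
      then have "\<bar>((1 - t) * x1 + t * y1) - ((1 - t) * x2 + t * y2)\<bar> \<le> (1 - t) * p + t * q"
        using t abs_triangle_ineq[of "(1 - t) * (x1 - x2)" "t * (y1 - y2)"] by (simp add: p_def q_def abs_mult)
      also have "\<dots> \<le> (1 - t) * max p q + t * max p q"
        using t by (intro add_mono mult_left_mono) auto
      finally show ?thesis by (simp add: algebra_simps)
    qed
    then have "\<bar>((1 - t) * x1 + t * y1) - ((1 - t) * x2 + t * y2)\<bar> powr \<gamma> \<le> (max p q) powr \<gamma>"
      using exponent by (intro powr_mono2) auto
    also have "\<dots> \<le> p powr \<gamma> + q powr \<gamma>" by (simp add: max_def)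
    finally have mid: "\<bar>((1 - t) * x1 + t * y1) - ((1 - t) * x2 + t * y2)\<bar> powr \<gamma> \<le> p powr \<gamma> + q powr \<gamma>" .
    have "chord_defect x1 y1 t - chord_defect x2 y2 t =
      (f ((1 - t) * x1 + t * y1) - f ((1 - t) * x2 + t * y2)) - ((1 - t) *\<^sub>R (f x1 - f x2) + t *\<^sub>R (f y1 - f y2))"
      by (simp add: chord_defect_def algebra_simps)
    also have "norm \<dots> \<le> norm (f ((1 - t) * x1 + t * y1) - f ((1 - t) * x2 + t * y2))
        + (norm ((1 - t) *\<^sub>R (f x1 - f x2)) + norm (t *\<^sub>R (f y1 - f y2)))"
      by (intro order.trans[OF norm_triangle_ineq4] add_left_mono norm_triangle_ineq)
    also have "\<dots> \<le> 4 * C * (p powr \<gamma> + q powr \<gamma>) + (1 * (4 * C * p powr \<gamma>) + 1 * (4 * C * q powr \<gamma>))"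
      using t C_nonneg mid unfolding norm_scaleR p_def q_def
      by (intro add_mono mult_mono holder order.trans[OF holder]) auto
    finally have D2: "D \<le> 8 * C * (p powr \<gamma> + q powr \<gamma>)" by (simp add: D_def algebra_simps)
    \<comment> \<open>Interpolation between \<open>D1\<close>, which decays in t, and
      \<open>D2\<close>, which is small for close arguments. The 8 in \<open>D2\<close> is raised to
      16 so that the two square roots multiply to 16 C. After division by t (1 - t) the exponent is
      \<gamma> / 2 - 1 > -1.\<close>
    have "D \<le> sqrt (16 * C * (t * (1 - t)) powr \<gamma>) * sqrt (16 * C * (p powr \<gamma> + q powr \<gamma>))"
    proof (rule min_le_sqrt_mult)
      have "0 \<le> C * (p powr \<gamma> + q powr \<gamma>)" using C_nonneg by simp
      then show "D \<le> 16 * C * (p powr \<gamma> + q powr \<gamma>)" using D2 by linarith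
    qed (use D1 C_nonneg in auto)
    also have "\<dots> = (sqrt (16 * C) * sqrt (16 * C)) * ((t * (1 - t)) powr (\<gamma> / 2) * sqrt (p powr \<gamma> + q powr \<gamma>))"
      unfolding real_sqrt_mult[of "16 * C"] using powr_half_sqrt_powr[of "t * (1 - t)" \<gamma>] tt by simp
    also have "sqrt (16 * C) * sqrt (16 * C) = 16 * C" using C_nonneg by simp
    also have "sqrt (p powr \<gamma> + q powr \<gamma>) \<le> P"
      unfolding P_def using pq by (intro order.trans[OF sqrt_add_le_add_sqrt]) (auto simp: powr_half_sqrt_powr)
    finally have "D \<le> 16 * C * ((t * (1 - t)) powr (\<gamma> / 2) * P)"
      using C_nonneg by (simp add: mult_left_mono mult_right_mono)
    moreover have "norm (U_integrand x1 y1 f t - U_integrand x2 y2 f t) = D / (t * (1 - t))"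
      unfolding U_integrand_eq scaleR_diff_right[symmetric] norm_scaleR D_def
      using tt by (simp only: abs_of_pos positive_imp_inverse_positive divide_inverse mult.commute)
    ultimately have "norm (U_integrand x1 y1 f t - U_integrand x2 y2 f t)
        \<le> 16 * C * ((t * (1 - t)) powr (\<gamma> / 2) * P) / (t * (1 - t))"
      using tt by (simp only: divide_right_mono less_imp_le)
    also have "\<dots> = 16 * C * P * ((t * (1 - t)) powr (\<gamma> / 2) / (t * (1 - t)) powr 1)"
      using tt by simp
    finally show ?thesis by (simp only: powr_diff)
  qed (auto simp: U_integrand_eq)
  have int: "set_integrable lborel {0..1} (U_integrand x y f)" for x y
    using U_exists[of x y] by (simp add: U_exists_def)
  have "norm (U x1 y1 f - U x2 y2 f) = norm (LINT t:{0..1}|lborel. U_integrand x1 y1 f t - U_integrand x2 y2 f t)"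
    unfolding U_def using int by (simp add: set_integral_diff)
  also have "\<dots> \<le> (LINT t:{0..1}|lborel. norm (U_integrand x1 y1 f t - U_integrand x2 y2 f t))"
    using int by (intro set_integral_norm_bound set_integral_diff)
  also have "\<dots> \<le> (LINT t:{0..1}|lborel. (16 * C * P) * (t * (1 - t)) powr (\<gamma> / 2 - 1))"
    using int bound exponent
    by (intro set_integral_mono set_integrable_norm set_integral_diff beta_integrable) auto
  also have "\<dots> = 16 * C * beta_const (\<gamma> / 2) * P" by (simp add: beta_const_def mult_ac)
  also have "\<dots> \<le> U_const * P"
    using C_nonneg beta_const_nonneg \<open>P \<ge> 0\<close> by (intro mult_right_mono) (auto simp: U_const_def)
  finally show ?thesis by (simp add: P_def p_def q_def)
qed

lemma U_measurable:
  assumes [measurable]: "a \<in> borel_measurable M" "b \<in> borel_measurable M"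
  shows "(\<lambda>z. U (a z) (b z) f) \<in> borel_measurable M"
  unfolding U_def set_lebesgue_integral_def U_integrand_def by measurable

end

section \<open>Fermi symbols\<close>

lemma nderiv_eq_0_on_open:
  fixes f :: "real \<Rightarrow> 'a::real_normed_vector"
  assumes "open S" "\<And>t. t \<in> S \<Longrightarrow> f t = 0" "t \<in> S"
  shows "nderiv k f t = 0"
  using assms(3)
proof (induction k arbitrary: t)
  case (Suc k)
  have "(nderiv k f has_vector_derivative 0) (at t)"
    by (rule has_vector_derivative_transform_within_open[OF has_vector_derivative_const[of 0] assms(1)])
       (use Suc in auto)
  then show ?case by (simp add: nderiv_def vector_derivative_at)
qed (use assms in \<open>simp add: nderiv_def\<close>)

lemma C_on_has_vector_derivative:
  assumes "C_on n S f" "k < n" "t \<in> S"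
  shows "(nderiv k f has_vector_derivative nderiv (Suc k) f t) (at t)"
  using assms vector_derivative_works[of "nderiv k f" "at t"] by (simp add: C_on_def nderiv_def)

text \<open>Lowering the exponent to \<open>min \<gamma> 1\<close> weakens the bounds where |t - t0|
  \<le> 1. At larger distances f vanishes on an open set, since R \<le> 1, and its derivatives
  vanish there too.\<close>

lemma condition_F_power_singularity:
  assumes F: "condition_F 2 \<gamma> t0 R f" and R: "R \<le> 1"
  obtains C where "power_singularity f (nderiv 1 f) (nderiv 2 f) t0 (min \<gamma> 1) C"
proof -
  define \<gamma>' where "\<gamma>' = min \<gamma> 1"
  from F obtain C0 where \<gamma>: "\<gamma> > 0" and con: "C_on 2 (- {t0}) f" and cont: "continuous_on UNIV f"
    and C0: "\<And>k t. k \<le> 2 \<Longrightarrow> t \<noteq> t0 \<Longrightarrow> norm (nderiv k f t) * \<bar>t - t0\<bar> powr (- \<gamma> + real k) \<le> C0"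
    and supp: "\<And>t. t \<notin> {t0 - R<..<t0 + R} \<Longrightarrow> f t = 0"
    unfolding condition_F_def by blast
  define C where "C = \<bar>C0\<bar>"
  have bound: "norm (nderiv k f t) \<le> C * \<bar>t - t0\<bar> powr (\<gamma>' - real k)" if "k \<le> 2" "t \<noteq> t0" for k t
  proof (cases "\<bar>t - t0\<bar> \<le> 1")
    case True
    have "norm (nderiv k f t) = norm (nderiv k f t) * \<bar>t - t0\<bar> powr (- \<gamma> + real k) * \<bar>t - t0\<bar> powr (\<gamma> - real k)"
      using that(2) by (simp add: mult.assoc flip: powr_add)
    also have "\<dots> \<le> C * \<bar>t - t0\<bar> powr (\<gamma> - real k)"
      using C0[OF that] by (intro mult_right_mono) (auto simp: C_def)
    also have "\<dots> \<le> C * \<bar>t - t0\<bar> powr (\<gamma>' - real k)"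
      using True by (intro mult_left_mono powr_mono') (auto simp: C_def \<gamma>'_def)
    finally show ?thesis .
  next
    case False
    have "open {t. \<bar>t - t0\<bar> > 1}"
      by (intro open_Collect_less continuous_intros)
    then have "nderiv k f t = 0"
      using False R by (rule_tac nderiv_eq_0_on_open) (auto intro!: supp)
    then show ?thesis by (simp add: C_def)
  qed
  \<comment> \<open>The bounds of Condition (F) exclude \<open>t0\<close>; the value there is
    obtained from continuity.\<close>
  have "((\<lambda>t. C * \<bar>t - t0\<bar> powr \<gamma>') \<longlongrightarrow> C * \<bar>t0 - t0\<bar> powr \<gamma>') (at t0)"
    using \<gamma> by (intro tendsto_intros) (auto simp: \<gamma>'_def)
  then have "(f \<longlongrightarrow> 0) (at t0)"
    by (intro Lim_null_comparison[of f "\<lambda>t. C * \<bar>t - t0\<bar> powr \<gamma>'"])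
       (use bound[of 0] in \<open>auto simp: eventually_at_filter nderiv_def\<close>)
  moreover have "(f \<longlongrightarrow> f t0) (at t0)"
    using cont by (simp add: continuous_on_eq_continuous_at continuous_at)
  ultimately have "f t0 = 0" using tendsto_unique trivial_limit_at by blast
  have "power_singularity f (nderiv 1 f) (nderiv 2 f) t0 \<gamma>' C"
  proof
    show "norm (f t) \<le> C * \<bar>t - t0\<bar> powr \<gamma>'" for t
      using bound[of 0 t] \<open>f t0 = 0\<close> by (cases "t = t0") (auto simp: nderiv_def)
    show "norm (nderiv 1 f t) \<le> C * \<bar>t - t0\<bar> powr (\<gamma>' - 1)" if "t \<noteq> t0" for t
      using bound[of 1 t] that by simp
    show "norm (nderiv 2 f t) \<le> C * \<bar>t - t0\<bar> powr (\<gamma>' - 2)" if "t \<noteq> t0" for t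
      using bound[of 2 t] that by simp
    show "(f has_vector_derivative nderiv 1 f t) (at t)" if "t \<noteq> t0" for t
      using C_on_has_vector_derivative[OF con, of 0 t] that by (simp add: nderiv_def)
    show "(nderiv 1 f has_vector_derivative nderiv 2 f t) (at t)" if "t \<noteq> t0" for t
      using C_on_has_vector_derivative[OF con, of 1 t] that by (simp add: numeral_2_eq_2)
  qed (use \<gamma> cont in \<open>auto simp: \<gamma>'_def C_def\<close>)
  then show thesis using that by (simp add: \<gamma>'_def)
qed

section \<open>The logistic function\<close>

definition logistic :: "real \<Rightarrow> real" where
  "logistic u = 1 / (1 + exp u)"

lemma fermi_eq_logistic: "fermi h \<mu> T \<xi> = logistic ((h \<xi> - \<mu>) / T)"
  by (simp add: fermi_def logistic_def)

lemma logistic_pos: "0 < logistic u" and logistic_less_1: "logistic u < 1"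
  by (auto simp: logistic_def add_pos_pos)

lemma one_minus_logistic: "1 - logistic u = logistic (- u)"
proof -
  have "1 + exp u > 0" by (simp add: add_pos_pos)
  then show ?thesis by (simp add: logistic_def exp_minus field_simps)
qed

lemma logistic_le_exp: "logistic u \<le> exp (- u)"
  by (simp add: logistic_def exp_minus divide_simps add_pos_pos)

lemma logistic_variance_le: "logistic u * (1 - logistic u) \<le> exp (- \<bar>u\<bar>)"
proof -
  have *: "logistic v * logistic (- v) \<le> exp (- v)" for v
    using mult_mono[OF logistic_le_exp[of v], of "logistic (- v)" 1] logistic_pos[of "-v"] logistic_less_1[of "-v"]
    by simp
  show ?thesis using *[of u] *[of "- u"] by (cases "u \<ge> 0") (auto simp: one_minus_logistic mult.commute)
qed

text \<open>The distance to the step is the smaller of a and 1 - a, and the other factor is at least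
  1/2.\<close>

lemma logistic_dist_step:
  "\<bar>logistic u - (if u < 0 then 1 else 0)\<bar> \<le> 2 * (logistic u * (1 - logistic u))"
proof (cases "u < 0")
  case True
  then have "logistic u \<ge> 1 / 2" by (simp add: logistic_def divide_simps add_pos_pos)
  then have "(1 - logistic u) * 1 \<le> (1 - logistic u) * (2 * logistic u)"
    using logistic_less_1[of u] by (intro mult_left_mono) auto
  then show ?thesis using True logistic_less_1[of u] by (simp add: mult_ac)
next
  case False
  then have "logistic u \<le> 1 / 2" by (simp add: logistic_def divide_simps add_pos_pos)
  then have "logistic u * 1 \<le> logistic u * (2 * (1 - logistic u))"
    using logistic_pos[of u] by (intro mult_left_mono) auto
  then show ?thesis using False logistic_pos[of u] by (simp add: mult_ac)
qed

text \<open>The bound involves a (1 - a) at u alone, so that it can be paired with a singular factor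
  evaluated at u. The 6 is 2 times 3: |exp x - 1| \<le> 2 |x| for |x| \<le> 1, and 1 + exp u \<le> 3
  (1 + exp v) because exp 1 \<le> 3.\<close>

lemma logistic_diff_le:
  assumes "\<bar>u - v\<bar> \<le> 1"
  shows "\<bar>logistic u - logistic v\<bar> \<le> 6 * \<bar>u - v\<bar> * (logistic u * (1 - logistic u))"
proof -
  have exp1: "exp 1 \<le> (3::real)" by (rule exp_le)
  have pos: "1 + exp x > 0" for x :: real by (simp add: add_pos_pos)
  have e: "\<bar>exp x - 1\<bar> \<le> 2 * \<bar>x\<bar>" if "\<bar>x\<bar> \<le> 1" for x :: real
  proof (cases "x \<ge> 0")
    case True
    have "exp x \<le> 1 + x + x\<^sup>2" using True that by (intro exp_bound) auto
    moreover have "x\<^sup>2 \<le> x" using True that by (simp add: power2_eq_square mult_left_le)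
    moreover have "1 + x \<le> exp x" by (rule exp_ge_add_one_self)
    ultimately show ?thesis using True by simp
  next
    case False
    have "1 + x \<le> exp x" by (rule exp_ge_add_one_self)
    moreover have "exp x \<le> 1" using False by simp
    ultimately have "\<bar>exp x - 1\<bar> \<le> \<bar>x\<bar>" using False by linarith
    then show ?thesis using abs_ge_zero[of x] by linarith
  qed
  have "logistic u - logistic v = (exp v - exp u) / ((1 + exp u) * (1 + exp v))"
    using pos[of u] pos[of v] by (simp add: logistic_def divide_simps)
  also have "exp v - exp u = exp u * (exp (v - u) - 1)"
    by (simp add: algebra_simps flip: exp_add)
  finally have "\<bar>logistic u - logistic v\<bar> = exp u * \<bar>exp (v - u) - 1\<bar> * inverse (1 + exp u) * inverse (1 + exp v)"
    using pos[of u] pos[of v] by (simp add: abs_mult divide_inverse)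
  also have "\<dots> \<le> exp u * (2 * \<bar>u - v\<bar>) * inverse (1 + exp u) * (3 * inverse (1 + exp u))"
  proof (intro mult_mono)
    show "\<bar>exp (v - u) - 1\<bar> \<le> 2 * \<bar>u - v\<bar>" using e[of "v - u"] assms by (simp add: abs_minus_commute)
    have "exp u \<le> exp (v + 1)" using assms by simp
    also have "\<dots> \<le> 3 * exp v" using exp1 by (simp add: exp_add)
    finally have "1 + exp u \<le> 3 * (1 + exp v)" by simp
    then show "inverse (1 + exp v) \<le> 3 * inverse (1 + exp u)"
      using pos[of u] pos[of v] by (simp add: divide_simps)
  qed (use pos[of u] pos[of v] in \<open>auto simp: less_imp_le\<close>)
  also have "\<dots> = 6 * \<bar>u - v\<bar> * (logistic u * (exp u * inverse (1 + exp u)))"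
    by (simp add: logistic_def divide_inverse)
  also have "exp u * inverse (1 + exp u) = 1 - logistic u"
    using pos[of u] by (simp add: logistic_def field_simps)
  finally show ?thesis .
qed

section \<open>Elementary integrals and the jump kernel\<close>

lemma nn_integral_lborel_pair:
  assumes [measurable]: "f \<in> borel_measurable (borel \<Otimes>\<^sub>M borel)"
  shows "(\<integral>\<^sup>+ z. f z \<partial>(lborel :: (real \<times> real) measure)) = (\<integral>\<^sup>+ x. \<integral>\<^sup>+ y. f (x, y) \<partial>lborel \<partial>lborel)"
  by (subst lborel_prod[symmetric], subst lborel.nn_integral_fst[symmetric]) auto

lemma nn_integral_lborel_swap:
  assumes [measurable]: "f \<in> borel_measurable (borel \<Otimes>\<^sub>M borel)"
  shows "(\<integral>\<^sup>+ z. f (snd z, fst z) \<partial>(lborel :: (real \<times> real) measure)) = (\<integral>\<^sup>+ z. f z \<partial>lborel)"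
  by (subst (1 2) nn_integral_lborel_pair) (auto simp: lborel_pair.Fubini'[of "\<lambda>x y. f (x, y)"] intro: lborel_pair.Fubini')

text \<open>Tonelli followed by a translation in every fibre. It reduces the integral of a majorant
  depending on one point and on the difference to an inner integral over the difference.\<close>

lemma nn_integral_lborel_shear:
  assumes [measurable]: "case_prod g \<in> borel_measurable (borel \<Otimes>\<^sub>M borel)"
  shows "(\<integral>\<^sup>+ z. g (fst z) (snd z - fst z) \<partial>(lborel :: (real \<times> real) measure))
    = (\<integral>\<^sup>+ x. \<integral>\<^sup>+ s. g x s \<partial>lborel \<partial>lborel)"
proof -
  have "(\<integral>\<^sup>+ y. g x (y - x) \<partial>lborel) = (\<integral>\<^sup>+ s. g x s \<partial>lborel)" for x
    by (subst nn_integral_real_affine[where c = 1 and t = x]) auto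
  then show ?thesis
    by (subst nn_integral_lborel_pair) auto
qed

section \<open>One-dimensional integrals\<close>

lemma nn_integral_inverse_square_atLeast:
  assumes "c > 0"
  shows "(\<integral>\<^sup>+ v. ennreal (1 / v\<^sup>2) * indicator {c..} v \<partial>lborel) = ennreal (1 / c)"
proof -
  have "((\<lambda>v::real. - 1 / v) \<longlongrightarrow> 0) at_top"
    by (intro tendsto_divide_0[OF tendsto_const] filterlim_at_top_imp_at_infinity filterlim_ident)
  then have "(\<integral>\<^sup>+ v. ennreal (1 / v\<^sup>2) * indicator {c..} v \<partial>lborel) = ennreal (0 - (- 1 / c))"
    using assms
    by (intro nn_integral_FTC_atLeast) (auto intro!: derivative_eq_intros simp: power2_eq_square)
  then show ?thesis by simp
qed

lemma nn_integral_inverse_square_outside: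
  assumes "c > 0"
  shows "(\<integral>\<^sup>+ s. ennreal (1 / s\<^sup>2) * indicator {s. \<bar>s\<bar> \<ge> c} s \<partial>lborel) = ennreal (2 / c)"
proof -
  have "(\<integral>\<^sup>+ s. ennreal (1 / s\<^sup>2) * indicator {s. \<bar>s\<bar> \<ge> c} s \<partial>lborel) =
    (\<integral>\<^sup>+ s. ennreal (1 / s\<^sup>2) * indicator {c..} s + ennreal (1 / (- s)\<^sup>2) * indicator {c..} (- s) \<partial>lborel)"
    using assms by (intro nn_integral_cong) (auto simp: indicator_def)
  also have "\<dots> = (\<integral>\<^sup>+ s. ennreal (1 / s\<^sup>2) * indicator {c..} s \<partial>lborel)
      + (\<integral>\<^sup>+ s. ennreal (1 / (- s)\<^sup>2) * indicator {c..} (- s) \<partial>lborel)"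
    by (intro nn_integral_add) auto
  also have "(\<integral>\<^sup>+ s. ennreal (1 / (- s)\<^sup>2) * indicator {c..} (- s) \<partial>lborel) = (\<integral>\<^sup>+ s. ennreal (1 / s\<^sup>2) * indicator {c..} s \<partial>lborel)"
    by (subst (2) nn_integral_real_affine[where c = "-1" and t = 0]) auto
  finally show ?thesis
    using assms nn_integral_inverse_square_atLeast[OF assms] by (simp flip: ennreal_plus)
qed

lemma nn_integral_powr_inside:
  assumes "0 < \<kappa>" "0 \<le> L"
  shows "(\<integral>\<^sup>+ s. ennreal (\<bar>s\<bar> powr (\<kappa> - 1)) * indicator {s. \<bar>s\<bar> \<le> L} s \<partial>lborel) = ennreal (2 * L powr \<kappa> / \<kappa>)"
proof -
  have half: "(\<integral>\<^sup>+ s. ennreal (s powr (\<kappa> - 1)) * indicator {0..L} s \<partial>lborel) = ennreal (L powr \<kappa> / \<kappa>)"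
    using nn_integral_has_integral_lebesgue[OF _ has_integral_powr_from_0[of "\<kappa> - 1" L]] assms
    by (simp add: nn_integral_completion mult.commute indicator_mult_ennreal)
  \<comment> \<open>Both summands are active at s = 0, but \<open>0 powr (\<kappa> - 1) = 0\<close>,
    so the identity holds at every point.\<close>
  have "(\<integral>\<^sup>+ s. ennreal (\<bar>s\<bar> powr (\<kappa> - 1)) * indicator {s. \<bar>s\<bar> \<le> L} s \<partial>lborel) =
    (\<integral>\<^sup>+ s. ennreal (s powr (\<kappa> - 1)) * indicator {0..L} s + ennreal ((- s) powr (\<kappa> - 1)) * indicator {0..L} (- s) \<partial>lborel)"
    using assms by (intro nn_integral_cong) (auto simp: indicator_def)
  also have "\<dots> = (\<integral>\<^sup>+ s. ennreal (s powr (\<kappa> - 1)) * indicator {0..L} s \<partial>lborel)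
      + (\<integral>\<^sup>+ s. ennreal ((- s) powr (\<kappa> - 1)) * indicator {0..L} (- s) \<partial>lborel)"
    by (intro nn_integral_add) auto
  also have "(\<integral>\<^sup>+ s. ennreal ((- s) powr (\<kappa> - 1)) * indicator {0..L} (- s) \<partial>lborel) = (\<integral>\<^sup>+ s. ennreal (s powr (\<kappa> - 1)) * indicator {0..L} s \<partial>lborel)"
    by (subst (2) nn_integral_real_affine[where c = "-1" and t = 0]) auto
  finally show ?thesis
    using assms half by (simp flip: ennreal_plus)
qed

text \<open>Uniform in t, which may lie anywhere on the line: within distance 1 of t the full
  singular integral 2 / \<kappa> is an upper bound, and beyond it the integrand is at most
  1.\<close>

lemma nn_integral_powr_unit_interval:
  assumes "0 < \<kappa>" "\<kappa> \<le> 1"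
  shows "(\<integral>\<^sup>+ y. ennreal (\<bar>y - t\<bar> powr (\<kappa> - 1)) * indicator {0..1} y \<partial>lborel) \<le> ennreal (2 / \<kappa> + 1)"
proof -
  have "(\<integral>\<^sup>+ y. ennreal (\<bar>y - t\<bar> powr (\<kappa> - 1)) * indicator {0..1} y \<partial>lborel) \<le>
    (\<integral>\<^sup>+ y. ennreal (\<bar>y - t\<bar> powr (\<kappa> - 1)) * indicator {s. \<bar>s\<bar> \<le> 1} (y - t) + indicator {0..1} y \<partial>lborel)"
  proof (rule nn_integral_mono)
    fix y :: real
    show "ennreal (\<bar>y - t\<bar> powr (\<kappa> - 1)) * indicator {0..1} y \<le>
      ennreal (\<bar>y - t\<bar> powr (\<kappa> - 1)) * indicator {s. \<bar>s\<bar> \<le> 1} (y - t) + indicator {0..1} y"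
    proof (cases "\<bar>y - t\<bar> \<le> 1")
      case False
      then have "\<bar>y - t\<bar> powr (\<kappa> - 1) \<le> \<bar>y - t\<bar> powr 0" using assms by (intro powr_mono) auto
      also have "\<dots> = 1" using False by auto
      finally show ?thesis using False by (auto simp: indicator_def)
    qed (auto simp: indicator_def)
  qed
  also have "\<dots> = (\<integral>\<^sup>+ y. ennreal (\<bar>y - t\<bar> powr (\<kappa> - 1)) * indicator {s. \<bar>s\<bar> \<le> 1} (y - t) \<partial>lborel) + (\<integral>\<^sup>+ y. indicator {0..1::real} y \<partial>lborel)"
    by (intro nn_integral_add) auto
  also have "(\<integral>\<^sup>+ y. ennreal (\<bar>y - t\<bar> powr (\<kappa> - 1)) * indicator {s. \<bar>s\<bar> \<le> 1} (y - t) \<partial>lborel) = ennreal (2 / \<kappa>)"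
    using nn_integral_powr_inside[OF assms(1), of 1]
    by (subst nn_integral_real_affine[where c = 1 and t = t]) auto
  finally show ?thesis using assms by (simp add: ennreal_plus)
qed

lemma nn_integral_inverse_1_plus_square:
  "(\<integral>\<^sup>+ x. ennreal (1 / (1 + x\<^sup>2)) \<partial>lborel) \<le> ennreal 4"
proof -
  have "(\<integral>\<^sup>+ x. ennreal (1 / (1 + x\<^sup>2)) \<partial>lborel) \<le>
    (\<integral>\<^sup>+ x. indicator {-1..1::real} x + ennreal (1 / x\<^sup>2) * indicator {s. \<bar>s\<bar> \<ge> 1} x \<partial>lborel)"
  proof (rule nn_integral_mono)
    fix x :: real
    have "1 / (1 + x\<^sup>2) \<le> 1" by (simp add: divide_simps add_pos_nonneg)
    moreover have "1 / (1 + x\<^sup>2) \<le> 1 / x\<^sup>2" if "\<bar>x\<bar> \<ge> 1" using that by (intro divide_left_mono) (auto simp: add_pos_nonneg)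
    ultimately show "ennreal (1 / (1 + x\<^sup>2)) \<le> indicator {-1..1::real} x + ennreal (1 / x\<^sup>2) * indicator {s. \<bar>s\<bar> \<ge> 1} x"
      by (cases "\<bar>x\<bar> \<ge> 1") (auto simp: indicator_def ennreal_leI add_increasing)
  qed
  also have "\<dots> = (\<integral>\<^sup>+ x. indicator {-1..1::real} x \<partial>lborel) + (\<integral>\<^sup>+ x. ennreal (1 / x\<^sup>2) * indicator {s. \<bar>s\<bar> \<ge> 1} x \<partial>lborel)"
    by (intro nn_integral_add) auto
  also have "\<dots> = ennreal 2 + ennreal 2"
    using nn_integral_inverse_square_outside[of 1] by simp
  finally show ?thesis by (simp flip: ennreal_plus)
qed

lemma nn_integral_inverse_max:
  assumes "0 < \<tau>" "\<tau> \<le> L"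
  shows "(\<integral>\<^sup>+ v. ennreal (1 / max v \<tau>) * indicator {0<..<L} v \<partial>lborel) = ennreal (1 + ln (L / \<tau>))"
proof -
  have "(\<integral>\<^sup>+ v. ennreal (1 / max v \<tau>) * indicator {0<..<L} v \<partial>lborel) =
    (\<integral>\<^sup>+ v. ennreal (1 / \<tau>) * indicator {0<..<\<tau>} v + ennreal (1 / v) * indicator {\<tau>..L} v \<partial>lborel)"
  \<comment> \<open>The two sides differ only at v = L, which belongs to the closed interval but not
    to the open one.\<close>
  proof (rule nn_integral_cong_AE)
    have "AE v in lborel. v \<noteq> L" by (rule AE_lborel_singleton)
    then show "AE v in lborel. ennreal (1 / max v \<tau>) * indicator {0<..<L} v
        = ennreal (1 / \<tau>) * indicator {0<..<\<tau>} v + ennreal (1 / v) * indicator {\<tau>..L} v"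
      by eventually_elim (use assms in \<open>auto simp: indicator_def max_def\<close>)
  qed
  also have "\<dots> = (\<integral>\<^sup>+ v. ennreal (1 / \<tau>) * indicator {0<..<\<tau>} v \<partial>lborel) + (\<integral>\<^sup>+ v. ennreal (1 / v) * indicator {\<tau>..L} v \<partial>lborel)"
    by (intro nn_integral_add) auto
  also have "(\<integral>\<^sup>+ v. ennreal (1 / \<tau>) * indicator {0<..<\<tau>} v \<partial>lborel) = ennreal 1"
    using assms by (simp add: nn_integral_cmult flip: ennreal_mult)
  also have "(\<integral>\<^sup>+ v. ennreal (1 / v) * indicator {\<tau>..L} v \<partial>lborel) = ennreal (ln L - ln \<tau>)"
    using assms by (intro nn_integral_FTC_Icc) (auto intro!: derivative_eq_intros)
  also have "ennreal 1 + ennreal (ln L - ln \<tau>) = ennreal (1 + (ln L - ln \<tau>))"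
    using assms by (intro ennreal_plus[symmetric]) auto
  finally show ?thesis using assms by (simp add: ln_div)
qed

text \<open>The main term up to the factor \<open>U 1 0 f\<close>. For an interval, each endpoint
  makes the untruncated kernel diverge logarithmically; the cutoff turns this into |ln
  \<tau>|.\<close>

definition jump_kernel :: "real set \<Rightarrow> real \<Rightarrow> real \<times> real \<Rightarrow> real" where
  "jump_kernel S \<tau> z = (if (fst z \<in> S) \<noteq> (snd z \<in> S) \<and> \<tau> \<le> \<bar>fst z - snd z\<bar> then 1 / (fst z - snd z)\<^sup>2 else 0)"

lemma jump_kernel_nonneg: "0 \<le> jump_kernel S \<tau> z"
  by (simp add: jump_kernel_def)

lemma jump_kernel_measurable [measurable]:
  assumes [measurable]: "S \<in> sets borel"
  shows "jump_kernel S \<tau> \<in> borel_measurable (borel \<Otimes>\<^sub>M borel)"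
  unfolding jump_kernel_def by measurable

text \<open>To the left of a the distance from x is at least x - a, to the right of b at least b -
  x; the cutoff raises either threshold to at least \<tau>.\<close>

lemma nn_integral_leave_interval:
  assumes x: "x \<in> {a<..<b}" and \<tau>: "0 < \<tau>"
  shows "(\<integral>\<^sup>+ y. ennreal (1 / (x - y)\<^sup>2) * indicator {y. y \<notin> {a<..<b} \<and> \<tau> \<le> \<bar>x - y\<bar>} y \<partial>lborel)
    = ennreal (1 / max (x - a) \<tau>) + ennreal (1 / max (b - x) \<tau>)"
proof -
  have "(\<integral>\<^sup>+ y. ennreal (1 / (x - y)\<^sup>2) * indicator {y. y \<notin> {a<..<b} \<and> \<tau> \<le> \<bar>x - y\<bar>} y \<partial>lborel) =
    (\<integral>\<^sup>+ y. ennreal (1 / (x - y)\<^sup>2) * indicator {max (x - a) \<tau>..} (x - y)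
      + ennreal (1 / (y - x)\<^sup>2) * indicator {max (b - x) \<tau>..} (y - x) \<partial>lborel)"
    using x \<tau> by (intro nn_integral_cong) (auto simp: indicator_def power2_commute)
  also have "\<dots> = (\<integral>\<^sup>+ y. ennreal (1 / (x - y)\<^sup>2) * indicator {max (x - a) \<tau>..} (x - y) \<partial>lborel)
      + (\<integral>\<^sup>+ y. ennreal (1 / (y - x)\<^sup>2) * indicator {max (b - x) \<tau>..} (y - x) \<partial>lborel)"
    by (intro nn_integral_add) auto
  also have "(\<integral>\<^sup>+ y. ennreal (1 / (x - y)\<^sup>2) * indicator {max (x - a) \<tau>..} (x - y) \<partial>lborel) = ennreal (1 / max (x - a) \<tau>)"
    using \<tau> by (subst nn_integral_real_affine[where c = "-1" and t = x]) (auto simp: nn_integral_inverse_square_atLeast)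
  also have "(\<integral>\<^sup>+ y. ennreal (1 / (y - x)\<^sup>2) * indicator {max (b - x) \<tau>..} (y - x) \<partial>lborel) = ennreal (1 / max (b - x) \<tau>)"
    using \<tau> by (subst nn_integral_real_affine[where c = 1 and t = x]) (auto simp: nn_integral_inverse_square_atLeast)
  finally show ?thesis .
qed

text \<open>The factor 4 counts two endpoints and two orders of the coordinates. Each of these
  contributes 1 from the plateau of width \<tau> and a logarithm from the rest of the
  interval.\<close>

lemma nn_integral_jump_kernel_interval:
  assumes \<tau>: "0 < \<tau>" "\<tau> \<le> b - a"
  shows "(\<integral>\<^sup>+ z. ennreal (jump_kernel {a<..<b} \<tau> z) \<partial>lborel) = ennreal (4 * (1 + ln ((b - a) / \<tau>)))"
proof -
  define g :: "real \<times> real \<Rightarrow> ennreal" where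
    "g z = (if fst z \<in> {a<..<b} \<and> snd z \<notin> {a<..<b} \<and> \<tau> \<le> \<bar>fst z - snd z\<bar> then ennreal (1 / (fst z - snd z)\<^sup>2) else 0)" for z
  have g[measurable]: "g \<in> borel_measurable (borel \<Otimes>\<^sub>M borel)"
    unfolding g_def by measurable
  have ln0: "0 \<le> 1 + ln ((b - a) / \<tau>)" using \<tau> by (simp add: add_increasing)
  have left: "(\<integral>\<^sup>+ x. ennreal (1 / max (x - a) \<tau>) * indicator {a<..<b} x \<partial>lborel) = ennreal (1 + ln ((b - a) / \<tau>))"
    by (subst nn_integral_real_affine[where c = 1 and t = a])
       (use nn_integral_inverse_max[OF \<tau>] in \<open>auto simp: indicator_def less_diff_eq add.commute if_distrib cong: if_cong\<close>)
  have right: "(\<integral>\<^sup>+ x. ennreal (1 / max (b - x) \<tau>) * indicator {a<..<b} x \<partial>lborel) = ennreal (1 + ln ((b - a) / \<tau>))"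
  proof -
    have "(\<integral>\<^sup>+ x. ennreal (1 / max (b - x) \<tau>) * indicator {a<..<b} x \<partial>lborel) =
      (\<integral>\<^sup>+ v. ennreal (1 / max v \<tau>) * indicator {0<..<b - a} v \<partial>lborel)"
      by (subst nn_integral_real_affine[where c = "-1" and t = b]) (auto simp: indicator_def intro!: nn_integral_cong)
    then show ?thesis using nn_integral_inverse_max[OF \<tau>] by simp
  qed
  have "(\<integral>\<^sup>+ z. g z \<partial>lborel) = (\<integral>\<^sup>+ x. (\<integral>\<^sup>+ y. g (x, y) \<partial>lborel) \<partial>lborel)"
    by (rule nn_integral_lborel_pair) measurable
  also have "\<dots> = (\<integral>\<^sup>+ x. ennreal (1 / max (x - a) \<tau>) * indicator {a<..<b} x + ennreal (1 / max (b - x) \<tau>) * indicator {a<..<b} x \<partial>lborel)"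
  proof (rule nn_integral_cong)
    fix x :: real
    show "(\<integral>\<^sup>+ y. g (x, y) \<partial>lborel) =
      ennreal (1 / max (x - a) \<tau>) * indicator {a<..<b} x + ennreal (1 / max (b - x) \<tau>) * indicator {a<..<b} x"
    proof (cases "x \<in> {a<..<b}")
      case True
      then have "(\<integral>\<^sup>+ y. g (x, y) \<partial>lborel) =
        (\<integral>\<^sup>+ y. ennreal (1 / (x - y)\<^sup>2) * indicator {y. y \<notin> {a<..<b} \<and> \<tau> \<le> \<bar>x - y\<bar>} y \<partial>lborel)"
        by (intro nn_integral_cong) (auto simp: g_def indicator_def)
      with True nn_integral_leave_interval[OF True \<tau>(1)] show ?thesis by simp
    qed (auto simp: g_def)
  qed
  also have "\<dots> = ennreal (1 + ln ((b - a) / \<tau>)) + ennreal (1 + ln ((b - a) / \<tau>))"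
    by (subst nn_integral_add) (auto simp: left right)
  also have "\<dots> = ennreal (2 * (1 + ln ((b - a) / \<tau>)))" using ln0 by (simp flip: ennreal_plus)
  finally have g_int: "(\<integral>\<^sup>+ z. g z \<partial>lborel) = ennreal (2 * (1 + ln ((b - a) / \<tau>)))" .
  have "(\<integral>\<^sup>+ z. ennreal (jump_kernel {a<..<b} \<tau> z) \<partial>lborel) = (\<integral>\<^sup>+ z. g z + g (snd z, fst z) \<partial>lborel)"
    by (intro nn_integral_cong) (auto simp: g_def jump_kernel_def indicator_def power2_commute abs_minus_commute)
  also have "\<dots> = (\<integral>\<^sup>+ z. g z \<partial>lborel) + (\<integral>\<^sup>+ z. g (snd z, fst z) \<partial>lborel)"
    unfolding lborel_prod[symmetric] by (intro nn_integral_add) auto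
  also have "\<dots> = ennreal (2 * (1 + ln ((b - a) / \<tau>))) + ennreal (2 * (1 + ln ((b - a) / \<tau>)))"
    using g_int by (simp add: nn_integral_lborel_swap)
  also have "\<dots> = ennreal (4 * (1 + ln ((b - a) / \<tau>)))" using ln0 by (simp flip: ennreal_plus)
  finally show ?thesis .
qed

section \<open>Concentration at the Fermi points\<close>

lemma logistic_deriv:
  "(logistic has_real_derivative - (logistic u * (1 - logistic u))) (at u)"
proof -
  have "1 + exp u \<noteq> 0" using exp_gt_zero[of u] by linarith
  then show ?thesis unfolding logistic_def
    by (auto intro!: derivative_eq_intros simp: divide_simps power2_eq_square)
qed

lemma continuous_logistic [continuous_intros]:
  assumes "continuous_on S v"
  shows "continuous_on S (\<lambda>x. logistic (v x))"
proof -
  have "1 + exp y \<noteq> 0" for y :: real using exp_gt_zero[of y] by linarith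
  then show ?thesis using assms unfolding logistic_def by (intro continuous_intros) auto
qed

text \<open>For 0 < a < 1, taking t = 0 or t = 1 gives a^\<kappa> (1 - a) or a (1 - a)^\<kappa>,
  which measure the distance of a to the step; t = t0 carries the singularity of the test function.
  At a = t the value is 0.\<close>

definition logistic_weight :: "real \<Rightarrow> real \<Rightarrow> real \<Rightarrow> real" where
  "logistic_weight \<kappa> t a = a * (1 - a) * \<bar>a - t\<bar> powr (\<kappa> - 1)"

lemma logistic_weight_reflect: "logistic_weight \<kappa> (1 - t) (1 - a) = logistic_weight \<kappa> t a"
  by (simp add: logistic_weight_def abs_minus_commute mult.commute)

lemma logistic_weight_nonneg: "0 \<le> logistic_weight \<kappa> t (logistic u)"
  using logistic_pos[of u] logistic_less_1[of u] by (simp add: logistic_weight_def)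

text \<open>The function 1 - logistic (v) = logistic (- v) increases along with v, as the
  substitution rule requires; the singular point moves from t to 1 - t accordingly. Its derivative
  is at least c a (1 - a), whence the factor 1 / c. Its range lies in [0, 1], so the bound depends
  neither on t nor on the interval.\<close>

lemma nn_integral_logistic_weight_increasing:
  assumes v: "\<And>x. x \<in> {l..r} \<Longrightarrow> (v has_real_derivative v' x) (at x)"
    and v': "continuous_on {l..r} v'" "\<And>x. x \<in> {l..r} \<Longrightarrow> v' x \<ge> c"
    and c: "c > 0" and lr: "l \<le> r" and \<kappa>: "0 < \<kappa>" "\<kappa> \<le> 1"
  shows "(\<integral>\<^sup>+ x. ennreal (logistic_weight \<kappa> t (logistic (v x))) * indicator {l..r} x \<partial>lborel)
    \<le> ennreal ((2 / \<kappa> + 1) / c)"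
proof -
  define g where "g x = logistic (- v x)" for x
  define g' where "g' x = logistic (- v x) * (1 - logistic (- v x)) * v' x" for x
  define F :: "real \<Rightarrow> real" where "F y = \<bar>y - (1 - t)\<bar> powr (\<kappa> - 1)" for y
  have Fm[measurable]: "F \<in> borel_measurable borel" unfolding F_def by measurable
  have contv: "continuous_on {l..r} v"
    using v by (intro continuous_at_imp_continuous_on ballI DERIV_isCont) auto
  have pos: "0 < logistic (- v x) * (1 - logistic (- v x))" for x
    using logistic_pos[of "- v x"] logistic_less_1[of "- v x"] by simp
  have "(\<integral>\<^sup>+ x. F x * indicator {g l..g r} x \<partial>lborel) = (\<integral>\<^sup>+ x. F (g x) * g' x * indicator {l..r} x \<partial>lborel)"
  proof (rule nn_integral_substitution)
    show "(g has_real_derivative g' x) (at x)" if "x \<in> {l..r}" for x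
      unfolding g_def g'_def
      using DERIV_chain2[OF logistic_deriv DERIV_minus[OF v[OF that]]] by simp
    show "continuous_on {l..r} g'"
      unfolding g'_def using v' contv by (intro continuous_intros) auto
    show "0 \<le> g' x" if "x \<in> {l..r}" for x
      using pos[of x] v'(2)[OF that] c by (simp add: g'_def)
    show "set_borel_measurable borel {g l..g r} F" by (simp add: set_borel_measurable_def)
  qed fact
  moreover have "(\<integral>\<^sup>+ x. F x * indicator {g l..g r} x \<partial>lborel) \<le> ennreal (2 / \<kappa> + 1)"
  proof -
    have "(\<integral>\<^sup>+ x. F x * indicator {g l..g r} x \<partial>lborel) \<le> (\<integral>\<^sup>+ x. ennreal (F x) * indicator {0..1} x \<partial>lborel)"
      using logistic_pos[of "- v l"] logistic_less_1[of "- v r"]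
      by (intro nn_integral_mono) (auto simp: g_def indicator_def)
    then show ?thesis
      using nn_integral_powr_unit_interval[OF \<kappa>, of "1 - t"] unfolding F_def by (rule order.trans)
  qed
  ultimately have int: "(\<integral>\<^sup>+ x. F (g x) * g' x * indicator {l..r} x \<partial>lborel) \<le> ennreal (2 / \<kappa> + 1)" by simp
  \<comment> \<open>The function v is controlled only on the interval, so g and g' are cut off
    before F is applied.\<close>
  have g'm: "(\<lambda>x. ennreal (F (g x) * g' x * indicator {l..r} x)) \<in> borel_measurable borel"
  proof -
    have "(\<lambda>x. indicator {l..r} x *\<^sub>R g x) \<in> borel_measurable borel" "(\<lambda>x. indicator {l..r} x *\<^sub>R g' x) \<in> borel_measurable borel"
      unfolding g_def g'_def using contv v'
      by (intro borel_measurable_continuous_on_indicator continuous_intros; simp)+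
    then have "(\<lambda>x. ennreal (F (indicator {l..r} x *\<^sub>R g x) * (indicator {l..r} x *\<^sub>R g' x))) \<in> borel_measurable borel"
      by measurable
    then show ?thesis by (rule measurable_cong[THEN iffD1, rotated]) (auto simp: indicator_def)
  qed
  have "(\<integral>\<^sup>+ x. ennreal (logistic_weight \<kappa> t (logistic (v x))) * indicator {l..r} x \<partial>lborel)
    \<le> (\<integral>\<^sup>+ x. ennreal (1 / c) * ennreal (F (g x) * g' x * indicator {l..r} x) \<partial>lborel)"
  proof (rule nn_integral_mono)
    fix x
    show "ennreal (logistic_weight \<kappa> t (logistic (v x))) * indicator {l..r} x
      \<le> ennreal (1 / c) * ennreal (F (g x) * g' x * indicator {l..r} x)"
    proof (cases "x \<in> {l..r}")
      case True
      have eq: "logistic (v x) = 1 - g x" unfolding g_def using one_minus_logistic[of "v x"] by simp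
      have "logistic_weight \<kappa> t (logistic (v x)) = F (g x) * (g x * (1 - g x))"
        unfolding eq using logistic_weight_reflect[of \<kappa> "1 - t" "g x"]
        by (simp add: logistic_weight_def F_def)
      also have "\<dots> \<le> F (g x) * (1 / c * g' x)"
        using v'(2)[OF True] pos[of x] c
        by (intro mult_left_mono) (auto simp: g_def g'_def F_def divide_simps mult_left_mono)
      finally show ?thesis using True c
        by (auto simp: ennreal_mult'[symmetric] mult_ac intro!: ennreal_leI)
    qed simp
  qed
  also have "\<dots> = ennreal (1 / c) * (\<integral>\<^sup>+ x. ennreal (F (g x) * g' x * indicator {l..r} x) \<partial>lborel)"
    using g'm by (intro nn_integral_cmult) auto
  also have "(\<integral>\<^sup>+ x. ennreal (F (g x) * g' x * indicator {l..r} x) \<partial>lborel) \<le> ennreal (2 / \<kappa> + 1)"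
    using int by (simp add: indicator_def if_distrib cong: if_cong)
  also have "ennreal (1 / c) * ennreal (2 / \<kappa> + 1) = ennreal ((2 / \<kappa> + 1) / c)"
    using c by (subst ennreal_mult'[symmetric]) auto
  finally show ?thesis by (simp add: mult_left_mono)
qed

text \<open>The decreasing case is the increasing one for - v and 1 - t, since the weight is
  invariant under reflecting both a and t.\<close>

lemma nn_integral_logistic_weight_interval:
  assumes v: "\<And>x. x \<in> {l..r} \<Longrightarrow> (v has_real_derivative v' x) (at x)"
    and v': "continuous_on {l..r} v'" "(\<forall>x\<in>{l..r}. v' x \<ge> c) \<or> (\<forall>x\<in>{l..r}. v' x \<le> - c)"
    and c: "c > 0" and lr: "l \<le> r" and \<kappa>: "0 < \<kappa>" "\<kappa> \<le> 1"
  shows "(\<integral>\<^sup>+ x. ennreal (logistic_weight \<kappa> t (logistic (v x))) * indicator {l..r} x \<partial>lborel)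
    \<le> ennreal ((2 / \<kappa> + 1) / c)"
  using v'(2)
proof
  assume "\<forall>x\<in>{l..r}. v' x \<ge> c"
  then show ?thesis by (intro nn_integral_logistic_weight_increasing[where v' = v'] assms) auto
next
  assume "\<forall>x\<in>{l..r}. v' x \<le> - c"
  then have neg: "- v' x \<ge> c" if "x \<in> {l..r}" for x using that by (metis le_minus_iff)
  have "(\<integral>\<^sup>+ x. ennreal (logistic_weight \<kappa> (1 - t) (logistic (- v x))) * indicator {l..r} x \<partial>lborel)
      \<le> ennreal ((2 / \<kappa> + 1) / c)"
    by (intro nn_integral_logistic_weight_increasing[where v' = "\<lambda>x. - v' x"] assms continuous_intros)
       (use neg in \<open>auto intro!: derivative_eq_intros v\<close>)
  then show ?thesis
    by (simp add: logistic_weight_reflect flip: one_minus_logistic)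
qed

text \<open>The weight is a^\<kappa> (1 - a). It decays at rate \<kappa> as u grows, where a tends
  to its singular point 0, and at rate 1 \<ge> \<kappa> on the other side.\<close>

lemma logistic_weight_decay_0:
  assumes "0 < \<kappa>" "\<kappa> \<le> 1"
  shows "logistic_weight \<kappa> 0 (logistic u) \<le> exp (- \<kappa> * \<bar>u\<bar>)"
proof -
  have L: "0 < logistic u" "logistic u < 1" by (rule logistic_pos logistic_less_1)+
  have "logistic_weight \<kappa> 0 (logistic u) = logistic u powr \<kappa> * (1 - logistic u)"
    using L by (simp add: logistic_weight_def powr_diff)
  also have "\<dots> \<le> exp (- \<kappa> * \<bar>u\<bar>)"
  proof (cases "u \<ge> 0")
    case True
    have "logistic u powr \<kappa> * (1 - logistic u) \<le> exp (- u) powr \<kappa> * 1"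
      using L assms by (intro mult_mono powr_mono2 logistic_le_exp) auto
    then show ?thesis using True by (simp add: exp_powr_real mult.commute)
  next
    case False
    have "logistic u powr \<kappa> * (1 - logistic u) \<le> 1 * exp u"
      using L assms logistic_le_exp[of "- u"]
      by (intro mult_mono powr_le1) (simp_all add: flip: one_minus_logistic)
    also have "exp u \<le> exp (- \<kappa> * \<bar>u\<bar>)" using False assms by (simp add: mult_left_le)
    finally show ?thesis by simp
  qed
  finally show ?thesis .
qed

lemma logistic_weight_decay:
  assumes \<kappa>: "0 < \<kappa>" "\<kappa> \<le> 1"
  shows "\<exists>K\<ge>0. \<exists>M. \<forall>u. \<bar>u\<bar> \<ge> M \<longrightarrow> logistic_weight \<kappa> t (logistic u) \<le> K * exp (- \<kappa> * \<bar>u\<bar>)"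
proof -
  consider "t = 0" | "t = 1" | "t \<noteq> 0" "t \<noteq> 1" by blast
  then show ?thesis
  proof cases
    case 1
    then show ?thesis using logistic_weight_decay_0[OF \<kappa>] by (intro exI[of _ 1]) auto
  next
    case 2
    have "logistic_weight \<kappa> 1 (logistic u) \<le> exp (- \<kappa> * \<bar>u\<bar>)" for u
      using logistic_weight_decay_0[OF \<kappa>, of "- u"] logistic_weight_reflect[of \<kappa> 1 "logistic u"]
      by (simp add: one_minus_logistic)
    then show ?thesis using 2 by (intro exI[of _ 1]) auto
  next
    case 3
    \<comment> \<open>Half the distance of t to the set {0, 1}. Once exp (- |u|) \<le> d, the value
      logistic (u) is within d of 0 or 1 and hence at least d away from t.\<close>
    define d where "d = min \<bar>t\<bar> \<bar>1 - t\<bar> / 2"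
    have d: "d > 0" using 3 by (simp add: d_def)
    show ?thesis
    proof (intro exI conjI allI impI)
      show "d powr (\<kappa> - 1) \<ge> 0" by simp
      fix u assume u: "\<bar>u\<bar> \<ge> - ln d"
      have L: "0 < logistic u" "logistic u < 1" by (rule logistic_pos logistic_less_1)+
      have "exp (- \<bar>u\<bar>) \<le> exp (ln d)" using u by simp
      then have ed: "exp (- \<bar>u\<bar>) \<le> d" using d by simp
      have "\<bar>logistic u - t\<bar> \<ge> d"
      proof (cases "u \<ge> 0")
        case True
        then have "logistic u \<le> d" using ed logistic_le_exp[of u] by simp
        moreover have "\<bar>t\<bar> \<ge> 2 * d" by (simp add: d_def)
        ultimately show ?thesis using L by linarith
      next
        case False
        then have "1 - logistic u \<le> d" using ed logistic_le_exp[of "- u"] by (simp add: one_minus_logistic)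
        moreover have "\<bar>1 - t\<bar> \<ge> 2 * d" by (simp add: d_def)
        ultimately show ?thesis using L by linarith
      qed
      then have "\<bar>logistic u - t\<bar> powr (\<kappa> - 1) \<le> d powr (\<kappa> - 1)"
        using d \<kappa> by (intro powr_mono2') auto
      moreover have "logistic u * (1 - logistic u) \<le> exp (- \<kappa> * \<bar>u\<bar>)"
        using logistic_variance_le[of u] \<kappa> mult_right_mono[of \<kappa> 1 "\<bar>u\<bar>"]
        by (elim order.trans) simp
      ultimately have "logistic u * (1 - logistic u) * \<bar>logistic u - t\<bar> powr (\<kappa> - 1) \<le> exp (- \<kappa> * \<bar>u\<bar>) * d powr (\<kappa> - 1)"
        using L by (intro mult_mono) auto
      then show "logistic_weight \<kappa> t (logistic u) \<le> d powr (\<kappa> - 1) * exp (- \<kappa> * \<bar>u\<bar>)"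
        by (simp add: logistic_weight_def mult.commute)
    qed
  qed
qed

text \<open>A single term of the exponential series bounds exp y from below.\<close>

lemma exp_minus_le_power:
  assumes "y > (0::real)"
  shows "exp (- y) \<le> fact m / y ^ m"
proof -
  have "(\<Sum>n\<in>{m}. y ^ n /\<^sub>R fact n) \<le> exp y"
    unfolding exp_def using assms by (intro sum_le_suminf summable_exp_generic) auto
  then show ?thesis using assms by (simp add: exp_minus divide_simps mult.commute)
qed

text \<open>The part of Condition (H) that the estimates work with, h' being named explicitly. The
  normalisation \<open>C1 \<ge> 1\<close> makes the local scales at least 1.\<close>

locale dispersion =
  fixes h h' :: "real \<Rightarrow> real" and \<mu> \<beta>1 c0 r0 \<beta>2 C1 :: real
  assumes h_deriv: "(h has_real_derivative h' x) (at x)"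
    and h'_cont: "continuous_on UNIV h'"
    and growth_const: "\<beta>1 > 0" "c0 > 0"
    and growth: "\<bar>x\<bar> \<ge> r0 \<Longrightarrow> h x \<ge> c0 * \<bar>x\<bar> powr \<beta>1"
    and h'_growth_const: "\<beta>2 \<ge> 0" "C1 \<ge> 1"
    and h'_growth: "\<bar>h' x\<bar> \<le> C1 * (1 + \<bar>x\<bar>) powr \<beta>2"
    and regular: "h x = \<mu> \<Longrightarrow> h' x \<noteq> 0"
    and finite_components: "finite (components (sublevel h \<mu>))"
begin

section \<open>The level set of \<open>h\<close> and the weighted integrals around it\<close>

lemma h_cont: "continuous_on S h"
  using h_deriv by (intro continuous_at_imp_continuous_on ballI DERIV_isCont)

lemma h_measurable [measurable]: "h \<in> borel_measurable borel"
  using h_cont by (rule borel_measurable_continuous_onI)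

text \<open>Half of c0 |x|^\<beta>1 absorbs \<mu> once |x|^\<beta>1 \<ge> 2 |\<mu>| / c0; replacing
  |x| by 1 + |x| \<le> 2 |x| costs the factor (1/2)^\<beta>1.\<close>

lemma growth':
  obtains c \<rho> where "c > 0" "\<rho> > 0" "\<And>x. \<bar>x\<bar> \<ge> \<rho> \<Longrightarrow> h x - \<mu> \<ge> c * (1 + \<bar>x\<bar>) powr \<beta>1"
proof -
  define c where "c = c0 / 2 * (1 / 2) powr \<beta>1"
  define \<rho> where "\<rho> = max (max r0 1) ((2 * \<bar>\<mu>\<bar> / c0) powr (1 / \<beta>1))"
  have "h x - \<mu> \<ge> c * (1 + \<bar>x\<bar>) powr \<beta>1" if x: "\<bar>x\<bar> \<ge> \<rho>" for x
  proof -
    have x': "\<bar>x\<bar> \<ge> r0" "\<bar>x\<bar> \<ge> 1" "\<bar>x\<bar> \<ge> (2 * \<bar>\<mu>\<bar> / c0) powr (1 / \<beta>1)" using x by (auto simp: \<rho>_def)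
    have "2 * \<bar>\<mu>\<bar> / c0 = ((2 * \<bar>\<mu>\<bar> / c0) powr (1 / \<beta>1)) powr \<beta>1"
      using growth_const by (simp add: powr_powr)
    also have "\<dots> \<le> \<bar>x\<bar> powr \<beta>1" using x' growth_const by (intro powr_mono2) auto
    finally have "\<bar>\<mu>\<bar> \<le> c0 / 2 * \<bar>x\<bar> powr \<beta>1" using growth_const by (simp add: field_simps)
    moreover have "c0 * \<bar>x\<bar> powr \<beta>1 \<le> h x" using x' by (intro growth)
    ultimately have "c0 / 2 * \<bar>x\<bar> powr \<beta>1 \<le> h x - \<mu>" by simp
    moreover have "c * (1 + \<bar>x\<bar>) powr \<beta>1 \<le> c0 / 2 * \<bar>x\<bar> powr \<beta>1"
    proof -
      have "c * (1 + \<bar>x\<bar>) powr \<beta>1 = c0 / 2 * ((1 + \<bar>x\<bar>) / 2) powr \<beta>1"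
        by (simp add: c_def powr_divide)
      also have "\<dots> \<le> c0 / 2 * \<bar>x\<bar> powr \<beta>1"
        using x' growth_const by (intro mult_left_mono powr_mono2) auto
      finally show ?thesis .
    qed
    ultimately show ?thesis by simp
  qed
  moreover have "c > 0" "\<rho> > 0" using growth_const by (auto simp: c_def \<rho>_def)
  ultimately show thesis using that by blast
qed

lemma level_set_bounded: obtains \<rho> where "\<rho> > 0" "\<And>x. h x \<le> \<mu> \<Longrightarrow> \<bar>x\<bar> < \<rho>"
proof -
  obtain c \<rho> where c: "c > 0" "\<rho> > 0" and *: "\<And>x. \<bar>x\<bar> \<ge> \<rho> \<Longrightarrow> h x - \<mu> \<ge> c * (1 + \<bar>x\<bar>) powr \<beta>1"
    by (rule growth') (rule that)
  have "\<bar>x\<bar> < \<rho>" if "h x \<le> \<mu>" for x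
  proof (rule ccontr)
    assume "\<not> \<bar>x\<bar> < \<rho>"
    then have "h x - \<mu> \<ge> c * (1 + \<bar>x\<bar>) powr \<beta>1" using *[of x] by simp
    moreover have "c * (1 + \<bar>x\<bar>) powr \<beta>1 > 0" using c by simp
    ultimately show False using that by simp
  qed
  with c that show thesis by blast
qed

lemma monotone_neighbourhood:
  assumes "h z = \<mu>"
  shows "\<exists>\<eta>>0. \<exists>c>0. (\<forall>x\<in>{z - \<eta>..z + \<eta>}. h' x \<ge> c) \<or> (\<forall>x\<in>{z - \<eta>..z + \<eta>}. h' x \<le> - c)"
proof -
  have nz: "h' z \<noteq> 0" using regular[OF assms] .
  then obtain d where d: "d > 0" and *: "\<And>x. \<bar>x - z\<bar> < d \<Longrightarrow> \<bar>h' x - h' z\<bar> < \<bar>h' z\<bar> / 2"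
    using h'_cont[unfolded continuous_on_iff, rule_format, of z "\<bar>h' z\<bar> / 2"] by (auto simp: dist_real_def)
  have **: "\<bar>h' x - h' z\<bar> < \<bar>h' z\<bar> / 2" if "x \<in> {z - d / 2..z + d / 2}" for x
    using that d by (intro *) (auto simp: abs_if)
  show ?thesis
  proof (intro exI conjI)
    show "d / 2 > 0" "\<bar>h' z\<bar> / 2 > 0" using d nz by auto
    show "(\<forall>x\<in>{z - d / 2..z + d / 2}. h' x \<ge> \<bar>h' z\<bar> / 2) \<or> (\<forall>x\<in>{z - d / 2..z + d / 2}. h' x \<le> - (\<bar>h' z\<bar> / 2))"
    proof (cases "h' z > 0")
      case True
      have "h' x \<ge> \<bar>h' z\<bar> / 2" if "x \<in> {z - d / 2..z + d / 2}" for x using **[OF that] True by (simp add: abs_if split: if_splits)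
      then show ?thesis by blast
    next
      case False
      have "h' x \<le> - (\<bar>h' z\<bar> / 2)" if "x \<in> {z - d / 2..z + d / 2}" for x using **[OF that] False by (simp add: abs_if split: if_splits)
      then show ?thesis by blast
    qed
  qed
qed

text \<open>The level set is compact, so finitely many intervals with h' of fixed sign and bounded
  away from 0 cover it. On the rest of a large ball |h - \<mu>| / (1 + |x|)^\<beta>1 has a positive
  minimum, and outside the ball the growth of h gives such a bound. Finiteness allows one constant c
  for everything.\<close>

lemma level_set_cover:
  obtains J :: "(real \<times> real) set" and c where "finite J" "c > 0"
    "\<And>l r. (l, r) \<in> J \<Longrightarrow> l \<le> r \<and> ((\<forall>x\<in>{l..r}. h' x \<ge> c) \<or> (\<forall>x\<in>{l..r}. h' x \<le> - c))"
    "\<And>x. x \<notin> (\<Union>p\<in>J. {fst p..snd p}) \<Longrightarrow> \<bar>h x - \<mu>\<bar> \<ge> c * (1 + \<bar>x\<bar>) powr \<beta>1"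
proof -
  define Z where "Z = {z. h z = \<mu>}"
  obtain c\<rho> \<rho> where c\<rho>: "c\<rho> > 0" "\<rho> > 0" and far: "\<And>x. \<bar>x\<bar> \<ge> \<rho> \<Longrightarrow> h x - \<mu> \<ge> c\<rho> * (1 + \<bar>x\<bar>) powr \<beta>1"
    by (rule growth') (rule that)
  have "\<forall>z\<in>Z. \<exists>p. fst p > 0 \<and> snd p > 0 \<and>
      ((\<forall>x\<in>{z - fst p..z + fst p}. h' x \<ge> snd p) \<or> (\<forall>x\<in>{z - fst p..z + fst p}. h' x \<le> - snd p))"
    using monotone_neighbourhood unfolding Z_def split_paired_Ex by simp
  from bchoice[OF this] obtain p where p: "\<And>z. z \<in> Z \<Longrightarrow> fst (p z) > 0 \<and> snd (p z) > 0 \<and>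
      ((\<forall>x\<in>{z - fst (p z)..z + fst (p z)}. h' x \<ge> snd (p z)) \<or> (\<forall>x\<in>{z - fst (p z)..z + fst (p z)}. h' x \<le> - snd (p z)))"
    by blast
  define \<eta> c where "\<eta> z = fst (p z)" and "c z = snd (p z)" for z
  have \<eta>: "\<eta> z > 0" and c: "c z > 0" and mono: "(\<forall>x\<in>{z - \<eta> z..z + \<eta> z}. h' x \<ge> c z) \<or> (\<forall>x\<in>{z - \<eta> z..z + \<eta> z}. h' x \<le> - c z)"
    if "z \<in> Z" for z
    using p[OF that] by (auto simp only: \<eta>_def c_def)
  have "closed Z" unfolding Z_def using h_cont by (intro closed_Collect_eq continuous_intros)
  moreover have "bounded Z"
    using level_set_bounded unfolding Z_def bounded_iff by (metis mem_Collect_eq order.refl real_norm_def less_imp_le)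
  ultimately have "compact Z" by (simp add: compact_eq_bounded_closed)
  then obtain D where D: "D \<subseteq> Z" "finite D" "Z \<subseteq> (\<Union>z\<in>D. {z - \<eta> z<..<z + \<eta> z})"
    using \<eta> by (elim compactE_image[where C = Z and f = "\<lambda>z. {z - \<eta> z<..<z + \<eta> z}"]) force+
  \<comment> \<open>Open intervals are removed so that Y is compact; the family J consists of their
    closures, so a point of the ball outside J lies in Y.\<close>
  define Y where "Y = {- \<rho>..\<rho>} - (\<Union>z\<in>D. {z - \<eta> z<..<z + \<eta> z})"
  have "compact Y" unfolding Y_def by (intro compact_diff open_UN) auto
  have "\<exists>m>0. \<forall>x\<in>Y. m \<le> \<bar>h x - \<mu>\<bar> / (1 + \<bar>x\<bar>) powr \<beta>1"
  proof (cases "Y = {}")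
    case False
    have "1 + \<bar>x\<bar> \<noteq> 0" for x :: real by linarith
    then have "continuous_on Y (\<lambda>x. \<bar>h x - \<mu>\<bar> / (1 + \<bar>x\<bar>) powr \<beta>1)"
      using h_cont by (intro continuous_intros) auto
    then obtain x0 where x0: "x0 \<in> Y" "\<And>x. x \<in> Y \<Longrightarrow> \<bar>h x0 - \<mu>\<bar> / (1 + \<bar>x0\<bar>) powr \<beta>1 \<le> \<bar>h x - \<mu>\<bar> / (1 + \<bar>x\<bar>) powr \<beta>1"
      using continuous_attains_inf[OF \<open>compact Y\<close> False] by blast
    have "x0 \<notin> Z" using x0(1) D(3) unfolding Y_def by blast
    then have "\<bar>h x0 - \<mu>\<bar> / (1 + \<bar>x0\<bar>) powr \<beta>1 > 0" by (auto simp: Z_def add_pos_nonneg)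
    then show ?thesis using x0(2) by blast
  qed (auto intro: exI[of _ 1])
  then obtain m where m: "m > 0" "\<And>x. x \<in> Y \<Longrightarrow> m \<le> \<bar>h x - \<mu>\<bar> / (1 + \<bar>x\<bar>) powr \<beta>1" by blast
  define k where "k = Min (insert m (insert c\<rho> (c ` D)))"
  have fin: "finite (insert m (insert c\<rho> (c ` D)))" using D by simp
  have k: "k > 0" "k \<le> m" "k \<le> c\<rho>" "\<And>z. z \<in> D \<Longrightarrow> k \<le> c z"
    unfolding k_def using D m c c\<rho> by (auto simp del: Min_insert intro!: Min_le[OF fin] Min_gr_iff[OF fin, THEN iffD2])
  show thesis
  proof
    show "finite ((\<lambda>z. (z - \<eta> z, z + \<eta> z)) ` D)" using D by simp
    show "k > 0" by fact
    show "l \<le> r \<and> ((\<forall>x\<in>{l..r}. h' x \<ge> k) \<or> (\<forall>x\<in>{l..r}. h' x \<le> - k))"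
      if lr: "(l, r) \<in> (\<lambda>z. (z - \<eta> z, z + \<eta> z)) ` D" for l r
    proof -
      obtain z where z: "z \<in> D" "l = z - \<eta> z" "r = z + \<eta> z" using lr by blast
      then have "z \<in> Z" using D by blast
      show ?thesis using mono[OF \<open>z \<in> Z\<close>] \<eta>[OF \<open>z \<in> Z\<close>] k(4)[OF z(1)] unfolding z(2,3) by force
    qed
    fix x assume x: "x \<notin> (\<Union>p\<in>(\<lambda>z. (z - \<eta> z, z + \<eta> z)) ` D. {fst p..snd p})"
    have p: "(1 + \<bar>x\<bar>) powr \<beta>1 > 0" by simp
    show "\<bar>h x - \<mu>\<bar> \<ge> k * (1 + \<bar>x\<bar>) powr \<beta>1"
    proof (cases "\<bar>x\<bar> \<ge> \<rho>")
      case True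
      have "k * (1 + \<bar>x\<bar>) powr \<beta>1 \<le> c\<rho> * (1 + \<bar>x\<bar>) powr \<beta>1" using k p by (intro mult_right_mono) auto
      then show ?thesis using far[OF True] by linarith
    next
      case False
      then have "x \<in> Y" using x unfolding Y_def by (force simp: abs_if split: if_splits)
      then have "m * (1 + \<bar>x\<bar>) powr \<beta>1 \<le> \<bar>h x - \<mu>\<bar>" using m(2)[of x] p by (simp add: field_simps)
      moreover have "k * (1 + \<bar>x\<bar>) powr \<beta>1 \<le> m * (1 + \<bar>x\<bar>) powr \<beta>1" using k p by (intro mult_right_mono) auto
      ultimately show ?thesis by linarith
    qed
  qed
qed

lemma fermi_measurable [measurable]: "fermi h \<mu> T \<in> borel_measurable borel"
  unfolding fermi_def by measurable

text \<open>On the covering intervals (h - \<mu>) / T has slope at least c / T in modulus, so the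
  substitution gains the factor T, while the polynomial weight is bounded. Off them the exponent is
  at least a multiple of (1 + |x|)^\<beta>1 / T, which beats any polynomial in |x| and leaves a
  power of T.\<close>

lemma logistic_weight_integral:
  assumes \<kappa>: "0 < \<kappa>" "\<kappa> \<le> 1" and \<rho>: "\<rho> \<ge> 1" and \<beta>: "\<beta> \<ge> 0"
  obtains K T1 where "K \<ge> 0" "T1 > 0"
    "\<And>T. 0 < T \<Longrightarrow> T < T1 \<Longrightarrow>
      (\<integral>\<^sup>+ x. ennreal (logistic_weight \<kappa> t (fermi h \<mu> T x) * (\<rho> + \<bar>x\<bar>) powr \<beta>) \<partial>lborel) \<le> ennreal (K * T)"
proof -
  obtain J c where J: "finite J" and c: "c > 0"
    and inside: "\<And>l r. (l, r) \<in> J \<Longrightarrow> l \<le> r \<and> ((\<forall>x\<in>{l..r}. h' x \<ge> c) \<or> (\<forall>x\<in>{l..r}. h' x \<le> - c))"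
    and outside: "\<And>x. x \<notin> (\<Union>p\<in>J. {fst p..snd p}) \<Longrightarrow> \<bar>h x - \<mu>\<bar> \<ge> c * (1 + \<bar>x\<bar>) powr \<beta>1"
    by (rule level_set_cover) (rule that)
  obtain K0 M where K0: "K0 \<ge> 0" and decay: "\<And>u. \<bar>u\<bar> \<ge> M \<Longrightarrow> logistic_weight \<kappa> t (logistic u) \<le> K0 * exp (- \<kappa> * \<bar>u\<bar>)"
    using logistic_weight_decay[OF \<kappa>] by blast
  \<comment> \<open>The power m of the exponent has to absorb the weight of order \<beta> and still
    leave 1 / (1 + |x|)^2; this needs \<beta>1 m \<ge> \<beta> + 2. The added 1 makes m \<ge> 1
    immediate, as used for T^m \<le> T.\<close>
  define m where "m = nat \<lceil>(\<beta> + 2) / \<beta>1\<rceil> + 1"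
  have "(\<beta> + 2) / \<beta>1 \<le> real m" unfolding m_def by linarith
  then have m: "\<beta> + 2 \<le> \<beta>1 * real m" "m \<ge> 1" using growth_const by (auto simp: m_def field_simps)
  define V where "V p = (\<rho> + max \<bar>fst p\<bar> \<bar>snd p\<bar>) powr \<beta>" for p :: "real \<times> real"
  define E where "E = K0 * (fact m / (\<kappa> * c) ^ m) * \<rho> powr \<beta>"
  have E: "E \<ge> 0" using K0 \<kappa> c by (simp add: E_def)
  \<comment> \<open>Two demands: T \<le> 1, and T M \<le> c. The latter forces |h - \<mu>| / T \<ge>
    M off the intervals, where the decay bound applies.\<close>
  define T1 where "T1 = min 1 (c / max M 1)"
  define K where "K = (\<Sum>p\<in>J. V p * ((2 / \<kappa> + 1) / c)) + E * 4"
  have "T1 > 0" using c by (simp add: T1_def)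
  have "K \<ge> 0" using c E \<kappa> by (auto simp: K_def V_def intro!: add_nonneg_nonneg sum_nonneg)
  have "(\<integral>\<^sup>+ x. ennreal (logistic_weight \<kappa> t (fermi h \<mu> T x) * (\<rho> + \<bar>x\<bar>) powr \<beta>) \<partial>lborel) \<le> ennreal (K * T)"
    if T: "0 < T" "T < T1" for T
  proof -
    define \<phi> where "\<phi> x = logistic_weight \<kappa> t (fermi h \<mu> T x)" for x
    have \<phi>0: "\<phi> x \<ge> 0" for x
      unfolding \<phi>_def fermi_eq_logistic by (rule logistic_weight_nonneg)
    have [measurable]: "\<phi> \<in> borel_measurable borel"
      unfolding \<phi>_def logistic_weight_def by measurable
    have T': "T \<le> 1" "T * M \<le> c"
    proof -
      show "T \<le> 1" using T by (simp add: T1_def)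
      have "T * max M 1 \<le> c" using T by (simp add: T1_def pos_less_divide_eq less_imp_le)
      moreover have "T * M \<le> T * max M 1" using T by (intro mult_left_mono) auto
      ultimately show "T * M \<le> c" by linarith
    qed
    have far: "\<phi> x * (\<rho> + \<bar>x\<bar>) powr \<beta> \<le> E * T * (1 / (1 + x\<^sup>2))"
      if x: "x \<notin> (\<Union>p\<in>J. {fst p..snd p})" for x
    proof -
      define u where "u = (h x - \<mu>) / T"
      define X where "X = 1 + \<bar>x\<bar>"
      have X: "X \<ge> 1" by (simp add: X_def)
      define Y where "Y = \<kappa> * (c * X powr \<beta>1 / T)"
      have Y: "Y > 0" using X \<kappa> c T by (simp add: Y_def)
      have "c * X powr \<beta>1 \<le> \<bar>h x - \<mu>\<bar>" using outside[OF x] by (simp add: X_def)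
      then have u: "c * X powr \<beta>1 / T \<le> \<bar>u\<bar>" using T by (simp add: u_def divide_right_mono)
      have "1 \<le> X powr \<beta>1" using X growth_const by (simp add: ge_one_powr_ge_zero)
      then have "c \<le> c * X powr \<beta>1" using c by simp
      then have "T * M \<le> c * X powr \<beta>1" using T' by linarith
      then have "M \<le> c * X powr \<beta>1 / T" using T by (simp add: field_simps)
      then have "\<phi> x \<le> K0 * exp (- \<kappa> * \<bar>u\<bar>)"
        using u unfolding \<phi>_def fermi_eq_logistic u_def[symmetric] by (intro decay) linarith
      also have "\<dots> \<le> K0 * exp (- Y)"
      proof (rule mult_left_mono[OF _ K0])
        have "Y \<le> \<kappa> * \<bar>u\<bar>" unfolding Y_def using u \<kappa> by (intro mult_left_mono) simp_all
        then show "exp (- \<kappa> * \<bar>u\<bar>) \<le> exp (- Y)" by simp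
      qed
      also have "\<dots> \<le> K0 * (fact m / Y ^ m)"
        using K0 Y by (intro mult_left_mono exp_minus_le_power)
      also have "Y ^ m = (\<kappa> * c) ^ m * X powr (\<beta>1 * real m) / T ^ m"
        using X by (simp add: Y_def power_mult_distrib power_divide powr_power mult_ac)
      finally have 1: "\<phi> x \<le> K0 * (fact m / (\<kappa> * c) ^ m) * (T ^ m / X powr (\<beta>1 * real m))"
        by simp
      have "T ^ m / X powr (\<beta>1 * real m) \<le> T / X powr (\<beta> + 2)"
      proof (rule frac_le)
        show "T ^ m \<le> T" using T T' m power_decreasing[of 1 m T] by simp
        show "X powr (\<beta> + 2) \<le> X powr (\<beta>1 * real m)" using X m by (intro powr_mono) auto
      qed (use T X in auto)
      also have "X powr (\<beta> + 2) = X powr \<beta> * X\<^sup>2" using X by (simp add: powr_add)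
      finally have 2: "T ^ m / X powr (\<beta>1 * real m) \<le> T / (X powr \<beta> * X\<^sup>2)" .
      have "(\<rho> + \<bar>x\<bar>) powr \<beta> \<le> (\<rho> * X) powr \<beta>"
      proof (rule powr_mono2)
        have "1 * \<bar>x\<bar> \<le> \<rho> * \<bar>x\<bar>" using \<rho> by (intro mult_right_mono) auto
        then show "\<rho> + \<bar>x\<bar> \<le> \<rho> * X" by (simp add: X_def algebra_simps)
      qed (use \<rho> \<beta> in auto)
      then have 3: "(\<rho> + \<bar>x\<bar>) powr \<beta> \<le> \<rho> powr \<beta> * X powr \<beta>" by (simp add: powr_mult)
      have "\<phi> x * (\<rho> + \<bar>x\<bar>) powr \<beta> \<le>
        (K0 * (fact m / (\<kappa> * c) ^ m) * (T / (X powr \<beta> * X\<^sup>2))) * (\<rho> powr \<beta> * X powr \<beta>)"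
        using K0 \<kappa> c T X by (intro mult_mono 3 order.trans[OF 1] mult_left_mono 2) auto
      also have "\<dots> = E * T * (1 / X\<^sup>2)" using X by (simp add: E_def)
      also have "\<dots> \<le> E * T * (1 / (1 + x\<^sup>2))"
      proof (intro mult_left_mono divide_left_mono)
        show "1 + x\<^sup>2 \<le> X\<^sup>2" by (simp add: X_def power2_eq_square algebra_simps)
        show "0 < X\<^sup>2 * (1 + x\<^sup>2)" using X by (simp add: add_pos_nonneg)
      qed (use E T in auto)
      finally show ?thesis .
    qed
    have pointwise: "ennreal (\<phi> x * (\<rho> + \<bar>x\<bar>) powr \<beta>) \<le>
      (\<Sum>p\<in>J. ennreal (V p) * (ennreal (\<phi> x) * indicator {fst p..snd p} x)) + ennreal (E * T) * ennreal (1 / (1 + x\<^sup>2))" for x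
    proof (cases "\<exists>p\<in>J. x \<in> {fst p..snd p}")
      case True
      then obtain p where p: "p \<in> J" "x \<in> {fst p..snd p}" by blast
      have "(\<rho> + \<bar>x\<bar>) powr \<beta> \<le> V p"
        unfolding V_def using p \<rho> \<beta> by (intro powr_mono2) auto
      then have "\<phi> x * (\<rho> + \<bar>x\<bar>) powr \<beta> \<le> \<phi> x * V p"
        using \<phi>0[of x] by (rule mult_left_mono)
      then have "\<phi> x * (\<rho> + \<bar>x\<bar>) powr \<beta> \<le> V p * \<phi> x"
        by (simp only: mult.commute)
      then have "ennreal (\<phi> x * (\<rho> + \<bar>x\<bar>) powr \<beta>) \<le> ennreal (V p) * (ennreal (\<phi> x) * indicator {fst p..snd p} x)"
        using p \<phi>0[of x] by (simp add: ennreal_mult'[symmetric] V_def ennreal_leI)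
      also have "\<dots> \<le> (\<Sum>p\<in>J. ennreal (V p) * (ennreal (\<phi> x) * indicator {fst p..snd p} x))"
        by (rule member_le_sum) (use p J in auto)
      finally show ?thesis by (simp add: add_increasing2)
    next
      case False
      then have "\<phi> x * (\<rho> + \<bar>x\<bar>) powr \<beta> \<le> E * T * (1 / (1 + x\<^sup>2))" by (intro far) blast
      then have "ennreal (\<phi> x * (\<rho> + \<bar>x\<bar>) powr \<beta>) \<le> ennreal (E * T) * ennreal (1 / (1 + x\<^sup>2))"
        using E T by (subst ennreal_mult'[symmetric]) (auto intro: ennreal_leI)
      then show ?thesis by (simp add: add_increasing)
    qed
    have interval: "(\<integral>\<^sup>+ x. ennreal (\<phi> x) * indicator {fst p..snd p} x \<partial>lborel) \<le> ennreal ((2 / \<kappa> + 1) / c * T)" if p: "p \<in> J" for p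
    proof -
      obtain l r where lr: "p = (l, r)" by (cases p)
      note in_lr = inside[of l r] p[unfolded lr]
      have "(\<integral>\<^sup>+ x. ennreal (logistic_weight \<kappa> t (logistic ((h x - \<mu>) / T))) * indicator {l..r} x \<partial>lborel)
          \<le> ennreal ((2 / \<kappa> + 1) / (c / T))"
      proof (rule nn_integral_logistic_weight_interval[where v' = "\<lambda>x. h' x / T"])
        show "((\<lambda>x. (h x - \<mu>) / T) has_real_derivative h' x / T) (at x)" for x
          using T by (auto intro!: derivative_eq_intros h_deriv)
        show "continuous_on {l..r} (\<lambda>x. h' x / T)"
          using T continuous_on_subset[OF h'_cont] by (intro continuous_intros) auto
        show "(\<forall>x\<in>{l..r}. h' x / T \<ge> c / T) \<or> (\<forall>x\<in>{l..r}. h' x / T \<le> - (c / T))"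
        proof -
          have "\<forall>x\<in>{l..r}. h' x / T \<ge> c / T" if "\<forall>x\<in>{l..r}. h' x \<ge> c"
            using that T by (simp add: divide_right_mono)
          moreover have "\<forall>x\<in>{l..r}. h' x / T \<le> (- c) / T" if "\<forall>x\<in>{l..r}. h' x \<le> - c"
            using that T by (intro ballI divide_right_mono) auto
          ultimately show ?thesis using in_lr by auto
        qed
      qed (use in_lr T c \<kappa> in auto)
      then show ?thesis using T lr by (simp add: \<phi>_def fermi_eq_logistic)
    qed
    have "(\<integral>\<^sup>+ x. ennreal (\<phi> x * (\<rho> + \<bar>x\<bar>) powr \<beta>) \<partial>lborel) \<le>
      (\<integral>\<^sup>+ x. (\<Sum>p\<in>J. ennreal (V p) * (ennreal (\<phi> x) * indicator {fst p..snd p} x)) + ennreal (E * T) * ennreal (1 / (1 + x\<^sup>2)) \<partial>lborel)"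
      by (intro nn_integral_mono pointwise)
    also have "\<dots> = (\<Sum>p\<in>J. ennreal (V p) * (\<integral>\<^sup>+ x. ennreal (\<phi> x) * indicator {fst p..snd p} x \<partial>lborel))
        + ennreal (E * T) * (\<integral>\<^sup>+ x. ennreal (1 / (1 + x\<^sup>2)) \<partial>lborel)"
      by (subst nn_integral_add) (auto simp: nn_integral_sum nn_integral_cmult)
    also have "\<dots> \<le> (\<Sum>p\<in>J. ennreal (V p) * ennreal ((2 / \<kappa> + 1) / c * T)) + ennreal (E * T) * ennreal 4"
      by (intro add_mono sum_mono mult_left_mono interval nn_integral_inverse_1_plus_square) auto
    also have "\<dots> = ennreal (\<Sum>p\<in>J. V p * ((2 / \<kappa> + 1) / c * T)) + ennreal (E * T * 4)"
    proof -
      have "(\<Sum>p\<in>J. ennreal (V p) * ennreal A) = ennreal (\<Sum>p\<in>J. V p * A)" if "A \<ge> 0" for A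
        using that by (subst sum_ennreal[symmetric]) (auto simp: V_def ennreal_mult)
      moreover have "ennreal (E * T) * ennreal 4 = ennreal (E * T * 4)"
        using E T by (intro ennreal_mult[symmetric]) auto
      ultimately show ?thesis using \<kappa> c T by simp
    qed
    also have "\<dots> = ennreal ((\<Sum>p\<in>J. V p * ((2 / \<kappa> + 1) / c * T)) + E * T * 4)"
      using \<kappa> c T E by (intro ennreal_plus[symmetric] sum_nonneg) (auto simp: V_def)
    also have "(\<Sum>p\<in>J. V p * ((2 / \<kappa> + 1) / c * T)) + E * T * 4 = K * T"
      by (simp only: K_def distrib_right sum_distrib_right mult.assoc mult.commute[of T 4])
    finally show ?thesis by (simp add: \<phi>_def)
  qed
  then show thesis using that \<open>K \<ge> 0\<close> \<open>T1 > 0\<close> by blast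
qed

section \<open>The components of \<Omega>\<close>

abbreviation "\<Omega> \<equiv> sublevel h \<mu>"

lemma open_sublevel: "open \<Omega>"
  unfolding sublevel_def using h_cont by (intro open_Collect_less continuous_intros)

lemma component_interval:
  assumes S: "S \<in> components \<Omega>"
  obtains a b where "a < b" "S = {a<..<b}"
proof -
  define a b where "a = Inf S" and "b = Sup S"
  have "open S" using open_components[OF open_sublevel S] .
  have "S \<noteq> {}" using S by (rule in_components_nonempty)
  obtain \<rho> where \<rho>: "\<And>x. h x \<le> \<mu> \<Longrightarrow> \<bar>x\<bar> < \<rho>" using level_set_bounded by metis
  have "\<bar>x\<bar> < \<rho>" if "x \<in> S" for x
    using in_components_subset[OF S] that by (intro \<rho>) (auto simp: sublevel_def less_imp_le)
  then have "S \<subseteq> {- \<rho>..\<rho>}" by (force simp: abs_less_iff)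
  then have bdd: "bdd_below S" "bdd_above S"
    using bdd_below_mono bdd_above_mono bdd_below_Icc bdd_above_Icc by metis+
  have "S = {a<..<b}"
  proof (intro equalityI subsetI)
    fix x assume "x \<in> S"
    then obtain e where e: "e > 0" "cball x e \<subseteq> S"
      using \<open>open S\<close> open_contains_cball by blast
    then have "x - e \<in> S" "x + e \<in> S" by (auto simp: dist_real_def subset_iff)
    then have "a \<le> x - e" "x + e \<le> b" using bdd by (auto simp: a_def b_def cInf_lower cSup_upper)
    then show "x \<in> {a<..<b}" using e by simp
  next
    fix x assume x: "x \<in> {a<..<b}"
    then obtain y z where "y \<in> S" "y < x" "z \<in> S" "x < z"
      using cInf_less_iff[OF \<open>S \<noteq> {}\<close> bdd(1)] less_cSup_iff[OF \<open>S \<noteq> {}\<close> bdd(2)]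
      by (auto simp: a_def b_def)
    then show "x \<in> S"
      using in_components_connected[OF S] connectedD_interval[of S y z x] by auto
  qed
  moreover from this have "a < b" using \<open>S \<noteq> {}\<close> by auto
  ultimately show thesis using that by blast
qed

text \<open>Continuity gives h \<le> \<mu> at the endpoints. If the inequality were strict at one of
  them, adding that endpoint would give a larger connected subset of \<Omega>, against
  maximality.\<close>

lemma component_endpoints:
  assumes S: "{a<..<b} \<in> components \<Omega>" and ab: "a < b"
  shows "h a = \<mu>" "h b = \<mu>"
proof -
  have sub: "{a<..<b} \<subseteq> \<Omega>" using S by (rule in_components_subset)
  have "closed {x. h x \<le> \<mu>}" using h_cont by (intro closed_Collect_le continuous_intros)
  then have "closure {a<..<b} \<subseteq> {x. h x \<le> \<mu>}"
    using sub by (intro closure_minimal) (auto simp: sublevel_def less_imp_le)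
  then have le: "h a \<le> \<mu>" "h b \<le> \<mu>" using ab by (simp_all add: subset_iff)
  show "h a = \<mu>"
  proof (rule ccontr)
    assume "h a \<noteq> \<mu>"
    then have "{a..<b} \<subseteq> \<Omega>" using le sub by (auto simp: sublevel_def subset_iff order.order_iff_strict)
    moreover have "(a + b) / 2 \<in> {a<..<b} \<inter> {a..<b}" using ab by simp
    ultimately have "{a..<b} \<subseteq> {a<..<b}" by (intro components_maximal[OF S]) (blast intro: connected_Ico)+
    then show False using ab by (auto simp: subset_iff)
  qed
  show "h b = \<mu>"
  proof (rule ccontr)
    assume "h b \<noteq> \<mu>"
    then have "{a<..b} \<subseteq> \<Omega>" using le sub by (auto simp: sublevel_def subset_iff order.order_iff_strict)
    moreover have "(a + b) / 2 \<in> {a<..<b} \<inter> {a<..b}" using ab by simp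
    ultimately have "{a<..b} \<subseteq> {a<..<b}" by (intro components_maximal[OF S]) (blast intro: connected_Ioc)+
    then show False using ab by (auto simp: subset_iff)
  qed
qed

text \<open>A common endpoint would be a local maximum of h at level \<mu>, so h' would vanish
  there.\<close>

lemma components_not_adjacent:
  assumes "{a<..<b} \<in> components \<Omega>" "{b<..<c} \<in> components \<Omega>" "a < b" "b < c"
  shows False
proof -
  have "h b = \<mu>" using component_endpoints assms by blast
  moreover have "h' b = 0"
  proof (rule DERIV_local_max[OF h_deriv])
    show "0 < min (b - a) (c - b)" using assms by simp
    have "h y < \<mu>" if "y \<in> {a<..<b} \<union> {b<..<c}" for y
      using that in_components_subset[OF assms(1)] in_components_subset[OF assms(2)]
      by (auto simp: sublevel_def subset_iff)
    then have "h y \<le> \<mu>" if "y \<in> {a<..<c}" for y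
      using that \<open>h b = \<mu>\<close> by (cases "y = b") (force intro: less_imp_le)+
    then show "\<forall>y. \<bar>b - y\<bar> < min (b - a) (c - b) \<longrightarrow> h y \<le> h b"
      using \<open>h b = \<mu>\<close> by (auto simp: abs_less_iff)
  qed
  ultimately show False using regular by blast
qed

lemma components_separated:
  assumes S: "S \<in> components \<Omega>" "S' \<in> components \<Omega>" "S \<noteq> S'"
  shows "\<exists>g>0. \<forall>x\<in>S. \<forall>y\<in>S'. g \<le> \<bar>x - y\<bar>"
proof -
  obtain a b where ab: "a < b" "S = {a<..<b}" by (rule component_interval[OF S(1)])
  obtain a' b' where ab': "a' < b'" "S' = {a'<..<b'}" by (rule component_interval[OF S(2)])
  have "S \<inter> S' = {}" using S components_nonoverlap by blast
  then have "b \<le> a' \<or> b' \<le> a"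
    using ab ab' by (auto simp: Int_greaterThanLessThan min_def max_def split: if_splits)
  moreover have "b \<noteq> a'" using components_not_adjacent[of a b b'] S ab ab' by blast
  moreover have "b' \<noteq> a" using components_not_adjacent[of a' b' b] S ab ab' by blast
  ultimately consider "b < a'" | "b' < a" by linarith
  then show ?thesis
  proof cases
    case 1
    then show ?thesis using ab ab' by (intro exI[of _ "a' - b"]) auto
  next
    case 2
    then show ?thesis using ab ab' by (intro exI[of _ "a - b'"]) auto
  qed
qed

text \<open>Pairs inside two different components are the only error when the kernel of \<Omega> is
  compared with the sum over its components; the uniform gap keeps the kernel bounded on
  them.\<close>

lemma component_gap:
  obtains g where "g > 0" "\<And>S S' x y. S \<in> components \<Omega> \<Longrightarrow> S' \<in> components \<Omega> \<Longrightarrow> S \<noteq> S' \<Longrightarrow> x \<in> S \<Longrightarrow> y \<in> S' \<Longrightarrow> g \<le> \<bar>x - y\<bar>"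
proof -
  define Q where "Q = {q \<in> components \<Omega> \<times> components \<Omega>. fst q \<noteq> snd q}"
  have "finite Q" unfolding Q_def using finite_components by (intro finite_Collect_conjI disjI1 finite_cartesian_product) auto
  have "\<forall>q\<in>Q. \<exists>g>0. \<forall>x\<in>fst q. \<forall>y\<in>snd q. g \<le> \<bar>x - y\<bar>"
    using components_separated by (auto simp: Q_def)
  from bchoice[OF this] obtain d where d: "\<forall>q\<in>Q. d q > 0 \<and> (\<forall>x\<in>fst q. \<forall>y\<in>snd q. d q \<le> \<bar>x - y\<bar>)" by blast
  define g where "g = Min (insert 1 (d ` Q))"
  have g: "g > 0" "\<And>q. q \<in> Q \<Longrightarrow> g \<le> d q"
    using \<open>finite Q\<close> d by (auto simp: g_def)
  show thesis
  proof (rule that[OF g(1)])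
    fix S S' x y assume *: "S \<in> components \<Omega>" "S' \<in> components \<Omega>" "S \<noteq> S'" "x \<in> S" "y \<in> S'"
    then have "(S, S') \<in> Q" by (simp add: Q_def)
    with g(2)[of "(S, S')"] d * show "g \<le> \<bar>x - y\<bar>" by fastforce
  qed
qed

end

section \<open>The logarithmic main term\<close>

lemma jump_kernel_borel_measurable [measurable]:
  "S \<in> sets borel \<Longrightarrow> jump_kernel S \<tau> \<in> borel_measurable borel"
  using jump_kernel_measurable by (simp add: borel_prod)

lemma jump_kernel_interval_integral:
  assumes \<tau>: "0 < \<tau>" "\<tau> \<le> b - a"
  shows "integrable lborel (jump_kernel {a<..<b} \<tau>)"
    and "(LINT z|lborel. jump_kernel {a<..<b} \<tau> z) = 4 * (1 + ln ((b - a) / \<tau>))"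
proof -
  have "0 \<le> 4 * (1 + ln ((b - a) / \<tau>))" using \<tau> by (simp add: add_increasing)
  then have "has_bochner_integral lborel (jump_kernel {a<..<b} \<tau>) (4 * (1 + ln ((b - a) / \<tau>)))"
    using nn_integral_jump_kernel_interval[OF \<tau>]
    by (intro has_bochner_integral_nn_integral) (auto simp: jump_kernel_nonneg)
  then show "integrable lborel (jump_kernel {a<..<b} \<tau>)"
    and "(LINT z|lborel. jump_kernel {a<..<b} \<tau> z) = 4 * (1 + ln ((b - a) / \<tau>))"
    by (auto simp: has_bochner_integral_iff)
qed

context dispersion
begin

text \<open>The component that contains the inner point of a separated pair already separates
  it.\<close>

lemma jump_kernel_sublevel_le_sum:
  "jump_kernel \<Omega> \<tau> z \<le> (\<Sum>S\<in>components \<Omega>. jump_kernel S \<tau> z)"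
proof (cases "(fst z \<in> \<Omega>) \<noteq> (snd z \<in> \<Omega>)")
  case True
  then obtain S where S: "S \<in> components \<Omega>" "fst z \<in> S \<or> snd z \<in> S"
    using Union_components[of \<Omega>] by blast
  have "jump_kernel \<Omega> \<tau> z \<le> jump_kernel S \<tau> z"
    using True S in_components_subset[OF S(1)] by (auto simp: jump_kernel_def)
  also have "\<dots> \<le> (\<Sum>S\<in>components \<Omega>. jump_kernel S \<tau> z)"
    by (rule member_le_sum) (use S finite_components jump_kernel_nonneg in auto)
  finally show ?thesis .
qed (auto simp: jump_kernel_def intro: sum_nonneg)

lemma sum_jump_kernel_component:
  assumes S: "S \<in> components \<Omega>" and z: "fst z \<in> S \<and> snd z \<notin> \<Omega> \<or> snd z \<in> S \<and> fst z \<notin> \<Omega>"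
  shows "(\<Sum>S\<in>components \<Omega>. jump_kernel S \<tau> z) = jump_kernel \<Omega> \<tau> z"
proof -
  have "(\<Sum>S\<in>components \<Omega>. jump_kernel S \<tau> z) = (\<Sum>S\<in>{S}. jump_kernel S \<tau> z)"
  proof (rule sum.mono_neutral_right)
    show "\<forall>S'\<in>components \<Omega> - {S}. jump_kernel S' \<tau> z = 0"
      using z components_nonoverlap[OF S] in_components_subset by (auto simp: jump_kernel_def; blast)
  qed (use S finite_components in auto)
  also have "\<dots> = jump_kernel \<Omega> \<tau> z"
    using z in_components_subset[OF S] by (auto simp: jump_kernel_def)
  finally show ?thesis .
qed

text \<open>The sum over components agrees with the kernel of \<Omega> except on pairs with both
  points in \<Omega>. Such a pair counts only if it lies in two different components, hence at
  distance at least g, and then every term is at most 1 / g^2.\<close>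

lemma sum_jump_kernel_le:
  assumes g: "g > 0" and gap: "\<And>S S' x y. S \<in> components \<Omega> \<Longrightarrow> S' \<in> components \<Omega> \<Longrightarrow> S \<noteq> S' \<Longrightarrow> x \<in> S \<Longrightarrow> y \<in> S' \<Longrightarrow> g \<le> \<bar>x - y\<bar>"
  shows "(\<Sum>S\<in>components \<Omega>. jump_kernel S \<tau> z)
    \<le> jump_kernel \<Omega> \<tau> z + real (card (components \<Omega>)) / g\<^sup>2 * indicator (\<Omega> \<times> \<Omega>) z"
proof -
  consider "fst z \<notin> \<Omega>" "snd z \<notin> \<Omega>" | "(fst z \<in> \<Omega>) \<noteq> (snd z \<in> \<Omega>)" | "fst z \<in> \<Omega>" "snd z \<in> \<Omega>" by blast
  then show ?thesis
  proof cases
    case 1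
    then have "jump_kernel S \<tau> z = 0" if "S \<in> components \<Omega>" for S
      using in_components_subset[OF that] by (auto simp: jump_kernel_def)
    then show ?thesis by (simp add: jump_kernel_nonneg)
  next
    case 2
    then obtain S where S: "S \<in> components \<Omega>" "fst z \<in> S \<or> snd z \<in> S"
      using Union_components[of \<Omega>] by blast
    then have "(\<Sum>S\<in>components \<Omega>. jump_kernel S \<tau> z) = jump_kernel \<Omega> \<tau> z"
      using 2 in_components_subset[OF S(1)] by (intro sum_jump_kernel_component) auto
    then show ?thesis by simp
  next
    case 3
    have "jump_kernel S \<tau> z \<le> 1 / g\<^sup>2" if S: "S \<in> components \<Omega>" for S
    proof (cases "(fst z \<in> S) \<noteq> (snd z \<in> S)")
      case True
      obtain S1 S2 where S12: "S1 \<in> components \<Omega>" "S2 \<in> components \<Omega>" "fst z \<in> S1" "snd z \<in> S2"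
        using 3 Union_components[of \<Omega>] by blast
      have "S1 \<noteq> S2"
        using True S S12 components_nonoverlap[of S \<Omega> S1] components_nonoverlap[of S \<Omega> S2] by blast
      then have "g \<le> \<bar>fst z - snd z\<bar>" using gap S12 by blast
      then have "g\<^sup>2 \<le> (fst z - snd z)\<^sup>2" using g by (intro abs_le_square_iff[THEN iffD1]) auto
      then have "1 / (fst z - snd z)\<^sup>2 \<le> 1 / g\<^sup>2" using g
        by (intro divide_left_mono mult_pos_pos less_le_trans[of 0 "g\<^sup>2" "(fst z - snd z)\<^sup>2"]) auto
      then show ?thesis by (simp add: jump_kernel_def)
    qed (simp add: jump_kernel_def)
    then have "(\<Sum>S\<in>components \<Omega>. jump_kernel S \<tau> z) \<le> (\<Sum>S\<in>components \<Omega>. 1 / g\<^sup>2)"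
      by (intro sum_mono)
    then show ?thesis using 3 jump_kernel_nonneg[of \<Omega> \<tau> z]
      by (cases z) (auto simp: indicator_def)
  qed
qed

lemma sublevel_measurable [measurable]: "\<Omega> \<in> sets borel"
  using open_sublevel by simp

lemma jump_kernel_sublevel_integral:
  obtains K \<tau>1 where "\<tau>1 > 0"
    "\<And>\<tau>. 0 < \<tau> \<Longrightarrow> \<tau> < \<tau>1 \<Longrightarrow> integrable lborel (jump_kernel \<Omega> \<tau>)"
    "\<And>\<tau>. 0 < \<tau> \<Longrightarrow> \<tau> < \<tau>1 \<Longrightarrow>
      \<bar>(LINT z|lborel. jump_kernel \<Omega> \<tau> z) - 4 * real (card (components \<Omega>)) * \<bar>ln \<tau>\<bar>\<bar> \<le> K"
proof -
  define N where "N = real (card (components \<Omega>))"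
  define len :: "real set \<Rightarrow> real" where "len S = measure lborel S" for S
  have len: "\<exists>a b. S = {a<..<b} \<and> len S = b - a \<and> a < b" if S: "S \<in> components \<Omega>" for S
  proof -
    obtain a b where "a < b" "S = {a<..<b}" by (rule component_interval[OF S])
    then show ?thesis by (intro exI[of _ a] exI[of _ b]) (simp add: len_def)
  qed
  obtain g where g: "g > 0" and gap: "\<And>S S' x y. S \<in> components \<Omega> \<Longrightarrow> S' \<in> components \<Omega> \<Longrightarrow> S \<noteq> S' \<Longrightarrow> x \<in> S \<Longrightarrow> y \<in> S' \<Longrightarrow> g \<le> \<bar>x - y\<bar>"
    by (rule component_gap) (rule that)
  obtain \<rho> where \<rho>: "\<rho> > 0" "\<And>x. h x \<le> \<mu> \<Longrightarrow> \<bar>x\<bar> < \<rho>" using level_set_bounded by metis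
  have \<Omega>_sub: "\<Omega> \<subseteq> {- \<rho>..\<rho>}"
  proof
    fix x assume "x \<in> \<Omega>"
    then have "\<bar>x\<bar> < \<rho>" by (intro \<rho>(2)) (simp add: sublevel_def)
    then show "x \<in> {- \<rho>..\<rho>}" by auto
  qed
  have N: "N \<ge> 0" by (simp add: N_def)
  \<comment> \<open>Integral of the overcount bound N / g^2 over the square of side 2 \<rho>
    containing \<Omega> x \<Omega>.\<close>
  define D where "D = N / g\<^sup>2 * (4 * \<rho>\<^sup>2)"
  \<comment> \<open>Below 1, so that |ln \<tau>| = - ln \<tau>, and at most every component length,
    as the exact formula for intervals requires.\<close>
  define \<tau>1 where "\<tau>1 = Min (insert 1 (len ` components \<Omega>))"
  have fin: "finite (insert 1 (len ` components \<Omega>))" using finite_components by simp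
  have "\<tau>1 > 0" unfolding \<tau>1_def using len
    by (auto simp del: Min_insert intro!: Min_gr_iff[OF fin, THEN iffD2]) fastforce
  define K where "K = (\<Sum>S\<in>components \<Omega>. 4 * \<bar>1 + ln (len S)\<bar>) + D"
  have main: "integrable lborel (jump_kernel \<Omega> \<tau>) \<and> \<bar>(LINT z|lborel. jump_kernel \<Omega> \<tau> z) - 4 * N * \<bar>ln \<tau>\<bar>\<bar> \<le> K"
    if \<tau>: "0 < \<tau>" "\<tau> < \<tau>1" for \<tau>
  proof -
    have \<tau>len: "\<tau> < 1" "\<And>S. S \<in> components \<Omega> \<Longrightarrow> \<tau> \<le> len S"
    proof -
      have "\<tau>1 \<le> 1" unfolding \<tau>1_def by (intro Min_le fin) auto
      then show "\<tau> < 1" using \<tau> by simp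
      fix S assume "S \<in> components \<Omega>"
      then have "\<tau>1 \<le> len S" unfolding \<tau>1_def by (intro Min_le fin) auto
      then show "\<tau> \<le> len S" using \<tau> by simp
    qed
    have comp: "integrable lborel (jump_kernel S \<tau>)" "(LINT z|lborel. jump_kernel S \<tau> z) = 4 * (1 + ln (len S)) + 4 * \<bar>ln \<tau>\<bar>"
      if "S \<in> components \<Omega>" for S
    proof -
      obtain a b where ab: "S = {a<..<b}" "len S = b - a" "a < b" using len[OF \<open>S \<in> components \<Omega>\<close>] by blast
      have le: "\<tau> \<le> b - a" using \<tau>len(2)[OF \<open>S \<in> components \<Omega>\<close>] ab by simp
      show "integrable lborel (jump_kernel S \<tau>)"
        using jump_kernel_interval_integral(1)[OF \<tau>(1) le] ab by simp
      have "ln ((b - a) / \<tau>) = ln (len S) + \<bar>ln \<tau>\<bar>"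
        using ab \<tau> \<tau>len(1) by (simp add: ln_div)
      then show "(LINT z|lborel. jump_kernel S \<tau> z) = 4 * (1 + ln (len S)) + 4 * \<bar>ln \<tau>\<bar>"
        using jump_kernel_interval_integral(2)[OF \<tau>(1) le] ab by simp
    qed
    define \<Sigma> where "\<Sigma> z = (\<Sum>S\<in>components \<Omega>. jump_kernel S \<tau> z)" for z
    have \<Sigma>: "integrable lborel \<Sigma>" unfolding \<Sigma>_def using comp(1) by (rule Bochner_Integration.integrable_sum)
    have \<Sigma>_int: "(LINT z|lborel. \<Sigma> z) = (\<Sum>S\<in>components \<Omega>. 4 * (1 + ln (len S))) + 4 * N * \<bar>ln \<tau>\<bar>"
      unfolding \<Sigma>_def using comp by (simp add: Bochner_Integration.integral_sum sum.distrib N_def)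
    have int: "integrable lborel (jump_kernel \<Omega> \<tau>)"
      by (rule Bochner_Integration.integrable_bound[OF \<Sigma>])
         (use jump_kernel_sublevel_le_sum[of \<tau>] jump_kernel_nonneg in
           \<open>auto simp: \<Sigma>_def intro!: AE_I2 order.trans[OF _ abs_ge_self]\<close>)
    have box: "integrable lborel (\<lambda>z. N / g\<^sup>2 * indicator ({- \<rho>..\<rho>} \<times> {- \<rho>..\<rho>}) z :: real)"
      "(LINT z|lborel. N / g\<^sup>2 * indicator ({- \<rho>..\<rho>} \<times> {- \<rho>..\<rho>}) z) = D"
    proof -
      have cb: "{- \<rho>..\<rho>} \<times> {- \<rho>..\<rho>} = cbox (- \<rho>, - \<rho>) (\<rho>, \<rho>)" by (simp add: cbox_Pair_eq)
      have m: "measure lborel ({- \<rho>..\<rho>} \<times> {- \<rho>..\<rho>}) = 4 * \<rho>\<^sup>2"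
        using \<rho>(1) lborel.emeasure_pair_measure_Times[of "{- \<rho>..\<rho>}" lborel "{- \<rho>..\<rho>}"]
        by (simp add: measure_def lborel_prod power2_eq_square flip: ennreal_mult)
      show "integrable lborel (\<lambda>z. N / g\<^sup>2 * indicator ({- \<rho>..\<rho>} \<times> {- \<rho>..\<rho>}) z :: real)"
        unfolding cb by (intro integrable_mult_right integrable_real_indicator) (auto simp del: emeasure_lborel_cbox_eq intro!: emeasure_bounded_finite[unfolded infinity_ennreal_def])
      show "(LINT z|lborel. N / g\<^sup>2 * indicator ({- \<rho>..\<rho>} \<times> {- \<rho>..\<rho>}) z) = D"
        using m by (simp add: D_def)
    qed
    have le1: "(LINT z|lborel. jump_kernel \<Omega> \<tau> z) \<le> (LINT z|lborel. \<Sigma> z)"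
      by (intro integral_mono int \<Sigma>) (simp add: \<Sigma>_def jump_kernel_sublevel_le_sum)
    have "(LINT z|lborel. \<Sigma> z) \<le> (LINT z|lborel. jump_kernel \<Omega> \<tau> z + N / g\<^sup>2 * indicator ({- \<rho>..\<rho>} \<times> {- \<rho>..\<rho>}) z)"
    proof (intro integral_mono Bochner_Integration.integrable_add int \<Sigma> box(1))
      fix z :: "real \<times> real"
      have "\<Sigma> z \<le> jump_kernel \<Omega> \<tau> z + N / g\<^sup>2 * indicator (\<Omega> \<times> \<Omega>) z"
        unfolding \<Sigma>_def N_def by (rule sum_jump_kernel_le[OF g gap])
      also have "\<dots> \<le> jump_kernel \<Omega> \<tau> z + N / g\<^sup>2 * indicator ({- \<rho>..\<rho>} \<times> {- \<rho>..\<rho>}) z"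
        using N \<Omega>_sub by (intro add_left_mono mult_left_mono) (auto simp: indicator_def)
      finally show "\<Sigma> z \<le> jump_kernel \<Omega> \<tau> z + N / g\<^sup>2 * indicator ({- \<rho>..\<rho>} \<times> {- \<rho>..\<rho>}) z" .
    qed
    also have "\<dots> = (LINT z|lborel. jump_kernel \<Omega> \<tau> z) + D"
      using int box by simp
    finally have le2: "(LINT z|lborel. \<Sigma> z) \<le> (LINT z|lborel. jump_kernel \<Omega> \<tau> z) + D" .
    have "\<bar>\<Sum>S\<in>components \<Omega>. 4 * (1 + ln (len S))\<bar> \<le> (\<Sum>S\<in>components \<Omega>. 4 * \<bar>1 + ln (len S)\<bar>)"
      by (intro order.trans[OF sum_abs] sum_mono) (simp add: abs_mult del: distrib_left_numeral)
    then have "\<bar>(LINT z|lborel. \<Sigma> z) - 4 * N * \<bar>ln \<tau>\<bar>\<bar> \<le> K - D"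
      unfolding \<Sigma>_int by (simp add: K_def)
    then have "\<bar>(LINT z|lborel. jump_kernel \<Omega> \<tau> z) - 4 * N * \<bar>ln \<tau>\<bar>\<bar> \<le> K"
      using le1 le2 by linarith
    with int show ?thesis by blast
  qed
  show thesis
    by (rule that[OF \<open>\<tau>1 > 0\<close>, of K]) (use main in \<open>auto simp: N_def\<close>)
qed

end

section \<open>The remainder\<close>

text \<open>The distance is at most 2 a (1 - a), and (a (1 - a))^\<kappa> = a (1 - a) a^(\<kappa> -
  1) (1 - a)^(\<kappa> - 1). One of the two singular factors is at most 2^(1 - \<kappa>), since a or
  1 - a is at least 1/2; with the 2^\<kappa> from the first step this gives the constant 2.\<close>

lemma logistic_dist_step_powr:
  assumes "0 < \<kappa>" "\<kappa> \<le> 1"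
  shows "\<bar>logistic u - (if u < 0 then 1 else 0)\<bar> powr \<kappa>
    \<le> 2 * (logistic_weight \<kappa> 0 (logistic u) + logistic_weight \<kappa> 1 (logistic u))"
proof -
  define a where "a = logistic u"
  have a: "0 < a" "a < 1" by (auto simp: a_def logistic_pos logistic_less_1)
  have half: "s powr (\<kappa> - 1) \<le> 2 powr (1 - \<kappa>)" if "s \<ge> 1 / 2" for s :: real
  proof -
    have "s powr (\<kappa> - 1) \<le> (1 / 2) powr (\<kappa> - 1)" using that assms by (intro powr_mono2') auto
    also have "\<dots> = 2 powr (1 - \<kappa>)" using powr_minus_divide[of 2 "\<kappa> - 1"] by (simp add: powr_divide)
    finally show ?thesis .
  qed
  have "(a * (1 - a)) powr (\<kappa> - 1) = a powr (\<kappa> - 1) * (1 - a) powr (\<kappa> - 1)"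
    by (rule powr_mult)
  also have "\<dots> \<le> 2 powr (1 - \<kappa>) * (a powr (\<kappa> - 1) + (1 - a) powr (\<kappa> - 1))"
  proof (cases "a \<ge> 1 / 2")
    case True
    have "a powr (\<kappa> - 1) * (1 - a) powr (\<kappa> - 1) \<le> 2 powr (1 - \<kappa>) * (1 - a) powr (\<kappa> - 1)"
      using half[OF True] by (intro mult_right_mono) auto
    also have "\<dots> \<le> 2 powr (1 - \<kappa>) * (a powr (\<kappa> - 1) + (1 - a) powr (\<kappa> - 1))"
      by (intro mult_left_mono) auto
    finally show ?thesis .
  next
    case False
    have "a powr (\<kappa> - 1) * (1 - a) powr (\<kappa> - 1) \<le> a powr (\<kappa> - 1) * 2 powr (1 - \<kappa>)"
      using half[of "1 - a"] False by (intro mult_left_mono) auto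
    also have "\<dots> \<le> (a powr (\<kappa> - 1) + (1 - a) powr (\<kappa> - 1)) * 2 powr (1 - \<kappa>)"
      by (intro mult_right_mono) auto
    finally show ?thesis by (simp add: mult.commute)
  qed
  finally have *: "(a * (1 - a)) powr (\<kappa> - 1) \<le> 2 powr (1 - \<kappa>) * (a powr (\<kappa> - 1) + (1 - a) powr (\<kappa> - 1))" .
  have "\<bar>a - (if u < 0 then 1 else 0)\<bar> powr \<kappa> \<le> (2 * (a * (1 - a))) powr \<kappa>"
    unfolding a_def using assms logistic_dist_step by (intro powr_mono2) auto
  also have "\<dots> = 2 powr \<kappa> * ((a * (1 - a)) * (a * (1 - a)) powr (\<kappa> - 1))"
    using a by (simp add: powr_mult powr_diff)
  also have "\<dots> \<le> 2 powr \<kappa> * ((a * (1 - a)) * (2 powr (1 - \<kappa>) * (a powr (\<kappa> - 1) + (1 - a) powr (\<kappa> - 1))))"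
    using a * by (intro mult_left_mono) auto
  also have "\<dots> = (2 powr \<kappa> * 2 powr (1 - \<kappa>)) * (logistic_weight \<kappa> 0 a + logistic_weight \<kappa> 1 a)"
    using a by (simp add: logistic_weight_def algebra_simps abs_if)
  also have "2 powr \<kappa> * 2 powr (1 - \<kappa>) = (2::real)" by (simp flip: powr_add)
  finally show ?thesis by (simp add: a_def)
qed

context dispersion
begin

text \<open>Two points at distance at most \<open>T / local_scale \<rho> x\<close> have values of \<open>(h - \<mu>) / T\<close> differing by at
  most 1, so that \<open>a (1 - a)\<close> is comparable at both. The maximum with \<open>\<rho>\<close> makes the scale constant
  in a neighbourhood of \<open>\<Omega>\<close>; hence a pair separated by \<open>\<Omega>\<close> is near the diagonal exactly when it
  falls below the fixed threshold of the jump kernel.\<close>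

definition local_scale :: "real \<Rightarrow> real \<Rightarrow> real" where
  "local_scale \<rho> x = C1 * max \<rho> (2 + \<bar>x\<bar>) powr \<beta>2"

lemma local_scale_measurable [measurable]: "local_scale \<rho> \<in> borel_measurable borel"
  unfolding local_scale_def by measurable

lemma local_scale_ge_1: "local_scale \<rho> x \<ge> 1"
proof -
  have "1 * 1 \<le> C1 * max \<rho> (2 + \<bar>x\<bar>) powr \<beta>2"
    using h'_growth_const by (intro mult_mono ge_one_powr_ge_zero) auto
  then show ?thesis by (simp add: local_scale_def)
qed

text \<open>A pair that is not near fails the test at one of its points; the comparison of scales
  passes this on to the other point.\<close>

lemma local_scale_double:
  assumes "\<bar>x - y\<bar> \<le> 1"
  shows "local_scale \<rho> y \<le> 2 powr \<beta>2 * local_scale \<rho> x"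
proof -
  have "max \<rho> (2 + \<bar>y\<bar>) powr \<beta>2 \<le> (2 * max \<rho> (2 + \<bar>x\<bar>)) powr \<beta>2"
  proof (rule powr_mono2)
    have "\<bar>y\<bar> - \<bar>x\<bar> \<le> 1"
      by (rule order.trans[OF abs_triangle_ineq2_sym assms])
    then have "2 + \<bar>y\<bar> \<le> 2 * (2 + \<bar>x\<bar>)" by simp
    moreover have "\<rho> \<le> max \<rho> (2 + \<bar>x\<bar>)" "2 + \<bar>x\<bar> \<le> max \<rho> (2 + \<bar>x\<bar>)" "0 \<le> \<bar>x\<bar>" by auto
    ultimately show "max \<rho> (2 + \<bar>y\<bar>) \<le> 2 * max \<rho> (2 + \<bar>x\<bar>)"
      by (intro max.boundedI) argo+
  qed (use h'_growth_const in auto)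
  then show ?thesis using h'_growth_const by (simp add: local_scale_def powr_mult mult_left_mono)
qed

lemma local_scale_const: "2 + \<bar>x\<bar> \<le> \<rho> \<Longrightarrow> local_scale \<rho> x = C1 * \<rho> powr \<beta>2"
  by (simp add: local_scale_def max_def)

text \<open>The summand 2 in the scale comes from here: on the segment 1 + |z| \<le> 2 + |x|, so the
  scale at x bounds |h'| throughout.\<close>

lemma h_lipschitz:
  assumes "\<bar>x - y\<bar> \<le> 1"
  shows "\<bar>h x - h y\<bar> \<le> local_scale \<rho> x * \<bar>x - y\<bar>"
proof -
  have "norm (h x - h y) \<le> local_scale \<rho> x * \<bar>x - y\<bar>"
  proof (rule mean_value_inequality)
    fix z assume z: "z \<in> closed_segment x y"
    show "(h has_vector_derivative h' z) (at z)"
      using h_deriv by (simp add: has_real_derivative_iff_has_vector_derivative)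
    have "\<bar>z - x\<bar> \<le> 1" using z assms by (auto simp: closed_segment_eq_real_ivl split: if_splits)
    then have "(1 + \<bar>z\<bar>) powr \<beta>2 \<le> max \<rho> (2 + \<bar>x\<bar>) powr \<beta>2"
      using h'_growth_const by (intro powr_mono2) auto
    then have "C1 * (1 + \<bar>z\<bar>) powr \<beta>2 \<le> local_scale \<rho> x"
      unfolding local_scale_def using h'_growth_const by (intro mult_left_mono) auto
    then show "norm (h' z) \<le> local_scale \<rho> x"
      using h'_growth[of z] unfolding real_norm_def by linarith
  qed
  then show ?thesis by simp
qed

end

text \<open>The 3 is the 2 of the local scale plus 1, so that the scale is constant on the
  neighbourhood of \<Omega> of radius 1.\<close>

locale fermi_singularity = dispersion h h' \<mu> \<beta>1 c0 r0 \<beta>2 C1 + power_singularity f f' f'' t0 \<gamma> C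
  for h h' \<mu> \<beta>1 c0 r0 \<beta>2 C1 f f' f'' t0 \<gamma> C +
  fixes \<rho> :: real
  assumes \<rho>: "h x \<le> \<mu> \<Longrightarrow> 3 + \<bar>x\<bar> \<le> \<rho>" and \<rho>_ge: "\<rho> \<ge> 3"
begin

abbreviation "\<delta> \<equiv> \<gamma> / 2"
abbreviation "lscale \<equiv> local_scale \<rho>"
abbreviation "scale0 \<equiv> C1 * \<rho> powr \<beta>2"
abbreviation "ratio \<equiv> 2 powr \<beta>2"

text \<open>The weights at 0 and 1 control the far error |a - \<chi>|^\<delta>, the weight at
  \<open>t0\<close> the near error; their sum allows a single majorant.\<close>

definition total_weight :: "real \<Rightarrow> real \<Rightarrow> real" where
  "total_weight T x = logistic_weight \<delta> 0 (fermi h \<mu> T x) + logistic_weight \<delta> 1 (fermi h \<mu> T x)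
     + logistic_weight \<delta> t0 (fermi h \<mu> T x)"

lemma \<delta>: "0 < \<delta>" "\<delta> \<le> 1"
  using exponent by auto

lemma logistic_weight_fermi_nonneg: "logistic_weight \<kappa> t (fermi h \<mu> T x) \<ge> 0"
  by (simp add: fermi_eq_logistic logistic_weight_nonneg)

lemma total_weight_nonneg: "total_weight T x \<ge> 0"
  by (simp add: total_weight_def logistic_weight_fermi_nonneg)

lemma total_weight_measurable [measurable]: "total_weight T \<in> borel_measurable borel"
  unfolding total_weight_def logistic_weight_def by measurable

lemma scale0_ge_1: "scale0 \<ge> 1"
proof -
  have "1 * 1 \<le> C1 * \<rho> powr \<beta>2"
    using h'_growth_const \<rho>_ge by (intro mult_mono ge_one_powr_ge_zero) auto
  then show ?thesis by simp
qed

lemma scale_near_sublevel: "x \<in> \<Omega> \<Longrightarrow> \<bar>x - y\<bar> \<le> 1 \<Longrightarrow> lscale y = scale0"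
  using \<rho>[of x] by (intro local_scale_const) (auto simp: sublevel_def)

text \<open>The bound |s|^(1 + \<delta>) for \<open>U\<close> divided by s^2 leaves |s|^(\<delta> -
  1), and the prefactor is the power 1 + \<delta> of the local Lipschitz constant of (h - \<mu>) /
  T.\<close>

definition near_part :: "real \<Rightarrow> real \<Rightarrow> real \<Rightarrow> real" where
  "near_part T x s = (if \<bar>s\<bar> \<le> T / lscale x then (lscale x / T) powr (1 + \<delta>) * \<bar>s\<bar> powr (\<delta> - 1) else 0)"

text \<open>Its range overlaps that of \<open>near_part\<close>, because a far pair is only known to
  reach the threshold up to the factor \<open>ratio\<close> at each of its points.\<close>

definition far_part :: "real \<Rightarrow> real \<Rightarrow> real \<Rightarrow> real" where
  "far_part T x s = (if T / (ratio * lscale x) \<le> \<bar>s\<bar> then 1 / s\<^sup>2 else 0)"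

text \<open>A function of one point and the difference; the remainder is bounded by one such term
  for each of its two points. The 36 comes from the near estimate and exceeds the 2 of the far
  one.\<close>

definition majorant :: "real \<Rightarrow> real \<Rightarrow> real \<Rightarrow> real" where
  "majorant T x s = 36 * U_const * total_weight T x * (near_part T x s + far_part T x s)"

lemma parts_nonneg: "0 \<le> near_part T x s" "0 \<le> far_part T x s"
  by (auto simp: near_part_def far_part_def)

lemma majorant_nonneg: "0 \<le> majorant T x s"
  using U_const_nonneg total_weight_nonneg parts_nonneg by (simp add: majorant_def)

lemma majorant_measurable [measurable]: "case_prod (majorant T) \<in> borel_measurable (borel \<Otimes>\<^sub>M borel)"
  unfolding majorant_def near_part_def far_part_def by measurable

text \<open>On values 0 and 1 of the indicator, \<open>U\<close> is \<open>U 1 0 f\<close> across a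
  jump and 0 otherwise, so this is the Hoelder continuity of \<open>U\<close> on the unit
  square.\<close>

lemma U_far:
  "norm (U (fermi h \<mu> T x) (fermi h \<mu> T y) f - (if (x \<in> \<Omega>) \<noteq> (y \<in> \<Omega>) then U 1 0 f else 0))
    \<le> 2 * U_const * (total_weight T x + total_weight T y)" if T: "T > 0"
proof -
  define ind :: "real \<Rightarrow> real" where "ind x = (if x \<in> \<Omega> then 1 else 0)" for x
  have dist: "\<bar>fermi h \<mu> T x - ind x\<bar> powr \<delta> \<le> 2 * total_weight T x" for x
  proof -
    have "(h x - \<mu>) / T < 0 \<longleftrightarrow> x \<in> \<Omega>" using T by (simp add: sublevel_def divide_less_0_iff)
    then have "\<bar>fermi h \<mu> T x - ind x\<bar> powr \<delta> \<le>
      2 * (logistic_weight \<delta> 0 (fermi h \<mu> T x) + logistic_weight \<delta> 1 (fermi h \<mu> T x))"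
      using logistic_dist_step_powr[OF \<delta>, of "(h x - \<mu>) / T"] by (simp add: ind_def fermi_eq_logistic)
    then show ?thesis using logistic_weight_fermi_nonneg[of \<delta> t0 T x] by (simp add: total_weight_def)
  qed
  have "(if (x \<in> \<Omega>) \<noteq> (y \<in> \<Omega>) then U 1 0 f else 0) = U (ind x) (ind y) f"
    using U_commute[of 0 1 f] by (auto simp: ind_def)
  moreover have "norm (U (fermi h \<mu> T x) (fermi h \<mu> T y) f - U (ind x) (ind y) f)
    \<le> U_const * (\<bar>fermi h \<mu> T x - ind x\<bar> powr \<delta> + \<bar>fermi h \<mu> T y - ind y\<bar> powr \<delta>)"
    by (rule U_difference)
       (auto simp: ind_def fermi_eq_logistic intro: less_imp_le logistic_pos logistic_less_1)
  moreover have "\<dots> \<le> U_const * (2 * total_weight T x + 2 * total_weight T y)"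
    using U_const_nonneg by (intro mult_left_mono add_mono dist)
  ultimately show ?thesis by (simp add: algebra_simps)
qed

text \<open>The singular factor |a - t0|^(\<delta> - 1) at either point is paired with the logistic
  difference bound based at the same point. This yields (a (1 - a))^(1 + \<delta>) \<le> a (1 - a)
  there, hence the weight at that point. The 36 bounds 6^(1 + \<delta>).\<close>

lemma U_near:
  assumes T: "0 < T" "T \<le> 1" and near: "\<bar>x - y\<bar> * lscale x \<le> T" "\<bar>x - y\<bar> * lscale y \<le> T"
  shows "norm (U (fermi h \<mu> T x) (fermi h \<mu> T y) f)
    \<le> 36 * U_const * \<bar>x - y\<bar> powr (1 + \<delta>) *
      ((lscale x / T) powr (1 + \<delta>) * total_weight T x + (lscale y / T) powr (1 + \<delta>) * total_weight T y)"
proof -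
  define a where "a = fermi h \<mu> T"
  define s where "s = \<bar>x - y\<bar>"
  have s1: "s \<le> 1"
    using near(1) T local_scale_ge_1[of \<rho> x] mult_left_mono[of 1 "lscale x" s] by (simp add: s_def)
  have one_sided: "\<bar>a x - a y\<bar> powr (1 + \<delta>) * \<bar>a z - t0\<bar> powr (\<delta> - 1)
      \<le> 36 * s powr (1 + \<delta>) * ((lscale z / T) powr (1 + \<delta>) * total_weight T z)" if "z = x \<or> z = y" for z
  proof -
    define w where "w = (if z = x then y else x)"
    have zw: "\<bar>z - w\<bar> = s" "\<bar>a x - a y\<bar> = \<bar>a z - a w\<bar>" "s * lscale z \<le> T"
      using that near by (auto simp: w_def s_def)
    define v where "v = a z * (1 - a z)"
    have az: "0 < a z" "a z < 1" by (auto simp: a_def fermi_eq_logistic logistic_pos logistic_less_1)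
    have v: "0 < v" "v \<le> 1" using az by (auto simp: v_def intro: mult_le_one)
    have "\<bar>h z - h w\<bar> \<le> lscale z * s" using h_lipschitz[of z w \<rho>] zw s1 by simp
    then have du: "\<bar>(h z - \<mu>) / T - (h w - \<mu>) / T\<bar> \<le> lscale z * s / T"
      using T by (simp add: divide_right_mono flip: diff_divide_distrib)
    also have "\<dots> \<le> 1" using zw T by (simp add: mult.commute)
    finally have "\<bar>a z - a w\<bar> \<le> 6 * \<bar>(h z - \<mu>) / T - (h w - \<mu>) / T\<bar> * v"
      unfolding a_def fermi_eq_logistic v_def by (rule logistic_diff_le)
    also have "\<dots> \<le> 6 * (lscale z * s / T) * v"
      using du v by (intro mult_right_mono mult_left_mono) auto
    finally have "\<bar>a x - a y\<bar> powr (1 + \<delta>) \<le> (6 * (lscale z * s / T) * v) powr (1 + \<delta>)"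
      using \<delta> zw by (intro powr_mono2) auto
    also have "\<dots> = 6 powr (1 + \<delta>) * s powr (1 + \<delta>) * (lscale z / T) powr (1 + \<delta>) * v powr (1 + \<delta>)"
      by (simp add: powr_mult powr_divide)
    also have "\<dots> \<le> 36 * s powr (1 + \<delta>) * (lscale z / T) powr (1 + \<delta>) * v"
    proof -
      have "(6::real) powr (1 + \<delta>) \<le> 6 powr 2" using \<delta> by (intro powr_mono) auto
      then have "(6::real) powr (1 + \<delta>) \<le> 36" by simp
      moreover have "v powr (1 + \<delta>) \<le> v powr 1" using v \<delta> by (intro powr_mono') auto
      then have "v powr (1 + \<delta>) \<le> v" using v by simp
      ultimately show ?thesis by (intro mult_mono mult_right_mono) auto
    qed
    finally have "\<bar>a x - a y\<bar> powr (1 + \<delta>) * \<bar>a z - t0\<bar> powr (\<delta> - 1)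
        \<le> (36 * s powr (1 + \<delta>) * (lscale z / T) powr (1 + \<delta>) * v) * \<bar>a z - t0\<bar> powr (\<delta> - 1)"
      using v by (intro mult_right_mono) auto
    also have "\<dots> = 36 * s powr (1 + \<delta>) * ((lscale z / T) powr (1 + \<delta>) * logistic_weight \<delta> t0 (a z))"
      by (simp add: logistic_weight_def v_def)
    also have "\<dots> \<le> 36 * s powr (1 + \<delta>) * ((lscale z / T) powr (1 + \<delta>) * total_weight T z)"
      by (intro mult_left_mono) (auto simp: total_weight_def a_def logistic_weight_fermi_nonneg)
    finally show ?thesis .
  qed
  have "norm (U (a x) (a y) f) \<le> U_const * (\<bar>a x - a y\<bar> powr (1 + \<delta>) * \<bar>a x - t0\<bar> powr (\<delta> - 1)
      + \<bar>a x - a y\<bar> powr (1 + \<delta>) * \<bar>a y - t0\<bar> powr (\<delta> - 1))"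
    using U_near_diagonal[of "a x" "a y"] by (simp add: algebra_simps)
  also have "\<dots> \<le> U_const * (36 * s powr (1 + \<delta>) * ((lscale x / T) powr (1 + \<delta>) * total_weight T x)
      + 36 * s powr (1 + \<delta>) * ((lscale y / T) powr (1 + \<delta>) * total_weight T y))"
    using U_const_nonneg by (intro mult_left_mono add_mono one_sided) auto
  finally show ?thesis by (simp add: a_def s_def algebra_simps)
qed

definition remainder :: "real \<Rightarrow> real \<times> real \<Rightarrow> complex" where
  "remainder T z = B_integrand (fermi h \<mu> T) f z - jump_kernel \<Omega> (T / scale0) z *\<^sub>R U 1 0 f"

lemma remainder_le_majorant:
  assumes T: "0 < T" "T \<le> 1"
  shows "norm (remainder T (x, y)) \<le> majorant T x (y - x) + majorant T y (x - y)"
proof (cases "x = y")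
  case True
  then have "remainder T (x, y) = 0" by (simp add: remainder_def B_integrand_def jump_kernel_def)
  then show ?thesis using majorant_nonneg by (simp add: add_nonneg_nonneg)
next
  case False
  define s where "s = \<bar>x - y\<bar>"
  have s: "s > 0" using False by (simp add: s_def)
  have sc: "lscale x \<ge> 1" "lscale y \<ge> 1" by (rule local_scale_ge_1)+
  have weights: "0 \<le> total_weight T x" "0 \<le> total_weight T y" by (rule total_weight_nonneg)+
  show ?thesis
  proof (cases "s * lscale x < T \<and> s * lscale y < T")
    case True
    \<comment> \<open>A separated pair has a point in \<Omega>, whose local scale is
      \<open>scale0\<close>; a near pair therefore lies below the cutoff.\<close>
    have jump0: "jump_kernel \<Omega> (T / scale0) (x, y) = 0"
    proof (rule ccontr)
      assume "jump_kernel \<Omega> (T / scale0) (x, y) \<noteq> 0"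
      then have *: "(x \<in> \<Omega>) \<noteq> (y \<in> \<Omega>)" "T / scale0 \<le> s"
        by (auto simp: jump_kernel_def s_def split: if_splits)
      then have "lscale x = scale0 \<or> lscale y = scale0" using scale_near_sublevel[of x x] scale_near_sublevel[of y y] by auto
      then show False using True *(2) scale0_ge_1 by (auto simp: pos_divide_le_eq)
    qed
    have p: "s powr (1 + \<delta>) / s\<^sup>2 = s powr (\<delta> - 1)"
    proof -
      have "s\<^sup>2 = s powr 2" using s by simp
      then show ?thesis by (simp flip: powr_diff)
    qed
    have "norm (remainder T (x, y)) = norm (U (fermi h \<mu> T x) (fermi h \<mu> T y) f) / s\<^sup>2"
      unfolding remainder_def jump0 by (simp add: B_integrand_def s_def divide_inverse mult.commute)
    also have "\<dots> \<le> 36 * U_const * s powr (1 + \<delta>) *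
      ((lscale x / T) powr (1 + \<delta>) * total_weight T x + (lscale y / T) powr (1 + \<delta>) * total_weight T y) / s\<^sup>2"
      using U_near[OF T, of x y] True by (intro divide_right_mono) (auto simp: s_def)
    also have "\<dots> = 36 * U_const * (s powr (1 + \<delta>) / s\<^sup>2) *
      ((lscale x / T) powr (1 + \<delta>) * total_weight T x + (lscale y / T) powr (1 + \<delta>) * total_weight T y)"
      by simp
    also have "\<dots> = 36 * U_const * total_weight T x * ((lscale x / T) powr (1 + \<delta>) * s powr (\<delta> - 1))
      + 36 * U_const * total_weight T y * ((lscale y / T) powr (1 + \<delta>) * s powr (\<delta> - 1))"
      unfolding p by (simp add: algebra_simps)
    also have "(lscale x / T) powr (1 + \<delta>) * s powr (\<delta> - 1) = near_part T x (y - x)"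
      using True sc by (auto simp: near_part_def s_def abs_minus_commute pos_le_divide_eq)
    also have "(lscale y / T) powr (1 + \<delta>) * s powr (\<delta> - 1) = near_part T y (x - y)"
      using True sc by (auto simp: near_part_def s_def pos_le_divide_eq)
    also have "36 * U_const * total_weight T x * near_part T x (y - x) + 36 * U_const * total_weight T y * near_part T y (x - y)
      \<le> majorant T x (y - x) + majorant T y (x - y)"
      unfolding majorant_def using U_const_nonneg weights parts_nonneg
      by (intro add_mono mult_left_mono) auto
    finally show ?thesis .
  next
    case far: False
    have ratio: "ratio \<ge> 1" using h'_growth_const by (simp add: ge_one_powr_ge_zero)
    \<comment> \<open>At least one point reaches its threshold. At distance at most 1 the scale of
      the other point is comparable up to \<open>ratio\<close>; at larger distance T \<le> 1
      suffices.\<close>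
    have T_le: "T \<le> s * (ratio * lscale x)" "T \<le> s * (ratio * lscale y)"
    proof -
      have "T \<le> s * (ratio * lscale x) \<and> T \<le> s * (ratio * lscale y)"
      proof (cases "s \<le> 1")
        case True
        have "lscale x \<le> ratio * lscale x" "lscale y \<le> ratio * lscale y"
          using ratio sc mult_right_mono[of 1 ratio "lscale x"] mult_right_mono[of 1 ratio "lscale y"] by auto
        moreover have "lscale y \<le> ratio * lscale x" "lscale x \<le> ratio * lscale y"
          using True by (auto intro!: local_scale_double simp: s_def abs_minus_commute)
        ultimately have "s * lscale x \<le> s * (ratio * lscale x)" "s * lscale y \<le> s * (ratio * lscale y)"
          "s * lscale y \<le> s * (ratio * lscale x)" "s * lscale x \<le> s * (ratio * lscale y)"
          using s by (auto intro: mult_left_mono)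
        then show ?thesis using far by linarith
      next
        case False
        have "1 * (1 * 1) \<le> s * (ratio * lscale x)" "1 * (1 * 1) \<le> s * (ratio * lscale y)"
          using False ratio sc by (intro mult_mono; simp)+
        then show ?thesis using T by simp
      qed
      then show "T \<le> s * (ratio * lscale x)" "T \<le> s * (ratio * lscale y)" by auto
    qed
    have far_eq: "far_part T x (y - x) = 1 / s\<^sup>2" "far_part T y (x - y) = 1 / s\<^sup>2"
    proof -
      have "0 < ratio * lscale x" "0 < ratio * lscale y" using ratio sc by (auto intro: mult_pos_pos)
      then have "T / (ratio * lscale x) \<le> s" "T / (ratio * lscale y) \<le> s"
        using T_le by (simp_all add: pos_divide_le_eq)
      then show "far_part T x (y - x) = 1 / s\<^sup>2" "far_part T y (x - y) = 1 / s\<^sup>2"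
        by (auto simp: far_part_def s_def abs_minus_commute power2_commute)
    qed
    \<comment> \<open>At distance at most 1 both points of a separated pair have scale
      \<open>scale0\<close>, so a far pair reaches the cutoff; beyond distance 1 the cutoff is
      passed because T / scale0 \<le> 1.\<close>
    have thr: "T / scale0 \<le> s" if "(x \<in> \<Omega>) \<noteq> (y \<in> \<Omega>)"
    proof (cases "s \<le> 1")
      case True
      have "lscale x = scale0 \<and> lscale y = scale0"
      proof (cases "x \<in> \<Omega>")
        case True
        with \<open>s \<le> 1\<close> show ?thesis using scale_near_sublevel[of x] by (auto simp: s_def)
      next
        case False
        with that \<open>s \<le> 1\<close> show ?thesis using scale_near_sublevel[of y] by (auto simp: s_def abs_minus_commute)
      qed
      then show ?thesis using far scale0_ge_1 by (auto simp: pos_divide_le_eq)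
    next
      case False
      have "T / scale0 \<le> 1" using T scale0_ge_1 by (simp add: pos_divide_le_eq)
      then show ?thesis using False by simp
    qed
    have "remainder T (x, y) = (U (fermi h \<mu> T x) (fermi h \<mu> T y) f - (if (x \<in> \<Omega>) \<noteq> (y \<in> \<Omega>) then U 1 0 f else 0)) /\<^sub>R s\<^sup>2"
      using thr by (auto simp: remainder_def B_integrand_def jump_kernel_def s_def divide_inverse scaleR_diff_right)
    then have "norm (remainder T (x, y)) =
      norm (U (fermi h \<mu> T x) (fermi h \<mu> T y) f - (if (x \<in> \<Omega>) \<noteq> (y \<in> \<Omega>) then U 1 0 f else 0)) * (1 / s\<^sup>2)"
      by (simp only: norm_scaleR) (simp add: divide_inverse)
    also have "\<dots> \<le> 2 * U_const * (total_weight T x + total_weight T y) * (1 / s\<^sup>2)"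
      using T by (intro mult_right_mono U_far) auto
    also have "\<dots> = 2 * U_const * total_weight T x * far_part T x (y - x) + 2 * U_const * total_weight T y * far_part T y (x - y)"
      by (simp add: far_eq add_divide_distrib ring_distribs)
    also have "\<dots> \<le> majorant T x (y - x) + majorant T y (x - y)"
      unfolding majorant_def using U_const_nonneg weights parts_nonneg
      by (intro add_mono mult_mono) (auto intro!: mult_nonneg_nonneg add_nonneg_nonneg)
    finally show ?thesis .
  qed
qed

text \<open>By scaling, both parts integrate to a multiple of \<open>lscale x / T\<close>: in the
  near part the powers 1 + \<delta> and - \<delta> of \<open>lscale x / T\<close> combine, and the
  far part gives 2 divided by its threshold.\<close>

lemma nn_integral_majorant:
  assumes T: "0 < T"
  shows "(\<integral>\<^sup>+ s. ennreal (majorant T x s) \<partial>lborel)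
    = ennreal (36 * U_const * (2 / \<delta> + 2 * ratio) / T * (total_weight T x * lscale x))"
proof -
  have sc: "lscale x \<ge> 1" by (rule local_scale_ge_1)
  have c: "0 < T / (ratio * lscale x)" "0 \<le> T / lscale x" using T sc by auto
  have near: "(\<integral>\<^sup>+ s. ennreal (near_part T x s) \<partial>lborel) = ennreal (2 / \<delta> * (lscale x / T))"
  proof -
    have "(\<integral>\<^sup>+ s. ennreal (near_part T x s) \<partial>lborel) =
      (\<integral>\<^sup>+ s. ennreal ((lscale x / T) powr (1 + \<delta>)) * (ennreal (\<bar>s\<bar> powr (\<delta> - 1)) * indicator {s. \<bar>s\<bar> \<le> T / lscale x} s) \<partial>lborel)"
      by (intro nn_integral_cong) (auto simp: near_part_def indicator_def ennreal_mult)
    also have "\<dots> = ennreal ((lscale x / T) powr (1 + \<delta>)) * ennreal (2 * (T / lscale x) powr \<delta> / \<delta>)"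
      by (subst nn_integral_cmult) (auto simp: nn_integral_powr_inside[OF \<delta>(1) c(2)])
    also have "\<dots> = ennreal ((lscale x / T) powr (1 + \<delta>) * (2 * (T / lscale x) powr \<delta> / \<delta>))"
      using \<delta> by (subst ennreal_mult) auto
    also have "(lscale x / T) powr (1 + \<delta>) * (2 * (T / lscale x) powr \<delta> / \<delta>) = 2 / \<delta> * (lscale x / T)"
      using T sc by (simp add: powr_add powr_divide mult_ac)
    finally show ?thesis .
  qed
  have far: "(\<integral>\<^sup>+ s. ennreal (far_part T x s) \<partial>lborel) = ennreal (2 * ratio * (lscale x / T))"
  proof -
    have "(\<integral>\<^sup>+ s. ennreal (far_part T x s) \<partial>lborel) =
      (\<integral>\<^sup>+ s. ennreal (1 / s\<^sup>2) * indicator {s. \<bar>s\<bar> \<ge> T / (ratio * lscale x)} s \<partial>lborel)"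
      by (intro nn_integral_cong) (auto simp: far_part_def indicator_def)
    then show ?thesis using nn_integral_inverse_square_outside[OF c(1)] by (simp add: mult.assoc)
  qed
  have [measurable]: "near_part T x \<in> borel_measurable borel" "far_part T x \<in> borel_measurable borel"
    unfolding near_part_def far_part_def by measurable
  have nonneg: "0 \<le> 36 * U_const * total_weight T x" using U_const_nonneg total_weight_nonneg by simp
  have "(\<integral>\<^sup>+ s. ennreal (majorant T x s) \<partial>lborel) =
    (\<integral>\<^sup>+ s. ennreal (36 * U_const * total_weight T x) * (ennreal (near_part T x s) + ennreal (far_part T x s)) \<partial>lborel)"
    using nonneg parts_nonneg by (intro nn_integral_cong) (simp add: majorant_def ennreal_mult flip: ennreal_plus)
  also have "\<dots> = ennreal (36 * U_const * total_weight T x) *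
      (ennreal (2 / \<delta> * (lscale x / T)) + ennreal (2 * ratio * (lscale x / T)))"
    by (subst nn_integral_cmult, measurable) (subst nn_integral_add; simp add: near far)
  also have "\<dots> = ennreal (36 * U_const * total_weight T x * (2 / \<delta> * (lscale x / T) + 2 * ratio * (lscale x / T)))"
    using nonneg \<delta> T sc by (subst ennreal_plus[symmetric]) (auto simp: ennreal_mult)
  also have "36 * U_const * total_weight T x * (2 / \<delta> * (lscale x / T) + 2 * ratio * (lscale x / T))
    = 36 * U_const * (2 / \<delta> + 2 * ratio) / T * (total_weight T x * lscale x)"
    using T by (simp add: field_simps)
  finally show ?thesis .
qed

lemma total_weight_integral:
  obtains K T1 where "K \<ge> 0" "T1 > 0"
    "\<And>T. 0 < T \<Longrightarrow> T < T1 \<Longrightarrow> (\<integral>\<^sup>+ x. ennreal (total_weight T x * lscale x) \<partial>lborel) \<le> ennreal (K * T)"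
proof -
  have "\<rho> \<ge> 1" using \<rho>_ge by simp
  note weight_integral = logistic_weight_integral[OF \<delta> this h'_growth_const(1)]
  obtain Ka Ta where Ka: "Ka \<ge> 0" "Ta > 0" "\<And>T. 0 < T \<Longrightarrow> T < Ta \<Longrightarrow>
      (\<integral>\<^sup>+ x. ennreal (logistic_weight \<delta> 0 (fermi h \<mu> T x) * (\<rho> + \<bar>x\<bar>) powr \<beta>2) \<partial>lborel) \<le> ennreal (Ka * T)"
    by (rule weight_integral[of 0]) (rule that)
  obtain Kb Tb where Kb: "Kb \<ge> 0" "Tb > 0" "\<And>T. 0 < T \<Longrightarrow> T < Tb \<Longrightarrow>
      (\<integral>\<^sup>+ x. ennreal (logistic_weight \<delta> 1 (fermi h \<mu> T x) * (\<rho> + \<bar>x\<bar>) powr \<beta>2) \<partial>lborel) \<le> ennreal (Kb * T)"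
    by (rule weight_integral[of 1]) (rule that)
  obtain Kc Tc where Kc: "Kc \<ge> 0" "Tc > 0" "\<And>T. 0 < T \<Longrightarrow> T < Tc \<Longrightarrow>
      (\<integral>\<^sup>+ x. ennreal (logistic_weight \<delta> t0 (fermi h \<mu> T x) * (\<rho> + \<bar>x\<bar>) powr \<beta>2) \<partial>lborel) \<le> ennreal (Kc * T)"
    by (rule weight_integral[of t0]) (rule that)
  define K where "K = C1 * (Ka + Kb + Kc)"
  define T1 where "T1 = min Ta (min Tb Tc)"
  show thesis
  proof (rule that)
    show "K \<ge> 0" using h'_growth_const Ka(1) Kb(1) Kc(1) by (simp add: K_def)
    show "T1 > 0" using Ka(2) Kb(2) Kc(2) by (simp add: T1_def)
    fix T assume T: "0 < T" "T < T1"
    define \<psi> where "\<psi> t x = logistic_weight \<delta> t (fermi h \<mu> T x) * (\<rho> + \<bar>x\<bar>) powr \<beta>2" for t x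
    have \<psi>0: "\<psi> t x \<ge> 0" for t x by (simp add: \<psi>_def logistic_weight_fermi_nonneg)
    have [measurable]: "\<psi> t \<in> borel_measurable borel" for t
      unfolding \<psi>_def logistic_weight_def by measurable
    have "(\<integral>\<^sup>+ x. ennreal (total_weight T x * lscale x) \<partial>lborel) \<le>
      (\<integral>\<^sup>+ x. ennreal C1 * (ennreal (\<psi> 0 x) + ennreal (\<psi> 1 x) + ennreal (\<psi> t0 x)) \<partial>lborel)"
    proof (rule nn_integral_mono)
      fix x
      have "lscale x \<le> C1 * (\<rho> + \<bar>x\<bar>) powr \<beta>2"
        unfolding local_scale_def using h'_growth_const \<rho>_ge by (intro mult_left_mono powr_mono2) auto
      then have "total_weight T x * lscale x \<le> total_weight T x * (C1 * (\<rho> + \<bar>x\<bar>) powr \<beta>2)"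
        using total_weight_nonneg by (intro mult_left_mono)
      also have "\<dots> = C1 * (\<psi> 0 x + \<psi> 1 x + \<psi> t0 x)" by (simp add: total_weight_def \<psi>_def algebra_simps)
      finally have "ennreal (total_weight T x * lscale x) \<le> ennreal (C1 * (\<psi> 0 x + \<psi> 1 x + \<psi> t0 x))" by (rule ennreal_leI)
      also have "\<dots> = ennreal C1 * (ennreal (\<psi> 0 x) + ennreal (\<psi> 1 x) + ennreal (\<psi> t0 x))"
        using \<psi>0 h'_growth_const by (simp add: ennreal_mult)
      finally show "ennreal (total_weight T x * lscale x) \<le> \<dots>" .
    qed
    also have "\<dots> = ennreal C1 * ((\<integral>\<^sup>+ x. ennreal (\<psi> 0 x) \<partial>lborel) + (\<integral>\<^sup>+ x. ennreal (\<psi> 1 x) \<partial>lborel) + (\<integral>\<^sup>+ x. ennreal (\<psi> t0 x) \<partial>lborel))"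
      by (simp add: nn_integral_cmult nn_integral_add)
    also have "\<dots> \<le> ennreal C1 * (ennreal (Ka * T) + ennreal (Kb * T) + ennreal (Kc * T))"
      unfolding \<psi>_def using T by (intro mult_left_mono add_mono Ka(3) Kb(3) Kc(3)) (auto simp: T1_def)
    also have "\<dots> = ennreal (C1 * (Ka * T + Kb * T + Kc * T))"
      using Ka(1) Kb(1) Kc(1) T h'_growth_const by (simp add: ennreal_mult)
    also have "C1 * (Ka * T + Kb * T + Kc * T) = K * T" by (simp add: K_def algebra_simps)
    finally show "(\<integral>\<^sup>+ x. ennreal (total_weight T x * lscale x) \<partial>lborel) \<le> ennreal (K * T)" .
  qed
qed

text \<open>The factor 1 / T from the integration over the difference cancels the factor T in the
  integral of the weights.\<close>

lemma remainder_integral_bounded: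
  obtains K T1 where "K \<ge> 0" "T1 > 0"
    "\<And>T. 0 < T \<Longrightarrow> T < T1 \<Longrightarrow> (\<integral>\<^sup>+ z. ennreal (norm (remainder T z)) \<partial>lborel) \<le> ennreal K"
proof -
  obtain K0 T0 where K0: "K0 \<ge> 0" "T0 > 0"
    "\<And>T. 0 < T \<Longrightarrow> T < T0 \<Longrightarrow> (\<integral>\<^sup>+ x. ennreal (total_weight T x * lscale x) \<partial>lborel) \<le> ennreal (K0 * T)"
    by (rule total_weight_integral) (rule that)
  define E where "E = 36 * U_const * (2 / \<delta> + 2 * ratio)"
  have E: "E \<ge> 0" unfolding E_def using U_const_nonneg \<delta> by (intro mult_nonneg_nonneg add_nonneg_nonneg) auto
  show thesis
  proof (rule that)
    show "0 \<le> 2 * (E * K0)" using E K0 by simp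
    show "0 < min 1 T0" using K0 by simp
    fix T assume "0 < T" "T < min 1 T0"
    then have T: "0 < T" "T \<le> 1" "T < T0" by auto
    define g where "g z = ennreal (majorant T (fst z) (snd z - fst z))" for z :: "real \<times> real"
    have g_meas[measurable]: "g \<in> borel_measurable (borel \<Otimes>\<^sub>M borel)"
    proof -
      have "(\<lambda>z. case_prod (majorant T) (fst z, snd z - fst z)) \<in> borel_measurable (borel \<Otimes>\<^sub>M borel)"
        by measurable
      then show ?thesis unfolding g_def by simp
    qed
    have g_int: "(\<integral>\<^sup>+ z. g z \<partial>lborel) \<le> ennreal (E * K0)"
    proof -
      have "(\<integral>\<^sup>+ z. g z \<partial>lborel) = (\<integral>\<^sup>+ x. \<integral>\<^sup>+ s. ennreal (majorant T x s) \<partial>lborel \<partial>lborel)"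
        unfolding g_def by (rule nn_integral_lborel_shear[of "\<lambda>x s. ennreal (majorant T x s)"]) measurable
      also have "\<dots> = (\<integral>\<^sup>+ x. ennreal (E / T) * ennreal (total_weight T x * lscale x) \<partial>lborel)"
        using E T by (intro nn_integral_cong) (simp add: nn_integral_majorant E_def ennreal_mult'[symmetric])
      also have "\<dots> = ennreal (E / T) * (\<integral>\<^sup>+ x. ennreal (total_weight T x * lscale x) \<partial>lborel)"
        by (intro nn_integral_cmult) measurable
      also have "\<dots> \<le> ennreal (E / T) * ennreal (K0 * T)"
        using T by (intro mult_left_mono K0) auto
      also have "\<dots> = ennreal (E * K0)" using E T K0 by (subst ennreal_mult[symmetric]) auto
      finally show ?thesis .
    qed
    have "(\<integral>\<^sup>+ z. ennreal (norm (remainder T z)) \<partial>lborel) \<le> (\<integral>\<^sup>+ z. g z + g (snd z, fst z) \<partial>lborel)"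
    proof (rule nn_integral_mono)
      fix z :: "real \<times> real"
      obtain x y where z: "z = (x, y)" by (cases z)
      have "ennreal (norm (remainder T (x, y))) \<le> ennreal (majorant T x (y - x) + majorant T y (x - y))"
        using T by (intro ennreal_leI remainder_le_majorant)
      then show "ennreal (norm (remainder T z)) \<le> g z + g (snd z, fst z)"
        by (simp add: z g_def majorant_nonneg)
    qed
    also have "\<dots> = (\<integral>\<^sup>+ z. g z \<partial>lborel) + (\<integral>\<^sup>+ z. g (snd z, fst z) \<partial>lborel)"
      unfolding lborel_prod[symmetric] by (intro nn_integral_add) auto
    also have "\<dots> = (\<integral>\<^sup>+ z. g z \<partial>lborel) + (\<integral>\<^sup>+ z. g z \<partial>lborel)"
      by (simp add: nn_integral_lborel_swap)
    also have "\<dots> \<le> ennreal (E * K0) + ennreal (E * K0)" by (intro add_mono g_int)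
    also have "\<dots> = ennreal (2 * (E * K0))" using E K0 by (simp flip: ennreal_plus)
    finally show "(\<integral>\<^sup>+ z. ennreal (norm (remainder T z)) \<partial>lborel) \<le> ennreal (2 * (E * K0))" .
  qed
qed

end

section \<open>Asymptotics of \<open>B\<close>\<close>

context fermi_singularity
begin

lemma B_integrand_measurable [measurable]: "B_integrand (fermi h \<mu> T) f \<in> borel_measurable borel"
proof -
  have "(\<lambda>z::real \<times> real. U (fermi h \<mu> T (fst z)) (fermi h \<mu> T (snd z)) f) \<in> borel_measurable (borel \<Otimes>\<^sub>M borel)"
    by (rule U_measurable) measurable
  then have "(\<lambda>z. U (fermi h \<mu> T (fst z)) (fermi h \<mu> T (snd z)) f /\<^sub>R \<bar>fst z - snd z\<bar>\<^sup>2) \<in> borel_measurable (borel \<Otimes>\<^sub>M borel)"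
    by measurable
  then show ?thesis by (simp add: B_integrand_def borel_prod split_beta')
qed

lemma remainder_measurable [measurable]: "remainder T \<in> borel_measurable borel"
  unfolding remainder_def by measurable

text \<open>Absolute integrability turns the truncated limit into a plain integral, by dominated
  convergence along sequences tending to 0 from the right.\<close>

lemma B_truncated_tendsto:
  assumes int: "integrable lborel (B_integrand (fermi h \<mu> T) f)"
  shows "B_exists (fermi h \<mu> T) f"
    and "B (fermi h \<mu> T) f = (1 / (8 * pi\<^sup>2)) *\<^sub>R (LINT z|lborel. B_integrand (fermi h \<mu> T) f z)"
proof -
  define F where "F = B_integrand (fermi h \<mu> T) f"
  have [measurable]: "F \<in> borel_measurable borel" unfolding F_def by measurable
  have "open (off_diagonal \<epsilon>)" for \<epsilon>
    unfolding off_diagonal_def split_beta' by (intro open_Collect_less continuous_intros)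
  then have off[measurable]: "off_diagonal \<epsilon> \<in> sets borel" for \<epsilon> by simp
  \<comment> \<open>No truncated region contains the diagonal; since the integrand is 0 there, the
    truncations converge at every point.\<close>
  have diag: "F z = 0" if "fst z = snd z" for z
    using that by (simp add: F_def B_integrand_def split_beta')
  have lim: "(B_truncated (fermi h \<mu> T) f \<longlongrightarrow> (LINT z|lborel. F z)) (at_right 0)"
  proof (rule tendsto_at_right_sequentially[of 0 1])
    fix S :: "nat \<Rightarrow> real" assume S: "\<And>n. 0 < S n" "S \<longlonglongrightarrow> 0"
    have "(\<lambda>n. LINT z|lborel. indicator (off_diagonal (S n)) z *\<^sub>R F z) \<longlonglongrightarrow> (LINT z|lborel. F z)"
    proof (rule integral_dominated_convergence[where w = "\<lambda>z. norm (F z)"])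
      show "integrable lborel (\<lambda>z. norm (F z))" using int by (simp add: F_def)
      show "AE z in lborel. (\<lambda>n. indicator (off_diagonal (S n)) z *\<^sub>R F z) \<longlonglongrightarrow> F z"
      proof (rule AE_I2)
        fix z :: "real \<times> real"
        show "(\<lambda>n. indicator (off_diagonal (S n)) z *\<^sub>R F z) \<longlonglongrightarrow> F z"
        proof (cases "fst z = snd z")
          case False
          then have "\<forall>\<^sub>F n in sequentially. S n < \<bar>fst z - snd z\<bar>"
            using S(2) by (intro order_tendstoD(2)) auto
          then have "\<forall>\<^sub>F n in sequentially. indicator (off_diagonal (S n)) z *\<^sub>R F z = F z"
            by eventually_elim (auto simp: off_diagonal_def split_beta')
          then show ?thesis by (rule tendsto_eventually)
        qed (simp add: diag)
      qed
    qed (auto simp: indicator_def)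
    then show "(\<lambda>n. B_truncated (fermi h \<mu> T) f (S n)) \<longlonglongrightarrow> (LINT z|lborel. F z)"
      by (simp add: B_truncated_def set_lebesgue_integral_def F_def)
  qed simp
  have "set_integrable lborel (off_diagonal \<epsilon>) F" for \<epsilon>
    using int unfolding set_integrable_def F_def[symmetric] by (intro integrable_mult_indicator) auto
  then show "B_exists (fermi h \<mu> T) f" using lim by (auto simp: B_exists_def F_def)
  show "B (fermi h \<mu> T) f = (1 / (8 * pi\<^sup>2)) *\<^sub>R (LINT z|lborel. B_integrand (fermi h \<mu> T) f z)"
    using tendsto_Lim[OF _ lim] by (simp add: B_def F_def)
qed

text \<open>The truncated kernel contributes 4 N |ln \<tau>| up to a bounded error, and 4 / (8 pi^2)
  = 1 / (2 pi^2).\<close>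

lemma B_asymptotics:
  obtains K T1 where "T1 > 0"
    "\<And>T. 0 < T \<Longrightarrow> T < T1 \<Longrightarrow> B_exists (fermi h \<mu> T) f"
    "\<And>T. 0 < T \<Longrightarrow> T < T1 \<Longrightarrow>
      norm (B (fermi h \<mu> T) f - (real (card (components \<Omega>)) / (2 * pi\<^sup>2)) *\<^sub>R U 1 0 f * of_real \<bar>ln T\<bar>) \<le> K"
proof -
  define A where "A = U 1 0 f"
  define N where "N = real (card (components \<Omega>))"
  obtain K1 T1 where K1: "K1 \<ge> 0" "T1 > 0"
    "\<And>T. 0 < T \<Longrightarrow> T < T1 \<Longrightarrow> (\<integral>\<^sup>+ z. ennreal (norm (remainder T z)) \<partial>lborel) \<le> ennreal K1"
    by (rule remainder_integral_bounded) (rule that)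
  obtain K2 \<tau>1 where K2: "\<tau>1 > 0"
    "\<And>\<tau>. 0 < \<tau> \<Longrightarrow> \<tau> < \<tau>1 \<Longrightarrow> integrable lborel (jump_kernel \<Omega> \<tau>)"
    "\<And>\<tau>. 0 < \<tau> \<Longrightarrow> \<tau> < \<tau>1 \<Longrightarrow> \<bar>(LINT z|lborel. jump_kernel \<Omega> \<tau> z) - 4 * real (card (components \<Omega>)) * \<bar>ln \<tau>\<bar>\<bar> \<le> K2"
    by (rule jump_kernel_sublevel_integral) (rule that)
  define K where "K = (1 / (8 * pi\<^sup>2)) * (K1 + (K2 + 4 * N * \<bar>ln scale0\<bar>) * norm A)"
  have main: "B_exists (fermi h \<mu> T) f \<and> norm (B (fermi h \<mu> T) f - (N / (2 * pi\<^sup>2)) *\<^sub>R A * of_real \<bar>ln T\<bar>) \<le> K"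
    if T: "0 < T" "T < min T1 (\<tau>1 * scale0)" for T
  proof -
    define \<tau> where "\<tau> = T / scale0"
    have \<tau>: "0 < \<tau>" "\<tau> < \<tau>1"
      using T scale0_ge_1 unfolding \<tau>_def by (auto simp: pos_divide_less_eq simp del: divide_divide_eq_left intro!: divide_pos_pos)
    define J where "J = (LINT z|lborel. jump_kernel \<Omega> \<tau> z)"
    have bound: "(\<integral>\<^sup>+ z. ennreal (norm (remainder T z)) \<partial>lborel) \<le> ennreal K1" using T by (intro K1) auto
    have rem: "integrable lborel (remainder T)"
      using bound by (intro integrableI_bounded) (auto intro: le_less_trans)
    have rem_le: "norm (LINT z|lborel. remainder T z) \<le> K1"
    proof -
      have "norm (LINT z|lborel. remainder T z) \<le> (LINT z|lborel. norm (remainder T z))"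
        by (rule integral_norm_bound)
      also have "ennreal (LINT z|lborel. norm (remainder T z)) \<le> ennreal K1"
        using bound rem by (subst nn_integral_eq_integral[symmetric]) auto
      then have "(LINT z|lborel. norm (remainder T z)) \<le> K1" using K1 by (simp add: ennreal_le_iff)
      finally show ?thesis .
    qed
    have jump: "integrable lborel (\<lambda>z. jump_kernel \<Omega> \<tau> z *\<^sub>R A)" using K2(2)[OF \<tau>] by simp
    have eq: "B_integrand (fermi h \<mu> T) f z = remainder T z + jump_kernel \<Omega> \<tau> z *\<^sub>R A" for z
      by (simp add: remainder_def \<tau>_def A_def)
    have int: "integrable lborel (B_integrand (fermi h \<mu> T) f)"
      unfolding eq[abs_def] using rem jump by simp
    have "(LINT z|lborel. B_integrand (fermi h \<mu> T) f z) = (LINT z|lborel. remainder T z) + J *\<^sub>R A"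
      unfolding eq[abs_def] J_def using rem jump K2(2)[OF \<tau>] by simp
    then have "B (fermi h \<mu> T) f - (N / (2 * pi\<^sup>2)) *\<^sub>R A * of_real \<bar>ln T\<bar> =
      (1 / (8 * pi\<^sup>2)) *\<^sub>R ((LINT z|lborel. remainder T z) + (J - 4 * N * \<bar>ln T\<bar>) *\<^sub>R A)"
      unfolding B_truncated_tendsto(2)[OF int] by (simp add: scaleR_conv_of_real field_simps)
    also have "norm \<dots> \<le> (1 / (8 * pi\<^sup>2)) * (norm (LINT z|lborel. remainder T z) + \<bar>J - 4 * N * \<bar>ln T\<bar>\<bar> * norm A)"
      using norm_triangle_ineq[of "LINT z|lborel. remainder T z" "(J - 4 * N * \<bar>ln T\<bar>) *\<^sub>R A"]
      by (simp add: divide_right_mono)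
    also have "\<dots> \<le> K"
    proof -
      \<comment> \<open>Passing from the cutoff T / scale0 to T changes the logarithm by a constant
        independent of T.\<close>
      have "ln \<tau> = ln T - ln scale0" unfolding \<tau>_def using T scale0_ge_1 by (intro ln_divide_pos) linarith+
      then have "\<bar>\<bar>ln \<tau>\<bar> - \<bar>ln T\<bar>\<bar> \<le> \<bar>ln scale0\<bar>" by linarith
      then have "\<bar>4 * N * \<bar>ln \<tau>\<bar> - 4 * N * \<bar>ln T\<bar>\<bar> \<le> 4 * N * \<bar>ln scale0\<bar>"
        by (simp add: N_def mult_left_mono abs_mult flip: right_diff_distrib)
      then have "\<bar>J - 4 * N * \<bar>ln T\<bar>\<bar> \<le> K2 + 4 * N * \<bar>ln scale0\<bar>"
        using K2(3)[OF \<tau>] unfolding J_def[symmetric] N_def[symmetric] by linarith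
      then show ?thesis unfolding K_def using rem_le by (intro mult_left_mono add_mono mult_right_mono) auto
    qed
    finally show ?thesis using B_truncated_tendsto(1)[OF int] by blast
  qed
  show thesis
  proof (rule that)
    show "0 < min T1 (\<tau>1 * scale0)" using K1(2) K2(1) scale0_ge_1 by simp
  qed (use main in \<open>auto simp: A_def N_def\<close>)
qed

end

lemma condition_H_dispersion:
  assumes "condition_H h \<mu>"
  obtains \<beta>1 c0 r0 \<beta>2 C1 where "dispersion h (nderiv 1 h) \<mu> \<beta>1 c0 r0 \<beta>2 C1"
proof -
  from assms have smooth: "\<And>n. C_on n UNIV h" and "\<And>x. h x = \<mu> \<Longrightarrow> deriv h x \<noteq> 0"
    and fin: "finite (components (sublevel h \<mu>))"
    unfolding condition_H_def by auto
  from assms obtain \<beta>1 c0 r0 where g: "\<beta>1 > 0" "c0 > 0" "\<And>x. \<bar>x\<bar> \<ge> r0 \<Longrightarrow> h x \<ge> c0 * \<bar>x\<bar> powr \<beta>1"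
    unfolding condition_H_def by blast
  from assms obtain \<beta>2 and Ck :: "nat \<Rightarrow> real" where d: "\<beta>2 \<ge> 0" "\<And>k x. k \<ge> 1 \<Longrightarrow> \<bar>nderiv k h x\<bar> \<le> Ck k * (1 + \<bar>x\<bar>) powr \<beta>2"
    unfolding condition_H_def by blast
  have h_deriv: "(h has_real_derivative nderiv 1 h x) (at x)" for x
    using C_on_has_vector_derivative[OF smooth[of 1], of 0 x]
    by (simp add: nderiv_def has_real_derivative_iff_has_vector_derivative)
  have "dispersion h (nderiv 1 h) \<mu> \<beta>1 c0 r0 \<beta>2 (max 1 (Ck 1))"
  proof
    show "continuous_on UNIV (nderiv 1 h)" using smooth[of 1] by (simp add: C_on_def)
    show "\<bar>nderiv 1 h x\<bar> \<le> max 1 (Ck 1) * (1 + \<bar>x\<bar>) powr \<beta>2" for x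
      by (rule order.trans[OF d(2)]) (auto intro: mult_right_mono)
    show "h x = \<mu> \<Longrightarrow> nderiv 1 h x \<noteq> 0" for x
      using \<open>h x = \<mu> \<Longrightarrow> deriv h x \<noteq> 0\<close> DERIV_imp_deriv[OF h_deriv[of x]] by simp
  qed (use h_deriv g d(1) fin in auto)
  then show thesis by (rule that)
qed

theorem theorem9p1:
  fixes \<mu> :: real and h :: "real \<Rightarrow> real" and N :: nat
    and f :: "real \<Rightarrow> complex" and t0 \<gamma> R :: real
  assumes "condition_H h \<mu>"
    and "N = card (components (sublevel h \<mu>))"
    and "condition_F 2 \<gamma> t0 R f"
    and "R \<le> 1"
  shows "(\<forall>s1 s2. U_exists s1 s2 f) \<and>
    (\<forall>\<^sub>F T in at_right 0. B_exists (fermi h \<mu> T) f) \<and>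
    (\<lambda>T. B (fermi h \<mu> T) f - (real N / (2 * pi\<^sup>2)) *\<^sub>R U 1 0 f * of_real \<bar>ln T\<bar>)
      \<in> O[at_right 0](\<lambda>_. 1)"
proof -
  obtain C where sing: "power_singularity f (nderiv 1 f) (nderiv 2 f) t0 (min \<gamma> 1) C"
    using assms(3,4) by (rule condition_F_power_singularity)
  obtain \<beta>1 c0 r0 \<beta>2 C1 where disp: "dispersion h (nderiv 1 h) \<mu> \<beta>1 c0 r0 \<beta>2 C1"
    using assms(1) by (rule condition_H_dispersion)
  interpret power_singularity f "nderiv 1 f" "nderiv 2 f" t0 "min \<gamma> 1" C by (rule sing)
  interpret dispersion h "nderiv 1 h" \<mu> \<beta>1 c0 r0 \<beta>2 C1 by (rule disp)
  obtain r where r: "r > 0" "\<And>x. h x \<le> \<mu> \<Longrightarrow> \<bar>x\<bar> < r" by (rule level_set_bounded) (rule that)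
  interpret fermi_singularity h "nderiv 1 h" \<mu> \<beta>1 c0 r0 \<beta>2 C1 f "nderiv 1 f" "nderiv 2 f" t0 "min \<gamma> 1" C "r + 3"
    by unfold_locales (use r in \<open>auto intro: less_imp_le\<close>)
  obtain K T1 where T1: "T1 > 0" and ex: "\<And>T. 0 < T \<Longrightarrow> T < T1 \<Longrightarrow> B_exists (fermi h \<mu> T) f"
    and bound: "\<And>T. 0 < T \<Longrightarrow> T < T1 \<Longrightarrow>
      norm (B (fermi h \<mu> T) f - (real (card (components \<Omega>)) / (2 * pi\<^sup>2)) *\<^sub>R U 1 0 f * of_real \<bar>ln T\<bar>) \<le> K"
    by (rule B_asymptotics) (rule that)
  have ev: "\<forall>\<^sub>F T in at_right 0. 0 < T \<and> T < T1"
    using eventually_at_right_real[OF T1] by (simp add: greaterThanLessThan_iff)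
  show ?thesis
  proof (intro conjI allI)
    show "U_exists s1 s2 f" for s1 s2 by (rule U_exists)
    show "\<forall>\<^sub>F T in at_right 0. B_exists (fermi h \<mu> T) f"
      using ev by eventually_elim (auto intro: ex)
    show "(\<lambda>T. B (fermi h \<mu> T) f - (real N / (2 * pi\<^sup>2)) *\<^sub>R U 1 0 f * of_real \<bar>ln T\<bar>) \<in> O[at_right 0](\<lambda>_. 1)"
      by (rule bigoI[where c = K], use ev in eventually_elim) (use bound assms(2) in auto)
  qed
qed

end
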